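(* Let $(X^{n+1},g,\rho^m\mathrm{dvol},m-1)$ be a compact smooth metric measure space with $m\in(-1,1)$ and boundary $M:=\partial X\neq\emptyset$ such that, in a collar neighborhood $\widetilde M=[0,\varepsilon)\times M$ of $M$ with first coordinate $r$, $$\rho=r\big(1+\Phi r^{1-m}+\rho_{(1)}r+o(r)\big)\quad\text{and}\quad g=\Big(\frac\rho r\Big)^2\big(dr^2+h+rh_{(1)}+o(r)\big),$$ where $\rho_{(1)},\Phi\in C^\infty(M)$, $h$ is a metric on $M$, and both $h_{(1)}$ and the $o(r)$ terms in the second formula are symmetric $(0,2)$-tensors on $M$. Let $\psi\in C^\infty(X)\cap C^0(\overline X)$, and suppose that $U\in C^\infty(X)\cap C^0(\overline X)$ is a nonnegative function such that $$-\Delta_\phi U+\psi U\ge0\quad\text{in }X.$$ If there are a point $q_0\in M$ and a constant $s_0>0$, sufficiently small (depending on the smooth metric measure space and on $\psi$), such that 1. $U(q_0)=0$, and 2. there is a point $p\in M$ such that $q_0\in\Gamma_{s_0}^0\setminus\overline{\Gamma_{s_0/2}^0}$ and $U>0$ on $\partial\Gamma_{s_0/2}^0$, where $\Gamma_s^0=\{x\in M: d(x,p)<s\}$, then $$\lim_{\rho\to0}\rho^m\frac{\partial U}{\partial\rho}(q_0,\rho)>0.$$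
   Context: For a smooth metric measure space $(X^{n+1},g,\rho^m\mathrm{dvol},m-1)$, $\overline X$ is an $(n+1)$-dimensional compact manifold with boundary $M$ and interior $X$ (on which smoothness is required), $g$ is a Riemannian metric, $\rho\geq0$ with $\rho^{-1}(0)=M$, and $\phi$ is defined in the interior by $\rho^m=e^{-\phi}$. The weighted Laplacian is $\Delta_\phi=\Delta-\langle\nabla\phi,\nabla\cdot\rangle=\Delta+m\rho^{-1}\langle\nabla\rho,\nabla\cdot\rangle$. The space may have limited regularity at $M$, as expressed by the stated expansions. The coordinate $r$ is the distance to $M$ with respect to the metric $(r/\rho)^2g=dr^2+h+rh_{(1)}+o(r)$. The distance $d(x,p)$ on $M$ is that of $h$. The derivative $\partial/\partial\rho$ is taken along the collar with $\rho$ replacing $r$ as the first coordinate.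
   Formalization: The limit as ρ→0 is not claimed to exist, since it can fail to: shown is that every limit (finite or infinite) of ρ^m ∂U/∂ρ(q_0,ρ) is positive and that its limsup is always positive. That ρ may replace r as coordinate is stated as ∂ρ/∂r>0 on the collar. *)

theory Defs
  imports "HOL-Analysis.Analysis"
begin

section \<open>Smooth maps\<close>

primrec Ck_on :: "nat \<Rightarrow> 'a::euclidean_space set \<Rightarrow> ('a \<Rightarrow> 'b::real_normed_vector) \<Rightarrow> bool" where
  "Ck_on 0 S f \<longleftrightarrow> continuous_on S f"
| "Ck_on (Suc k) S f \<longleftrightarrow> (\<forall>x\<in>S. f differentiable (at x)) \<and>
     (\<forall>b\<in>Basis. Ck_on k S (\<lambda>x. frechet_derivative f (at x) b))"

text \<open>On a set that need not be open, such as a relatively open subset of a half-space, smooth means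
  locally the restriction of a smooth map.\<close>

definition smooth_on :: "'a::euclidean_space set \<Rightarrow> ('a \<Rightarrow> 'b::real_normed_vector) \<Rightarrow> bool" where
  "smooth_on S f \<longleftrightarrow> (\<forall>x\<in>S. \<exists>W F. open W \<and> x \<in> W \<and> (\<forall>k. Ck_on k W F) \<and> (\<forall>y\<in>W \<inter> S. F y = f y))"

section \<open>Smooth manifolds with boundary\<close>

text \<open>The underlying space of the manifold with boundary is a whole type \<open>'x\<close>. For dimension
  \<open>n + 1\<close> the model space is \<open>real ^ ('n option)\<close> with \<open>n = CARD('n)\<close>; the index \<open>None\<close> is the
  coordinate transversal to the boundary.\<close>

type_synonym ('x, 'e) chart = "'x set \<times> ('x \<Rightarrow> 'e)"

definition halfspace :: "(real ^ ('n::finite option)) set" where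
  "halfspace = {v. 0 \<le> v $ None}"

definition chart_inv :: "('x, 'e) chart \<Rightarrow> 'e \<Rightarrow> 'x" where
  "chart_inv c = inv_into (fst c) (snd c)"

definition is_chart ::
  "'x::topological_space set \<Rightarrow> 'e::euclidean_space set \<Rightarrow> ('x, 'e) chart \<Rightarrow> bool" where
  "is_chart S H c \<longleftrightarrow>
     openin (top_of_set S) (fst c) \<and> openin (top_of_set H) (snd c ` fst c) \<and>
     homeomorphism (fst c) (snd c ` fst c) (snd c) (chart_inv c)"

definition compatible :: "('x, 'e::euclidean_space) chart \<Rightarrow> ('x, 'e) chart \<Rightarrow> bool" where
  "compatible c c' \<longleftrightarrow>
     smooth_on (snd c ` (fst c \<inter> fst c')) (snd c' \<circ> chart_inv c) \<and>
     smooth_on (snd c' ` (fst c \<inter> fst c')) (snd c \<circ> chart_inv c')"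

definition manifold_with_boundary ::
  "('x::{t2_space, second_countable_topology}, real ^ ('n::finite option)) chart set \<Rightarrow> bool" where
  "manifold_with_boundary A \<longleftrightarrow>
     (\<Union>c\<in>A. fst c) = UNIV \<and> (\<forall>c\<in>A. is_chart UNIV halfspace c) \<and>
     (\<forall>c\<in>A. \<forall>c'\<in>A. compatible c c')"

definition bdry :: "('x, real ^ ('n::finite option)) chart set \<Rightarrow> 'x set" where
  "bdry A = {q. \<exists>c\<in>A. q \<in> fst c \<and> snd c q $ None = 0}"

definition manifold_interior :: "('x, real ^ ('n::finite option)) chart set \<Rightarrow> 'x set" where
  "manifold_interior A = - bdry A"

definition bdry_charts ::
  "('x, real ^ ('n::finite option)) chart set \<Rightarrow> ('x, real ^ 'n) chart set" where
  "bdry_charts A = (\<lambda>c. (fst c \<inter> bdry A, \<lambda>q. \<chi> i. snd c q $ Some i)) ` A"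

text \<open>The maximal smooth atlas of the interior.\<close>

definition inner_charts ::
  "('x::topological_space, real ^ ('n::finite option)) chart set \<Rightarrow> ('x, real ^ ('n option)) chart set"
  where
  "inner_charts A = {c. is_chart (manifold_interior A) UNIV c \<and> (\<forall>c'\<in>A. compatible c c')}"

definition smooth_function ::
  "('x, 'e::euclidean_space) chart set \<Rightarrow> ('x \<Rightarrow> real) \<Rightarrow> bool" where
  "smooth_function B u \<longleftrightarrow> (\<forall>c\<in>B. smooth_on (snd c ` fst c) (u \<circ> chart_inv c))"

section \<open>Tensors and Riemannian metrics\<close>

text \<open>A \<open>(0,2)\<close>-tensor is given by its component matrix in every chart of an atlas \<open>B\<close>
  of a manifold without boundary, subject to the transformation law.\<close>

type_synonym ('x, 'k) tensor2 = "('x, real ^ 'k) chart \<Rightarrow> 'x \<Rightarrow> real ^ 'k ^ 'k"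

definition transition_matrix ::
  "('x, real ^ 'k::finite) chart \<Rightarrow> ('x, real ^ 'k) chart \<Rightarrow> 'x \<Rightarrow> real ^ 'k ^ 'k" where
  "transition_matrix c c' q = matrix (frechet_derivative (snd c' \<circ> chart_inv c) (at (snd c q)))"

definition symmetric_tensor ::
  "('x, real ^ 'k::finite) chart set \<Rightarrow> ('x, 'k) tensor2 \<Rightarrow> bool" where
  "symmetric_tensor B t \<longleftrightarrow>
     (\<forall>c\<in>B. \<forall>q\<in>fst c. transpose (t c q) = t c q) \<and>
     (\<forall>c\<in>B. \<forall>c'\<in>B. \<forall>q\<in>fst c \<inter> fst c'.
        t c q = transpose (transition_matrix c c' q) ** t c' q ** transition_matrix c c' q)"

definition smooth_tensor ::
  "('x, real ^ 'k::finite) chart set \<Rightarrow> ('x, 'k) tensor2 \<Rightarrow> bool" where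
  "smooth_tensor B t \<longleftrightarrow> (\<forall>c\<in>B. smooth_on (snd c ` fst c) (t c \<circ> chart_inv c))"

definition riemannian_metric ::
  "('x, real ^ 'k::finite) chart set \<Rightarrow> ('x, 'k) tensor2 \<Rightarrow> bool" where
  "riemannian_metric B g \<longleftrightarrow> symmetric_tensor B g \<and> smooth_tensor B g \<and>
     (\<forall>c\<in>B. \<forall>q\<in>fst c. \<forall>v. v \<noteq> 0 \<longrightarrow> 0 < v \<bullet> (g c q *v v))"

subsection \<open>The weighted Laplacian\<close>

definition pderivative :: "'k::finite \<Rightarrow> (real ^ 'k \<Rightarrow> real) \<Rightarrow> real ^ 'k \<Rightarrow> real" where
  "pderivative i f x = frechet_derivative f (at x) (axis i 1)"

definition laplacian ::
  "('x, 'k::finite) tensor2 \<Rightarrow> ('x, real ^ 'k) chart \<Rightarrow> ('x \<Rightarrow> real) \<Rightarrow> 'x \<Rightarrow> real" where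
  "laplacian g c u q =
     (let G = g c \<circ> chart_inv c; w = u \<circ> chart_inv c; x = snd c q in
        (\<Sum>i\<in>UNIV. pderivative i
            (\<lambda>y. sqrt (det (G y)) * (\<Sum>j\<in>UNIV. matrix_inv (G y) $ i $ j * pderivative j w y)) x)
        / sqrt (det (G x)))"

definition grad_inner ::
  "('x, 'k::finite) tensor2 \<Rightarrow> ('x, real ^ 'k) chart \<Rightarrow> ('x \<Rightarrow> real) \<Rightarrow> ('x \<Rightarrow> real) \<Rightarrow> 'x \<Rightarrow> real"
  where
  "grad_inner g c u v q =
     (\<Sum>i\<in>UNIV. \<Sum>j\<in>UNIV. matrix_inv (g c q) $ i $ j *
        pderivative i (u \<circ> chart_inv c) (snd c q) * pderivative j (v \<circ> chart_inv c) (snd c q))"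

text \<open>The value does not depend on the chart \<open>c\<close> around \<open>q\<close>.\<close>

definition weighted_laplacian ::
  "('x, 'k::finite) tensor2 \<Rightarrow> ('x \<Rightarrow> real) \<Rightarrow> ('x, real ^ 'k) chart \<Rightarrow> ('x \<Rightarrow> real) \<Rightarrow> 'x \<Rightarrow> real"
  where
  "weighted_laplacian g \<phi> c u q = laplacian g c u q - grad_inner g c \<phi> u q"

subsection \<open>The Riemannian distance\<close>

text \<open>Lengths are taken in the extended nonnegative reals, so a curve that is not rectifiable has
  infinite length, and points that no curve joins are at infinite distance.\<close>

definition speed ::
  "('x, real ^ 'k::finite) chart set \<Rightarrow> ('x, 'k) tensor2 \<Rightarrow> (real \<Rightarrow> 'x) \<Rightarrow> real \<Rightarrow> real" where
  "speed B h \<gamma> t =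
     (let c = (SOME c. c \<in> B \<and> \<gamma> t \<in> fst c); v = vector_derivative (snd c \<circ> \<gamma>) (at t)
      in sqrt (v \<bullet> (h c (\<gamma> t) *v v)))"

definition piecewise_C1_curve ::
  "('x::topological_space, real ^ 'k::finite) chart set \<Rightarrow> (real \<Rightarrow> 'x) \<Rightarrow> bool" where
  "piecewise_C1_curve B \<gamma> \<longleftrightarrow>
     continuous_on {0..1} \<gamma> \<and> \<gamma> ` {0..1} \<subseteq> (\<Union>c\<in>B. fst c) \<and>
     (\<exists>S. finite S \<and>
        (\<forall>c\<in>B. (snd c \<circ> \<gamma>) C1_differentiable_on ({t\<in>{0<..<1}. \<gamma> t \<in> fst c} - S)))"

definition riemannian_dist ::
  "('x::topological_space, real ^ 'k::finite) chart set \<Rightarrow> ('x, 'k) tensor2 \<Rightarrow> 'x \<Rightarrow> 'x \<Rightarrow> ennreal"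
  where
  "riemannian_dist B h x y =
     (INF \<gamma>\<in>{\<gamma>. piecewise_C1_curve B \<gamma> \<and> \<gamma> 0 = x \<and> \<gamma> 1 = y}.
        \<integral>\<^sup>+t\<in>{0..1}. ennreal (speed B h \<gamma> t) \<partial>lborel)"

definition boundary_ball ::
  "('x::topological_space, real ^ ('n::finite option)) chart set \<Rightarrow> ('x, 'n) tensor2 \<Rightarrow>
   'x \<Rightarrow> real \<Rightarrow> 'x set" where
  "boundary_ball A h p s = {x\<in>bdry A. riemannian_dist (bdry_charts A) h x p < ennreal s}"

section \<open>The collar\<close>

text \<open>The chart \<open>(r, y)\<close> of the interior obtained from a chart \<open>y\<close> of the boundary and a
  collar \<open>\<kappa>\<close>.\<close>

definition collar_chart ::
  "('x, real ^ ('n::finite option)) chart set \<Rightarrow> real \<Rightarrow> (real \<times> 'x \<Rightarrow> 'x) \<Rightarrow>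
   ('x, real ^ 'n) chart \<Rightarrow> ('x, real ^ ('n option)) chart" where
  "collar_chart A \<epsilon> \<kappa> d =
     (\<kappa> ` ({0<..<\<epsilon>} \<times> fst d),
      \<lambda>q. let z = inv_into ({0..<\<epsilon>} \<times> bdry A) \<kappa> q
          in \<chi> k. case k of None \<Rightarrow> fst z | Some i \<Rightarrow> snd d (snd z) $ i)"

text \<open>Because of the limited regularity at the boundary, a collar is only required to be a
  homeomorphism; away from the boundary it is a diffeomorphism. That \<open>r\<close> is the distance to the
  boundary for \<open>(r / \<rho>)\<^sup>2 g\<close> is a consequence of the form of this metric in the collar, in
  \<open>metric_expansion\<close> below.\<close>

definition is_collar ::
  "('x::topological_space, real ^ ('n::finite option)) chart set \<Rightarrow> real \<Rightarrow>
   (real \<times> 'x \<Rightarrow> 'x) \<Rightarrow> bool" where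
  "is_collar A \<epsilon> \<kappa> \<longleftrightarrow> 0 < \<epsilon> \<and>
     (\<forall>x\<in>bdry A. \<kappa> (0, x) = x) \<and>
     open (\<kappa> ` ({0..<\<epsilon>} \<times> bdry A)) \<and>
     (\<exists>\<kappa>'. homeomorphism ({0..<\<epsilon>} \<times> bdry A) (\<kappa> ` ({0..<\<epsilon>} \<times> bdry A)) \<kappa> \<kappa>') \<and>
     (\<forall>d\<in>bdry_charts A. collar_chart A \<epsilon> \<kappa> d \<in> inner_charts A)"

text \<open>The matrix of \<open>dr\<^sup>2 + t\<close> in a collar chart.\<close>

definition dr2_plus :: "real ^ 'n ^ 'n \<Rightarrow> real ^ ('n::finite option) ^ ('n option)" where
  "dr2_plus t = (\<chi> k l. case (k, l) of
      (None, None) \<Rightarrow> 1 | (Some i, Some j) \<Rightarrow> t $ i $ j | _ \<Rightarrow> 0)"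

text \<open>The remainders \<open>o(r)\<close> are uniform on the boundary; for tensors size is measured by \<open>h\<close>, as
  the supremum over the \<open>h\<close>-unit tangent vectors, which suffices by symmetry.\<close>

definition rho_expansion ::
  "('x, real ^ ('n::finite option)) chart set \<Rightarrow> (real \<times> 'x \<Rightarrow> 'x) \<Rightarrow> real \<Rightarrow>
   ('x \<Rightarrow> real) \<Rightarrow> ('x \<Rightarrow> real) \<Rightarrow> ('x \<Rightarrow> real) \<Rightarrow> bool" where
  "rho_expansion A \<kappa> m \<rho> \<Phi> \<rho>1 \<longleftrightarrow>
     uniform_limit (bdry A)
       (\<lambda>r x. (\<rho> (\<kappa> (r, x)) / r - (1 + \<Phi> x * r powr (1 - m) + \<rho>1 x * r)) / r) (\<lambda>x. 0) (at_right 0)"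

definition metric_expansion ::
  "('x, real ^ ('n::finite option)) chart set \<Rightarrow> real \<Rightarrow> (real \<times> 'x \<Rightarrow> 'x) \<Rightarrow>
   ('x \<Rightarrow> real) \<Rightarrow> ('x, 'n option) tensor2 \<Rightarrow> ('x, 'n) tensor2 \<Rightarrow> ('x, 'n) tensor2 \<Rightarrow> bool" where
  "metric_expansion A \<epsilon> \<kappa> \<rho> g h h1 \<longleftrightarrow>
     (\<exists>e :: real \<Rightarrow> ('x, 'n) tensor2.
        (\<forall>r\<in>{0<..<\<epsilon>}. symmetric_tensor (bdry_charts A) (e r)) \<and>
        (\<forall>d\<in>bdry_charts A. \<forall>x\<in>fst d. \<forall>r\<in>{0<..<\<epsilon>}.
           g (collar_chart A \<epsilon> \<kappa> d) (\<kappa> (r, x)) =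
             (\<rho> (\<kappa> (r, x)) / r)\<^sup>2 *\<^sub>R dr2_plus (h d x + r *\<^sub>R h1 d x + e r d x)) \<and>
        uniform_limit
          {(d, x, v). d \<in> bdry_charts A \<and> x \<in> fst d \<and> v \<bullet> (h d x *v v) = 1}
          (\<lambda>r (d, x, v). v \<bullet> (e r d x *v v) / r) (\<lambda>_. 0) (at_right 0))"

text \<open>The expansions say nothing about derivatives of the remainders, so it has to be said separately that
  \<open>\<rho>\<close> may replace \<open>r\<close> as first coordinate of the collar.\<close>

definition rho_is_coordinate ::
  "('x, real ^ ('n::finite option)) chart set \<Rightarrow> real \<Rightarrow> (real \<times> 'x \<Rightarrow> 'x) \<Rightarrow>
   ('x \<Rightarrow> real) \<Rightarrow> bool" where
  "rho_is_coordinate A \<epsilon> \<kappa> \<rho> \<longleftrightarrow>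
     (\<forall>x\<in>bdry A. \<forall>r\<in>{0<..<\<epsilon>}. 0 < deriv (\<lambda>r. \<rho> (\<kappa> (r, x))) r)"

definition in_rho_coordinate ::
  "real \<Rightarrow> (real \<times> 'x \<Rightarrow> 'x) \<Rightarrow> ('x \<Rightarrow> real) \<Rightarrow> ('x \<Rightarrow> real) \<Rightarrow> 'x \<Rightarrow> real \<Rightarrow> real" where
  "in_rho_coordinate \<epsilon> \<kappa> \<rho> u x \<sigma> = u (\<kappa> (THE r. r \<in> {0<..<\<epsilon>} \<and> \<rho> (\<kappa> (r, x)) = \<sigma>, x))"

definition rho_derivative ::
  "real \<Rightarrow> (real \<times> 'x \<Rightarrow> 'x) \<Rightarrow> ('x \<Rightarrow> real) \<Rightarrow> ('x \<Rightarrow> real) \<Rightarrow> 'x \<Rightarrow> real \<Rightarrow> real" where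
  "rho_derivative \<epsilon> \<kappa> \<rho> u x \<sigma> = deriv (in_rho_coordinate \<epsilon> \<kappa> \<rho> u x) \<sigma>"

end

theory Submission
  imports Defs
begin

text \<open>
In a collar chart \<open>(r, y)\<close> the inequality reads \<open>div (a grad U) \<le> C r\<^sup>m U\<close>, where \<open>a\<close> differs from
\<open>r\<^sup>m b\<close>, with \<open>b\<close> constant, by at most \<open>r\<^sup>m\<close> times a power of the distance to \<open>(0, q\<^sub>0)\<close>. The
expansions give no control of the derivatives of \<open>a\<close>, so the usual pointwise barrier argument does
not apply. Barriers for \<open>div (r\<^sup>m b grad)\<close> are instead compared with \<open>U\<close> in the divergence form of
the equation, where the perturbation enters only through its size, and a De Giorgi--Stampacchia
bound makes the error small of higher order on a cylinder of radius \<open>R\<close>. Iterating over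
\<open>R = R\<^sub>1 q\<^sup>k\<close>, with barriers that contract the error relative to \<open>r\<^sup>1\<^sup>-\<^sup>m\<close>, gives
\<open>U \<ge> c r\<^sup>1\<^sup>-\<^sup>m\<close> at the points \<open>(R\<^sub>1 q\<^sup>k, q\<^sub>0)\<close>, and this contradicts
\<open>limsup \<rho>\<^sup>m \<partial>U/\<partial>\<rho> \<le> 0\<close>. The positivity that starts the iteration spreads by the strong maximum
principle from \<open>\<partial>\<Gamma>\<^bsub>s\<^sub>0/2\<^esub>\<close>, which every curve in \<open>M\<close> from \<open>q\<^sub>0\<close> to \<open>p\<close> meets.
\<close>

section \<open>Integration by parts\<close>

text \<open>The barrier is \<open>A r^(1-m) - T (|y - y0|^2 - ct r^2)\<close>, a combination of two
  solutions of the model equation: the first carries the growth, the second pushes the barrier below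
  U on the lateral side of the cylinder. When the radius passes from R to \<theta> R, the quadratic
  term shrinks by \<theta>^2, the admissible error R^(1-m+\<beta>) only by \<theta>^(1-m+\<beta>).
  Since \<beta> < 1 + m, some \<theta> < 1 makes the quotient of these factors 1/4, and this is the
  contraction. The perturbation costs R^\<alpha> together with losses R^(-2 \<beta>'), where
  \<beta>' = \<beta> / (1 - m), because r^m oscillates on the set where the comparison takes place;
  \<beta> is small enough for the gain to win. The factor in front of r^(1-m) loses a relative
  amount of order R^\<beta> at each step. Along R1 \<theta>^k these losses form a geometric series,
  so a positive constant survives. The sign of m never enters: on the relevant set r / R is at least
  R^\<beta>', and |m| < 1 bounds both (r / R)^m and its inverse.\<close>

lemma gradient_eq_0_off_support:
  fixes f :: "'a::euclidean_space \<Rightarrow> real"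
  assumes f: "\<And>x. (f has_derivative (\<lambda>h. Df x \<bullet> h)) (at x)"
    and K: "closed K" "\<And>x. x \<notin> K \<Longrightarrow> f x = 0" and x: "x \<notin> K"
  shows "Df x = 0"
proof -
  have "(f has_derivative (\<lambda>h. 0)) (at x)"
    by (rule has_derivative_transform_within_open[of "\<lambda>_. 0" _ _ _ "- K"])
       (use K x in \<open>auto intro: has_derivative_const\<close>)
  then have "(\<lambda>h. Df x \<bullet> h) = (\<lambda>h. 0)"
    using f has_derivative_unique by blast
  then have "Df x \<bullet> Df x = 0" by meson
  then show ?thesis by simp
qed

lemma integrable_continuous_compact_support:
  fixes f :: "'a::euclidean_space \<Rightarrow> real"
  assumes "continuous_on UNIV f" "compact K" "\<And>x. x \<notin> K \<Longrightarrow> f x = 0"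
  shows "integrable lborel f"
proof -
  have "integrable lborel (\<lambda>x. indicat_real K x *\<^sub>R f x)"
    by (rule borel_integrable_compact[OF assms(2) continuous_on_subset[OF assms(1)]]) simp
  moreover have "(\<lambda>x. indicat_real K x *\<^sub>R f x) = f"
    using assms(3) by (auto simp: indicator_def fun_eq_iff)
  ultimately show ?thesis by simp
qed

lemma nn_integral_lborel_translate:
  fixes g :: "'a::euclidean_space \<Rightarrow> ennreal"
  assumes "g \<in> borel_measurable borel"
  shows "(\<integral>\<^sup>+x. g (v + x) \<partial>lborel) = (\<integral>\<^sup>+x. g x \<partial>lborel)"
proof -
  have "(\<integral>\<^sup>+x. g x \<partial>lborel) = (\<integral>\<^sup>+x. g x \<partial>(distr lborel borel ((+) v)))"
    by (simp add: lborel_distr_plus)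
  also have "\<dots> = (\<integral>\<^sup>+x. g (v + x) \<partial>lborel)"
    by (rule nn_integral_distr) (use assms in auto)
  finally show ?thesis by simp
qed

lemma integral_lborel_translate:
  fixes g :: "'a::euclidean_space \<Rightarrow> real"
  assumes "g \<in> borel_measurable borel"
  shows "(\<integral>x. g (v + x) \<partial>lborel) = (\<integral>x. g x \<partial>lborel)"
proof -
  have "(\<integral>x. g x \<partial>lborel) = (\<integral>x. g x \<partial>(distr lborel borel ((+) v)))"
    by (simp add: lborel_distr_plus)
  also have "\<dots> = (\<integral>x. g (v + x) \<partial>lborel)"
    by (rule integral_distr) (use assms in auto)
  finally show ?thesis by simp
qed

lemma directional_difference_le:
  fixes f :: "'a::euclidean_space \<Rightarrow> real"
  assumes f: "\<And>x. (f has_derivative (\<lambda>h. Df x \<bullet> h)) (at x)"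
    and B: "\<And>x. norm (Df x) \<le> B"
  shows "\<bar>f (x + v) - f x\<bar> \<le> B * norm v"
proof -
  have "norm (f (x + v) - f x) \<le> B * norm (x + v - x)"
  proof (rule differentiable_bound[of UNIV f "\<lambda>x h. Df x \<bullet> h"])
    fix x
    show "onorm (\<lambda>h. Df x \<bullet> h) \<le> B"
    proof (rule onorm_le)
      fix h show "norm (Df x \<bullet> h) \<le> B * norm h"
        using Cauchy_Schwarz_ineq2[of "Df x" h] mult_right_mono[OF B[of x], of "norm h"] by simp
    qed
  qed (use f in auto)
  then show ?thesis by simp
qed

lemma bounded_continuous_compact_support:
  fixes g :: "'a::euclidean_space \<Rightarrow> 'b::real_normed_vector"
  assumes "continuous_on UNIV g" "compact K" "\<And>x. x \<notin> K \<Longrightarrow> g x = 0"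
  obtains B where "B \<ge> 0" "\<And>x. norm (g x) \<le> B"
proof -
  have "bounded (g ` K)"
    by (meson assms(1,2) compact_continuous_image compact_imp_bounded continuous_on_subset subset_UNIV)
  then obtain B where B: "\<And>x. x \<in> K \<Longrightarrow> norm (g x) \<le> B" by (auto simp: bounded_iff)
  have "norm (g x) \<le> max B 0" for x
    using B[of x] assms(3)[of x] by (cases "x \<in> K") auto
  then show thesis by (intro that[of "max B 0"]) auto
qed

text \<open>Integrals are invariant under translation, so the derivative of a translated integral
  vanishes.\<close>

lemma integral_partial_derivative_eq_0:
  fixes f :: "'a::euclidean_space \<Rightarrow> real"
  assumes f: "\<And>x. (f has_derivative (\<lambda>h. Df x \<bullet> h)) (at x)"
    and Df: "continuous_on UNIV Df"
    and K: "compact K" "\<And>x. x \<notin> K \<Longrightarrow> f x = 0"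
  shows "(\<integral>x. Df x \<bullet> b \<partial>lborel) = 0"
proof -
  have Df0: "Df x = 0" if "x \<notin> K" for x
    using gradient_eq_0_off_support[OF f compact_imp_closed[OF K(1)] K(2) that] by simp
  have cf: "continuous_on UNIV f"
    by (rule has_derivative_continuous_on) (use f in auto)
  then have mf: "f \<in> borel_measurable borel" by (rule borel_measurable_continuous_onI)
  obtain B where B: "B \<ge> 0" "\<And>x. norm (Df x) \<le> B"
    using bounded_continuous_compact_support[OF Df K(1) Df0] by metis
  obtain e where e: "\<And>x. x \<in> K \<Longrightarrow> norm x \<le> e"
    using K(1) compact_imp_bounded bounded_iff by metis
  define t where "t n = inverse (real (Suc n))" for n
  have t: "0 < t n" "t n \<le> 1" for n by (auto simp: t_def field_simps)
  define q where "q n x = (f (t n *\<^sub>R b + x) - f x) / t n" for n x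
  have fi: "integrable lborel f" by (rule integrable_continuous_compact_support[OF cf K])
  have fti: "integrable lborel (\<lambda>x. f (v + x))" for v
  proof (rule integrable_continuous_compact_support)
    show "continuous_on UNIV (\<lambda>x. f (v + x))"
      by (rule continuous_on_compose2[OF cf]) (auto intro!: continuous_intros)
    show "compact ((+) (- v) ` K)" using K(1) by (rule compact_translation)
    fix x assume x: "x \<notin> (+) (- v) ` K"
    have "v + x \<notin> K"
    proof
      assume "v + x \<in> K"
      then have "(- v) + (v + x) \<in> (+) (- v) ` K" by blast
      then show False using x by simp
    qed
    then show "f (v + x) = 0" by (rule K(2))
  qed
  have qi: "(\<integral>x. q n x \<partial>lborel) = 0" for n
    unfolding q_def using integral_lborel_translate[OF mf, of "t n *\<^sub>R b"] fi fti by simp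
  have "(\<lambda>n. \<integral>x. q n x \<partial>lborel) \<longlonglongrightarrow> (\<integral>x. Df x \<bullet> b \<partial>lborel)"
  proof (rule integral_dominated_convergence)
    show "(\<lambda>x. Df x \<bullet> b) \<in> borel_measurable lborel"
      by (simp, intro borel_measurable_continuous_onI continuous_intros Df)
    show "q n \<in> borel_measurable lborel" for n
      unfolding q_def using fi fti by (intro borel_measurable_integrable) simp
    \<comment> \<open>All steps \<open>t n\<close> are at most 1, so the difference quotients vanish
      outside one fixed ball, and there the Lipschitz bound \<open>B * norm b\<close> dominates
      them.\<close>
    show "integrable lborel (\<lambda>x. indicat_real (cball (0::'a) (e + norm b)) x *\<^sub>R (B * norm b))"
      by (rule borel_integrable_compact) (auto intro: continuous_intros)
    show "AE x in lborel. (\<lambda>n. q n x) \<longlonglongrightarrow> Df x \<bullet> b"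
    proof (rule AE_I2)
      fix x
      have "((\<lambda>s. f (s *\<^sub>R b + x)) has_derivative (\<lambda>s. Df x \<bullet> (s *\<^sub>R b))) (at 0)"
      proof -
        have "((\<lambda>s. s *\<^sub>R b + x) has_derivative (\<lambda>s. s *\<^sub>R b)) (at 0)"
          by (auto intro!: derivative_eq_intros)
        moreover have "(f has_derivative (\<lambda>h. Df x \<bullet> h)) (at (0 *\<^sub>R b + x))" using f by simp
        ultimately show ?thesis by (rule has_derivative_compose)
      qed
      then have "((\<lambda>s. f (s *\<^sub>R b + x)) has_field_derivative (Df x \<bullet> b)) (at 0)"
        by (simp add: has_field_derivative_def inner_scaleR_right mult_commute_abs)
      then have "((\<lambda>h. (f (h *\<^sub>R b + x) - f x) / h) \<longlongrightarrow> Df x \<bullet> b) (at 0)"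
        by (simp add: has_field_derivative_iff)
      moreover have "filterlim t (at 0) sequentially"
      proof (rule tendsto_imp_filterlim_at_right[THEN filterlim_mono])
        show "t \<longlonglongrightarrow> 0" unfolding t_def by (rule LIMSEQ_inverse_real_of_nat)
        show "\<forall>\<^sub>F n in sequentially. t n > 0" using t by simp
      qed (auto simp: at_le)
      ultimately show "(\<lambda>n. q n x) \<longlonglongrightarrow> Df x \<bullet> b"
        unfolding q_def by (rule filterlim_compose)
    qed
    fix n
    show "AE x in lborel. norm (q n x) \<le> indicat_real (cball (0::'a) (e + norm b)) x *\<^sub>R (B * norm b)"
    proof (rule AE_I2)
      fix x
      show "norm (q n x) \<le> indicat_real (cball (0::'a) (e + norm b)) x *\<^sub>R (B * norm b)"
      proof (cases "x \<in> cball 0 (e + norm b)")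
        case True
        have "\<bar>f (x + t n *\<^sub>R b) - f x\<bar> \<le> B * norm (t n *\<^sub>R b)"
          using directional_difference_le[OF f B(2)] .
        then show ?thesis using True t[of n] by (simp add: q_def field_simps add.commute)
      next
        case False
        then have x: "norm x > e + norm b" by simp
        have "norm (t n *\<^sub>R b) \<le> norm b" using t[of n] by (simp add: mult_left_le_one_le)
        then have "norm (t n *\<^sub>R b + x) > e"
          using x norm_triangle_ineq2[of x "- (t n *\<^sub>R b)"] by (simp add: add.commute)
        then have "f (t n *\<^sub>R b + x) = 0" "f x = 0"
          using e[of "t n *\<^sub>R b + x"] e[of x] x K(2) norm_ge_zero[of b] by (smt (verit))+
        then show ?thesis using False by (simp add: q_def)
      qed
    qed
  qed
  then show ?thesis using qi by (simp add: LIMSEQ_const_iff)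
qed


text \<open>Integrate the derivative along the segment from \<open>x\<close> to \<open>x + v\<close>
  and exchange the integrals: by translation invariance, each time t contributes the full integral
  of \<open>norm (Du x)\<close>.\<close>

lemma nn_integral_difference_le:
  fixes u :: "'a::euclidean_space \<Rightarrow> real"
  assumes u: "\<And>x. (u has_derivative (\<lambda>h. Du x \<bullet> h)) (at x)"
    and Du: "continuous_on UNIV Du"
  shows "(\<integral>\<^sup>+x. ennreal \<bar>u (x + v) - u x\<bar> \<partial>lborel) \<le> ennreal (norm v) * (\<integral>\<^sup>+x. ennreal (norm (Du x)) \<partial>lborel)"
proof -
  have mg: "(\<lambda>x. ennreal (norm (Du x))) \<in> borel_measurable borel"
    by (intro measurable_compose[OF _ measurable_ennreal] borel_measurable_continuous_onI continuous_intros Du)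
  have mg2: "(\<lambda>(x, t). ennreal (norm (Du (x + t *\<^sub>R v))) * indicator {0..1::real} t)
      \<in> borel_measurable (lborel \<Otimes>\<^sub>M lborel)"
  proof -
    have "(\<lambda>z::'a \<times> real. norm (Du (fst z + snd z *\<^sub>R v))) \<in> borel_measurable borel"
      by (intro borel_measurable_continuous_onI continuous_on_norm continuous_on_compose2[OF Du] continuous_intros) auto
    then have "(\<lambda>z::'a \<times> real. norm (Du (fst z + snd z *\<^sub>R v))) \<in> borel_measurable (borel \<Otimes>\<^sub>M borel)"
      by (simp add: borel_prod)
    then have m: "(\<lambda>z::'a \<times> real. norm (Du (fst z + snd z *\<^sub>R v))) \<in> borel_measurable (lborel \<Otimes>\<^sub>M lborel)"
      by (simp add: measurable_lborel1 cong: measurable_cong_sets sets_pair_measure_cong)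
    show ?thesis unfolding case_prod_beta
      using m by measurable
  qed
  have pt: "ennreal \<bar>u (x + v) - u x\<bar> \<le> (\<integral>\<^sup>+t. ennreal (norm (Du (x + t *\<^sub>R v))) * indicator {0..1::real} t \<partial>lborel) * ennreal (norm v)"
    for x
  proof -
    have c: "continuous_on {0..1::real} (\<lambda>t. Du (x + t *\<^sub>R v) \<bullet> v)"
      by (intro continuous_intros continuous_on_compose2[OF Du]) auto
    have c2: "continuous_on {0..1::real} (\<lambda>t. norm (Du (x + t *\<^sub>R v)) * norm v)"
      by (intro continuous_intros continuous_on_compose2[OF Du]) auto
    have d: "((\<lambda>t. u (x + t *\<^sub>R v)) has_vector_derivative (Du (x + t *\<^sub>R v) \<bullet> v)) (at t within {0..1})" for t
    proof -
      have "((\<lambda>t. x + t *\<^sub>R v) has_derivative (\<lambda>t. t *\<^sub>R v)) (at t within {0..1})"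
        by (auto intro!: derivative_eq_intros)
      from has_derivative_compose[OF this u]
      show ?thesis by (simp add: has_vector_derivative_def inner_scaleR_right)
    qed
    have "((\<lambda>t. Du (x + t *\<^sub>R v) \<bullet> v) has_integral (u (x + 1 *\<^sub>R v) - u (x + 0 *\<^sub>R v))) {0..1}"
      by (rule fundamental_theorem_of_calculus) (use d in auto)
    then have "u (x + v) - u x = integral {0..1} (\<lambda>t. Du (x + t *\<^sub>R v) \<bullet> v)"
      by (simp add: integral_unique)
    then have "\<bar>u (x + v) - u x\<bar> \<le> integral {0..1} (\<lambda>t. norm (Du (x + t *\<^sub>R v)) * norm v)"
      using integral_norm_bound_integral[OF integrable_continuous_interval[OF c] integrable_continuous_interval[OF c2]]
      by (simp add: Cauchy_Schwarz_ineq2)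
    also have "ennreal \<dots> = (\<integral>\<^sup>+t. ennreal (norm (Du (x + t *\<^sub>R v)) * norm v) * indicator {0..1::real} t \<partial>lborel)"
      by (rule nn_integral_has_integral_lebesgue'[symmetric])
         (use integrable_integral[OF integrable_continuous_interval[OF c2]] in auto)
    also have "\<dots> = (\<integral>\<^sup>+t. (ennreal (norm (Du (x + t *\<^sub>R v))) * indicator {0..1::real} t) * ennreal (norm v) \<partial>lborel)"
      by (simp add: ennreal_mult' mult_ac)
    also have "\<dots> = (\<integral>\<^sup>+t. ennreal (norm (Du (x + t *\<^sub>R v))) * indicator {0..1::real} t \<partial>lborel) * ennreal (norm v)"
      by (rule nn_integral_multc) (use measurable_compose[OF measurable_Pair1' mg2] in simp)
    finally show ?thesis by (simp add: ennreal_leI)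
  qed
  have "(\<integral>\<^sup>+x. ennreal \<bar>u (x + v) - u x\<bar> \<partial>lborel) \<le>
     (\<integral>\<^sup>+x. (\<integral>\<^sup>+t. ennreal (norm (Du (x + t *\<^sub>R v))) * indicator {0..1::real} t \<partial>lborel) * ennreal (norm v) \<partial>lborel)"
    by (rule nn_integral_mono) (rule pt)
  also have "\<dots> = (\<integral>\<^sup>+x. \<integral>\<^sup>+t. ennreal (norm (Du (x + t *\<^sub>R v))) * indicator {0..1::real} t \<partial>lborel \<partial>lborel) * ennreal (norm v)"
    by (rule nn_integral_multc) (use lborel.borel_measurable_nn_integral_fst[OF mg2] in simp)
  also have "(\<integral>\<^sup>+x. \<integral>\<^sup>+t. ennreal (norm (Du (x + t *\<^sub>R v))) * indicator {0..1::real} t \<partial>lborel \<partial>lborel)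
     = (\<integral>\<^sup>+t. \<integral>\<^sup>+x. ennreal (norm (Du (x + t *\<^sub>R v))) * indicator {0..1::real} t \<partial>lborel \<partial>lborel)"
    using lborel_pair.Fubini[OF mg2] by simp
  also have "\<dots> = (\<integral>\<^sup>+t. (\<integral>\<^sup>+x. ennreal (norm (Du x)) \<partial>lborel) * indicator {0..1::real} t \<partial>lborel)"
  proof (rule nn_integral_cong)
    fix t :: real
    show "(\<integral>\<^sup>+x. ennreal (norm (Du (x + t *\<^sub>R v))) * indicator {0..1::real} t \<partial>lborel)
       = (\<integral>\<^sup>+x. ennreal (norm (Du x)) \<partial>lborel) * indicator {0..1::real} t"
      using nn_integral_lborel_translate[OF mg, of "t *\<^sub>R v"]
      by (simp add: indicator_def add.commute)
  qed
  also have "\<dots> = (\<integral>\<^sup>+x. ennreal (norm (Du x)) \<partial>lborel)"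
    by (simp add: nn_integral_cmult)
  finally show ?thesis by (simp add: mult.commute)
qed

section \<open>A De Giorgi--Stampacchia bound\<close>

text \<open>The proof averages \<open>\<bar>u (x + v) - u x\<bar>\<close> over the vectors \<open>v\<close> of a cube whose volume is twice that of the
  support: for each \<open>x\<close>, at least half of the points \<open>x + v\<close> lie off the support.\<close>

lemma faber_krahn:
  fixes u :: "'a::euclidean_space \<Rightarrow> real"
  assumes u: "\<And>x. (u has_derivative (\<lambda>h. Du x \<bullet> h)) (at x)"
    and Du: "continuous_on UNIV Du"
    and K: "compact K" "\<And>x. x \<notin> K \<Longrightarrow> u x = 0"
    and nn: "\<And>x. 0 \<le> u x"
  shows "(\<integral>x. u x \<partial>lborel) \<le> 4 * DIM('a) * measure lborel {x. u x \<noteq> 0} powr (1 / DIM('a)) * (\<integral>x. norm (Du x) \<partial>lborel)"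
proof -
  let ?N = "DIM('a)"
  have cu: "continuous_on UNIV u"
    by (rule has_derivative_continuous_on) (use u in auto)
  have Du0: "Du x = 0" if "x \<notin> K" for x
    using gradient_eq_0_off_support[OF u compact_imp_closed[OF K(1)] K(2) that] by simp
  have [measurable]: "u \<in> borel_measurable borel" by (rule borel_measurable_continuous_onI[OF cu])
  define A where "A = {x. u x \<noteq> 0}"
  have Am[measurable]: "A \<in> sets borel" unfolding A_def by measurable
  have fin: "emeasure lborel A < \<infinity>"
  proof -
    have "emeasure lborel A \<le> emeasure lborel K"
      by (rule emeasure_mono) (use K A_def in \<open>auto intro: borel_compact\<close>)
    also have "\<dots> < \<infinity>" using emeasure_compact_finite[OF K(1)] .
    finally show ?thesis .
  qed
  define a where "a = measure lborel A"
  have ea: "emeasure lborel A = ennreal a"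
    using fin unfolding a_def by (simp add: emeasure_eq_ennreal_measure)
  have iu: "integrable lborel u" by (rule integrable_continuous_compact_support[OF cu K])
  have iD: "integrable lborel (\<lambda>x. norm (Du x))"
    by (rule integrable_continuous_compact_support[OF _ K(1)]) (auto intro!: continuous_intros Du simp: Du0)
  define I where "I = (\<integral>x. u x \<partial>lborel)"
  define D where "D = (\<integral>x. norm (Du x) \<partial>lborel)"
  have I: "(\<integral>\<^sup>+x. ennreal (u x) \<partial>lborel) = ennreal I" unfolding I_def
    by (rule nn_integral_eq_integral[OF iu]) (simp add: nn)
  have D: "(\<integral>\<^sup>+x. ennreal (norm (Du x)) \<partial>lborel) = ennreal D" unfolding D_def
    by (rule nn_integral_eq_integral[OF iD]) simp
  have D0: "0 \<le> D" unfolding D_def by simp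
  show ?thesis
  proof (cases "a = 0")
    case True
    then have "AE x in lborel. x \<notin> A"
      using ea by (intro AE_not_in) (auto simp: null_sets_def)
    then have "(\<integral>x. u x \<partial>lborel) = (\<integral>x. 0 \<partial>(lborel::'a measure))"
      by (intro integral_cong_AE) (auto simp: A_def)
    then have "I = 0" by (simp add: I_def)
    moreover have "0 \<le> 4 * ?N * a powr (1 / ?N) * D" using D0 by simp
    ultimately show ?thesis unfolding a_def A_def I_def D_def by simp
  next
    case False
    then have a0: "0 < a" unfolding a_def by (simp add: zero_less_measure_iff)
    define l where "l = (2 * a) powr (1 / ?N)"
    have l0: "0 < l" using a0 by (simp add: l_def)
    have lN: "l ^ ?N = 2 * a"
    proof -
      have "l powr ?N = 2 * a" using a0 by (simp add: l_def powr_powr)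
      then show ?thesis using powr_realpow[OF l0] by simp
    qed
    define B where "B = cbox (0::'a) (l *\<^sub>R One)"
    have [measurable]: "B \<in> sets borel" by (simp add: B_def)
    have eB: "emeasure lborel B = ennreal (2 * a)"
    proof -
      have "emeasure lborel B = ennreal (\<Prod>b\<in>Basis. (l *\<^sub>R One - 0) \<bullet> (b::'a))"
        unfolding B_def by (rule emeasure_lborel_cbox) (use l0 in \<open>auto simp: inner_sum_left_Basis\<close>)
      also have "(\<Prod>b\<in>Basis. (l *\<^sub>R One - 0) \<bullet> (b::'a)) = l ^ ?N"
        by (simp add: inner_sum_left_Basis)
      finally show ?thesis by (simp add: lN)
    qed
    have nB: "norm v \<le> ?N * l" if "v \<in> B" for v :: 'a
    proof -
      have "norm v \<le> (\<Sum>b\<in>Basis. \<bar>v \<bullet> b\<bar>)" by (rule norm_le_l1)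
      also have "\<dots> \<le> (\<Sum>b\<in>(Basis::'a set). l)"
        by (rule sum_mono) (use that in \<open>auto simp: B_def mem_box inner_sum_left_Basis\<close>)
      finally show ?thesis by simp
    qed
    have m2: "(\<lambda>(x, v). ennreal (u x) * indicator (- A) (x + v) * indicator B v)
        \<in> borel_measurable (lborel \<Otimes>\<^sub>M (lborel :: 'a measure))"
      unfolding case_prod_beta by measurable
    have h1: "ennreal (u x) * ennreal a \<le> (\<integral>\<^sup>+v. ennreal (u x) * indicator (- A) (x + v) * indicator B v \<partial>lborel)" for x
    proof -
      have "B \<subseteq> (B \<inter> {v. x + v \<notin> A}) \<union> {v. x + v \<in> A}" by auto
      then have "emeasure lborel B \<le> emeasure lborel ((B \<inter> {v. x + v \<notin> A}) \<union> {v. x + v \<in> A})"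
        by (rule emeasure_mono) measurable
      also have "\<dots> \<le> emeasure lborel (B \<inter> {v. x + v \<notin> A}) + emeasure lborel {v. x + v \<in> A}"
        by (rule emeasure_subadditive) measurable
      also have "emeasure lborel {v. x + v \<in> A} = emeasure lborel A"
      proof -
        have "(\<integral>\<^sup>+v. indicator A (x + v) \<partial>lborel) = (\<integral>\<^sup>+v. indicator A v \<partial>lborel)"
          by (rule nn_integral_lborel_translate) measurable
        moreover have "(\<integral>\<^sup>+v. indicator A (x + v) \<partial>lborel) = emeasure lborel {v. x + v \<in> A}"
        proof -
          have "(\<lambda>v. indicator A (x + v) :: ennreal) = indicator {v. x + v \<in> A}" by (auto simp: indicator_def)
          then show ?thesis by simp
        qed
        ultimately show ?thesis by simp
      qed
      finally have "ennreal (2 * a) \<le> ennreal a + emeasure lborel (B \<inter> {v. x + v \<notin> A})"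
        unfolding eB ea by (simp only: add.commute)
      moreover have "ennreal (2 * a) = ennreal a + ennreal a"
        unfolding mult_2 by (rule ennreal_plus) (use a0 in auto)
      ultimately have "ennreal a \<le> emeasure lborel (B \<inter> {v. x + v \<notin> A})"
        using ennreal_add_left_cancel_le[of "ennreal a"] by simp
      moreover have "(\<integral>\<^sup>+v. ennreal (u x) * indicator (- A) (x + v) * indicator B v \<partial>lborel)
         = ennreal (u x) * emeasure lborel (B \<inter> {v. x + v \<notin> A})"
      proof -
        have "(\<integral>\<^sup>+v. ennreal (u x) * indicator (- A) (x + v) * indicator B v \<partial>lborel)
           = (\<integral>\<^sup>+v. ennreal (u x) * indicator (B \<inter> {v. x + v \<notin> A}) v \<partial>lborel)"
          by (rule nn_integral_cong) (auto simp: indicator_def)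
        also have "\<dots> = ennreal (u x) * emeasure lborel (B \<inter> {v. x + v \<notin> A})"
          by (rule nn_integral_cmult_indicator) measurable
        finally show ?thesis .
      qed
      ultimately show ?thesis by (simp add: mult_left_mono)
    qed
    \<comment> \<open>Where \<open>x + v\<close> lies off the support, \<open>u x\<close> is itself
      the difference \<open>\<bar>u (x + v) - u x\<bar>\<close>, which brings in the
      gradient.\<close>
    have h2: "(\<integral>\<^sup>+x. ennreal (u x) * indicator (- A) (x + v) * indicator B v \<partial>lborel)
       \<le> ennreal (?N * l * D) * indicator B v" for v :: 'a
    proof (cases "v \<in> B")
      case True
      have "(\<integral>\<^sup>+x. ennreal (u x) * indicator (- A) (x + v) * indicator B v \<partial>lborel)
        \<le> (\<integral>\<^sup>+x. ennreal \<bar>u (x + v) - u x\<bar> \<partial>lborel)"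
        by (rule nn_integral_mono) (use nn in \<open>auto simp: indicator_def A_def\<close>)
      also have "\<dots> \<le> ennreal (norm v) * ennreal D"
        using nn_integral_difference_le[OF u Du] D by simp
      also have "\<dots> \<le> ennreal (?N * l) * ennreal D"
        by (intro mult_right_mono ennreal_leI nB True) simp
      finally show ?thesis using True D0 l0 by (simp add: ennreal_mult'' ennreal_mult)
    qed auto
    have "ennreal I * ennreal a = (\<integral>\<^sup>+x. ennreal (u x) * ennreal a \<partial>lborel)"
      by (subst nn_integral_multc) (auto simp: I)
    also have "\<dots> \<le> (\<integral>\<^sup>+x. \<integral>\<^sup>+v. ennreal (u x) * indicator (- A) (x + v) * indicator B v \<partial>lborel \<partial>lborel)"
      by (rule nn_integral_mono) (rule h1)
    also have "\<dots> = (\<integral>\<^sup>+v. \<integral>\<^sup>+x. ennreal (u x) * indicator (- A) (x + v) * indicator B v \<partial>lborel \<partial>lborel)"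
      using lborel_pair.Fubini[OF m2] by simp
    also have "\<dots> \<le> (\<integral>\<^sup>+v. ennreal (?N * l * D) * indicator B v \<partial>lborel)"
      by (rule nn_integral_mono) (rule h2)
    also have "\<dots> = ennreal (?N * l * D) * ennreal (2 * a)"
      by (subst nn_integral_cmult_indicator) (auto simp: eB)
    finally have "ennreal (I * a) \<le> ennreal (?N * l * D * (2 * a))"
      using D0 l0 a0 by (simp add: ennreal_mult''[symmetric])
    then have "I * a \<le> ?N * l * D * (2 * a)"
      using D0 l0 a0 by (subst (asm) ennreal_le_iff) auto
    then have "I \<le> 2 * ?N * l * D" using a0 by (simp add: field_simps)
    also have "l \<le> 2 * a powr (1 / ?N)"
    proof -
      have "2 powr (1 / ?N) \<le> (2::real) powr 1" by (rule powr_mono) auto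
      then show ?thesis using a0 unfolding l_def by (simp add: powr_mult)
    qed
    then have "2 * ?N * l * D \<le> 2 * ?N * (2 * a powr (1 / ?N)) * D"
      using D0 by (intro mult_right_mono mult_left_mono) auto
    finally show ?thesis unfolding I_def D_def a_def A_def by (simp add: mult_ac)
  qed
qed

text \<open>Apply the inequality along the levels k0 + d (1 - 2^(-j)). The gaps halve, but the
  superlinear power 1 + s more than makes up for it, and \<phi> decays like 2^(-j / s). The bound on
  d is exactly what closes this induction; monotonicity then carries the decay to the limit level k0
  + d.\<close>

lemma stampacchia:
  fixes \<phi> :: "real \<Rightarrow> real"
  assumes nn: "\<And>k. 0 \<le> \<phi> k" and anti: "\<And>k k'. k0 \<le> k \<Longrightarrow> k \<le> k' \<Longrightarrow> \<phi> k' \<le> \<phi> k"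
    and M: "0 \<le> M" and s: "0 < s"
    and step: "\<And>k k'. k0 \<le> k \<Longrightarrow> k < k' \<Longrightarrow> (k' - k) * \<phi> k' \<le> M * \<phi> k powr (1 + s)"
    and d: "0 < d" "2 powr (1 + 1 / s) * M * \<phi> k0 powr s \<le> d"
  shows "\<phi> (k0 + d) = 0"
proof (cases "\<phi> k0 = 0")
  case True
  then show ?thesis using anti[of k0 "k0 + d"] nn[of "k0 + d"] d(1) by simp
next
  case False
  then have p0: "0 < \<phi> k0" using nn[of k0] by simp
  define k where "k j = k0 + d * (1 - 1 / 2 ^ j)" for j :: nat
  have kj: "k0 \<le> k j" for j unfolding k_def using d(1) by simp
  have b: "\<phi> (k j) \<le> \<phi> k0 * (2 powr (- 1 / s)) ^ j" for j
  proof (induction j)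
    case 0 then show ?case by (simp add: k_def)
  next
    case (Suc j)
    have df: "k (Suc j) - k j = d / 2 ^ Suc j"
      by (simp add: k_def field_simps)
    have lt: "k j < k (Suc j)" using df d(1) by (smt (verit) divide_pos_pos zero_less_power)
    have "d / 2 ^ Suc j * \<phi> (k (Suc j)) \<le> M * \<phi> (k j) powr (1 + s)"
      using step[OF kj lt] df by simp
    also have "\<dots> \<le> M * (\<phi> k0 * (2 powr (- 1 / s)) ^ j) powr (1 + s)"
      using M Suc s nn by (intro mult_left_mono powr_mono2) auto
    also have "\<dots> = M * \<phi> k0 powr s * \<phi> k0 * ((2 powr (- 1 / s)) ^ j) powr (1 + s)"
      using p0 by (simp add: powr_mult powr_add)
    also have "((2 powr (- 1 / s)) ^ j) powr (1 + s) = (2 powr (- 1 / s)) ^ j * (1 / 2) ^ j"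
    proof -
      have "((2 powr (- 1 / s)) ^ j) powr (1 + s) = ((2 powr (- 1 / s)) powr (1 + s)) ^ j"
        by (simp add: powr_power powr_powr mult_ac)
      also have "(2 powr (- 1 / s)) powr (1 + s) = 2 powr (- 1 / s + - 1)"
      proof -
        have "- 1 / s * (1 + s) = - 1 / s + - 1" using s by (simp add: field_simps)
        then show ?thesis by (simp add: powr_powr)
      qed
      also have "\<dots> = 2 powr (- 1 / s) * (1 / 2)" by (simp only: powr_add) (simp add: powr_minus_divide)
      finally show ?thesis by (simp only: power_mult_distrib)
    qed
    finally have e1: "d * \<phi> (k (Suc j)) \<le> (2 * M * \<phi> k0 powr s) * (\<phi> k0 * (2 powr (- 1 / s)) ^ j)"
      by (simp add: field_simps)
    define t where "t = 2 powr (1 / s)"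
    have t: "0 < t" "2 powr (1 + 1 / s) = 2 * t" "2 powr (- 1 / s) = 1 / t"
      by (simp_all add: t_def powr_add powr_minus_divide)
    have "(2 * M * \<phi> k0 powr s) * t \<le> d"
      using d(2) unfolding t(2) by (simp add: mult_ac)
    then have "2 * M * \<phi> k0 powr s \<le> d * 2 powr (- 1 / s)"
      using t(1) unfolding t(3) by (simp add: pos_le_divide_eq)
    then have "(2 * M * \<phi> k0 powr s) * (\<phi> k0 * (2 powr (- 1 / s)) ^ j)
        \<le> (d * 2 powr (- 1 / s)) * (\<phi> k0 * (2 powr (- 1 / s)) ^ j)"
      by (rule mult_right_mono) (use p0 in simp)
    then have "d * \<phi> (k (Suc j)) \<le> d * (\<phi> k0 * (2 powr (- 1 / s)) ^ Suc j)"
      using e1 by (simp add: mult_ac)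
    then show ?case using d(1) by (simp only: mult_le_cancel_left_pos)
  qed
  have "(\<lambda>j. \<phi> k0 * (2 powr (- 1 / s)) ^ j) \<longlonglongrightarrow> \<phi> k0 * 0"
  proof (rule tendsto_mult_left, rule LIMSEQ_power_zero)
    show "norm (2 powr (- 1 / s)) < (1::real)" using s powr_less_mono[of "-1 / s" 0 2] by simp
  qed
  moreover have "\<phi> (k0 + d) \<le> \<phi> k0 * (2 powr (- 1 / s)) ^ j" for j
  proof -
    have "\<phi> (k0 + d) \<le> \<phi> (k j)"
      by (rule anti[OF kj]) (use d(1) in \<open>simp add: k_def field_simps\<close>)
    then show ?thesis using b[of j] by simp
  qed
  ultimately have "\<phi> (k0 + d) \<le> \<phi> k0 * 0" using LIMSEQ_le_const by blast
  then show ?thesis using nn[of "k0 + d"] by simp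
qed

text \<open>The test functions and fields are defined on Q only, while the integration by parts and
  \<open>faber_krahn\<close> are stated on the whole space. Compact support inside Q keeps the
  extension continuously differentiable.\<close>

lemma extend_by_zero:
  fixes f :: "'a::euclidean_space \<Rightarrow> real"
  assumes Q: "open Q" and K: "compact K" "K \<subseteq> Q"
    and f: "\<And>x. x \<in> Q \<Longrightarrow> (f has_derivative (\<lambda>h. Df x \<bullet> h)) (at x)"
    and Df: "continuous_on Q Df" and f0: "\<And>x. x \<in> Q - K \<Longrightarrow> f x = 0"
  shows "((\<lambda>x. if x \<in> Q then f x else 0) has_derivative (\<lambda>h. (if x \<in> Q then Df x else 0) \<bullet> h)) (at x)"
    and "continuous_on UNIV (\<lambda>x. if x \<in> Q then Df x else 0)"
    and "x \<in> Q - K \<Longrightarrow> Df x = 0"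
proof -
  let ?F = "\<lambda>x. if x \<in> Q then f x else 0" and ?D = "\<lambda>x. if x \<in> Q then Df x else 0"
  have oK: "open (- K)" using K compact_imp_closed by blast
  have d0: "(?F has_derivative (\<lambda>h. 0)) (at x)" if "x \<notin> K" for x
    by (rule has_derivative_transform_within_open[of "\<lambda>_. 0" _ _ _ "- K"])
       (use oK f0 that in auto)
  have dQ: "(?F has_derivative (\<lambda>h. Df x \<bullet> h)) (at x)" if "x \<in> Q" for x
    by (rule has_derivative_transform_within_open[of f _ _ _ Q]) (use Q f that in auto)
  have D0: "Df x = 0" if "x \<in> Q - K" for x
  proof -
    have "(\<lambda>h. Df x \<bullet> h) = (\<lambda>h. 0)"
      using d0[of x] dQ[of x] that has_derivative_unique by blast
    then have "Df x \<bullet> Df x = 0" by meson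
    then show ?thesis by simp
  qed
  show "(?F has_derivative (\<lambda>h. ?D x \<bullet> h)) (at x)"
    using d0[of x] dQ[of x] K(2) by (cases "x \<in> Q") auto
  show "continuous_on UNIV ?D"
  proof -
    have "continuous_on Q ?D" using Df by (rule continuous_on_eq) auto
    moreover have "continuous_on (- K) ?D"
      by (rule continuous_on_eq[of _ "\<lambda>_. 0"]) (use D0 in auto)
    ultimately have "continuous_on (Q \<union> - K) ?D"
      by (rule continuous_on_open_Un[OF Q oK])
    moreover have "Q \<union> - K = UNIV" using K(2) by auto
    ultimately show ?thesis by simp
  qed
  show "x \<in> Q - K \<Longrightarrow> Df x = 0" by (rule D0)
qed

text \<open>A continuously differentiable version of the truncation at level k: zero below k,
  quadratic between k and k', of slope 1 above k'. Composed with z it is a classical test function,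
  and weak derivatives do not appear.\<close>

definition ramp :: "real \<Rightarrow> real \<Rightarrow> real \<Rightarrow> real" where
  "ramp k k' s = ((max (s - k) 0)\<^sup>2 - (max (s - k') 0)\<^sup>2) / (2 * (k' - k))"

definition ramp' :: "real \<Rightarrow> real \<Rightarrow> real \<Rightarrow> real" where
  "ramp' k k' s = (max (s - k) 0 - max (s - k') 0) / (k' - k)"

lemma DERIV_max_square: "((\<lambda>s. (max (s - k) 0)\<^sup>2) has_real_derivative 2 * max (s - k) 0) (at s)"
proof -
  consider "s < k" | "s = k" | "s > k" by linarith
  then show ?thesis
  proof cases
    case 1
    have "((\<lambda>s. 0) has_real_derivative 2 * max (s - k) 0) (at s)" using 1 by (auto intro!: derivative_eq_intros)
    then show ?thesis
      by (rule has_field_derivative_transform_within_open[of _ _ _ "{..<k}"]) (use 1 in auto)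
  next
    case 2
    have "((\<lambda>h. (max h 0)\<^sup>2 / h) \<longlongrightarrow> 0) (at (0::real))"
    proof (rule Lim_null_comparison)
      show "\<forall>\<^sub>F h in at (0::real). norm ((max h 0)\<^sup>2 / h) \<le> \<bar>h\<bar>"
        by (rule always_eventually) (auto simp: max_def power2_eq_square)
      show "((\<lambda>h. \<bar>h\<bar>) \<longlongrightarrow> 0) (at (0::real))" using tendsto_rabs_zero[OF tendsto_ident_at] by simp
    qed
    then show ?thesis using 2 by (simp add: DERIV_def)
  next
    case 3
    have "((\<lambda>s. (s - k)\<^sup>2) has_real_derivative 2 * max (s - k) 0) (at s)"
      using 3 by (auto intro!: derivative_eq_intros)
    then show ?thesis
      by (rule has_field_derivative_transform_within_open[of _ _ _ "{k<..}"]) (use 3 in auto)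
  qed
qed

lemma ramp_props:
  assumes "k < k'"
  shows "(ramp k k' has_real_derivative ramp' k k' s) (at s)"
    and "0 \<le> ramp' k k' s" "ramp' k k' s \<le> 1" "s \<le> k \<Longrightarrow> ramp' k k' s = 0" "0 \<le> ramp k k' s"
    and "ramp k k' s \<le> max (s - k) 0" "s \<le> k \<Longrightarrow> ramp k k' s = 0" "k' \<le> s \<Longrightarrow> (k' - k) / 2 \<le> ramp k k' s"
proof -
  show "(ramp k k' has_real_derivative ramp' k k' s) (at s)"
    unfolding ramp_def ramp'_def
    using assms
    by (intro DERIV_cong[OF DERIV_cdivide[OF DERIV_diff[OF DERIV_max_square[of k s] DERIV_max_square[of k' s]]]])
       (simp add: divide_simps, simp add: algebra_simps)
  show "0 \<le> ramp' k k' s" "ramp' k k' s \<le> 1" "s \<le> k \<Longrightarrow> ramp' k k' s = 0"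
    using assms by (auto simp: ramp'_def max_def divide_simps)
  show "s \<le> k \<Longrightarrow> ramp k k' s = 0" using assms by (auto simp: ramp_def max_def)
  show "0 \<le> ramp k k' s"
    using assms unfolding ramp_def by (intro divide_nonneg_pos) (auto intro!: power_mono)
  have eq: "ramp k k' s = s - k - (k' - k) / 2" if "k' \<le> s"
  proof -
    have "(s - k)\<^sup>2 - (s - k')\<^sup>2 = (2 * (k' - k)) * (s - k - (k' - k) / 2)"
      by (simp add: power2_eq_square field_simps)
    then show ?thesis using assms that unfolding ramp_def by simp
  qed
  show "ramp k k' s \<le> max (s - k) 0"
  proof (cases "k' \<le> s")
    case True
    then show ?thesis using eq assms by simp
  next
    case False
    show ?thesis
    proof (cases "s \<le> k")
      case True
      then show ?thesis using assms by (auto simp: ramp_def max_def)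
    next
      case False
      have "(s - k)\<^sup>2 \<le> (s - k) * (2 * (k' - k))"
        unfolding power2_eq_square by (rule mult_left_mono) (use False \<open>\<not> k' \<le> s\<close> in auto)
      then show ?thesis using False \<open>\<not> k' \<le> s\<close> assms
        by (simp add: ramp_def max_def field_simps)
    qed
  qed
  show "k' \<le> s \<Longrightarrow> (k' - k) / 2 \<le> ramp k k' s" using eq by (simp add: field_simps)
qed

lemma continuous_on_ramp': "k < k' \<Longrightarrow> continuous_on S (ramp' k k')"
  unfolding ramp'_def by (intro continuous_intros) auto

lemma superlevel_set:
  fixes z :: "'a::euclidean_space \<Rightarrow> real"
  assumes "open Q" "bounded Q" "continuous_on Q z"
  shows "open {x \<in> Q. k < z x}" "{x \<in> Q. k < z x} \<in> fmeasurable lborel"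
proof -
  show o: "open {x \<in> Q. k < z x}"
    using continuous_open_preimage[OF assms(3,1), of "{k<..}"] by (simp add: vimage_def Int_def conj_commute)
  show "{x \<in> Q. k < z x} \<in> fmeasurable lborel"
  proof (rule fmeasurableI)
    show "{x \<in> Q. k < z x} \<in> sets lborel" using o by simp
    show "emeasure lborel {x \<in> Q. k < z x} < \<infinity>"
      by (rule emeasure_bounded_finite[OF bounded_subset[OF assms(2)]]) auto
  qed
qed

text \<open>Testing \<open>div V \<ge> - f\<close> with \<open>ramp k k' \<circ> z\<close>.\<close>

lemma level_gradient_estimate:
  fixes z :: "'a::euclidean_space \<Rightarrow> real" and V :: "'a \<Rightarrow> 'a" and f G M :: real
  assumes Q: "open Q" "bounded Q"
    and z: "\<And>x. x \<in> Q \<Longrightarrow> (z has_derivative (\<lambda>h. Dz x \<bullet> h)) (at x)" "continuous_on Q Dz"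
    and V: "\<And>x. x \<in> Q \<Longrightarrow> (V has_derivative V' x) (at x)"
      "\<And>b. b \<in> Basis \<Longrightarrow> continuous_on Q (\<lambda>x. V' x b)"
    and K: "compact {x \<in> Q. k \<le> z x}" and kk: "k < k'"
    and div: "\<And>x. x \<in> Q \<Longrightarrow> k < z x \<Longrightarrow> - f \<le> (\<Sum>b\<in>Basis. V' x b \<bullet> b)"
    and ell: "\<And>x. x \<in> Q \<Longrightarrow> k < z x \<Longrightarrow> (norm (Dz x))\<^sup>2 / 2 - G\<^sup>2 / 2 \<le> V x \<bullet> Dz x"
    and M: "\<And>x. x \<in> Q \<Longrightarrow> z x - k \<le> M" and f: "0 \<le> f" "f * M \<le> G\<^sup>2 / 2" and G: "0 < G"
  shows "(k' - k) * measure lborel {x \<in> Q. k' < z x}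
    \<le> 12 * DIM('a) * G * measure lborel {x \<in> Q. k < z x} powr (1 + 1 / DIM('a))"
proof -
  define K where "K = {x \<in> Q. k \<le> z x}"
  have K': "compact K" "K \<subseteq> Q" using K by (auto simp: K_def)
  define u where "u x = ramp k k' (z x)" for x
  define Du where "Du x = ramp' k k' (z x) *\<^sub>R Dz x" for x
  have cz: "continuous_on Q z"
    by (rule has_derivative_continuous_on) (use z(1) has_derivative_at_withinI in blast)
  have cV: "continuous_on Q V"
    by (rule has_derivative_continuous_on) (use V(1) has_derivative_at_withinI in blast)
  have cr': "continuous_on Q (\<lambda>x. ramp' k k' (z x))"
    by (rule continuous_on_compose2[OF continuous_on_ramp'[OF kk, of UNIV] cz]) auto
  have du: "(u has_derivative (\<lambda>h. Du x \<bullet> h)) (at x)" if "x \<in> Q" for x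
    unfolding u_def Du_def
    using DERIV_compose_FDERIV[OF ramp_props(1)[OF kk] z(1)[OF that]] by (simp add: mult.commute)
  have cu: "continuous_on Q u"
    by (rule has_derivative_continuous_on) (use du has_derivative_at_withinI in blast)
  have cDu: "continuous_on Q Du" unfolding Du_def by (intro continuous_intros cr' z(2))
  have u0: "u x = 0" if "x \<in> Q - K" for x
    using that ramp_props(7)[OF kk, of "z x"] by (auto simp: u_def K_def)
  define A where "A k = {x \<in> Q. k < z x}" for k
  have Ao: "open (A k)" and Ab: "A k \<in> fmeasurable lborel" for k
    unfolding A_def by (rule superlevel_set[OF Q cz])+
  note EU = extend_by_zero[OF Q(1) K' du cDu u0]
  let ?u = "\<lambda>x. if x \<in> Q then u x else 0" and ?Du = "\<lambda>x. if x \<in> Q then Du x else 0"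
  have Vb: "((\<lambda>x. V x \<bullet> b) has_derivative (\<lambda>h. (\<Sum>c\<in>Basis. (V' x c \<bullet> b) *\<^sub>R c) \<bullet> h)) (at x)" if "x \<in> Q" for x b
  proof -
    have l: "linear (V' x)" using V(1)[OF that] by (simp add: has_derivative_linear)
    have "V' x h \<bullet> b = (\<Sum>c\<in>Basis. (V' x c \<bullet> b) *\<^sub>R c) \<bullet> h" for h
    proof -
      have "V' x h = V' x (\<Sum>c\<in>Basis. (h \<bullet> c) *\<^sub>R c)" by (simp add: euclidean_representation)
      also have "\<dots> = (\<Sum>c\<in>Basis. (h \<bullet> c) *\<^sub>R V' x c)"
        by (simp add: linear_sum[OF l] linear_cmul[OF l])
      finally show ?thesis by (simp add: inner_sum_left inner_sum_right mult.commute inner_commute)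
    qed
    then have "(\<lambda>h. V' x h \<bullet> b) = (\<lambda>h. (\<Sum>c\<in>Basis. (V' x c \<bullet> b) *\<^sub>R c) \<bullet> h)" by (rule ext)
    then show ?thesis using has_derivative_inner_left[OF V(1)[OF that], of b] by (simp only:)
  qed
  define X where "X b x = u x * (V x \<bullet> b)" for b x
  define DX where "DX b x = (V x \<bullet> b) *\<^sub>R Du x + u x *\<^sub>R (\<Sum>c\<in>Basis. (V' x c \<bullet> b) *\<^sub>R c)" for b x
  have dX: "(X b has_derivative (\<lambda>h. DX b x \<bullet> h)) (at x)" if "x \<in> Q" for x b
    unfolding X_def DX_def
    by (rule has_derivative_eq_rhs[OF has_derivative_mult[OF du[OF that] Vb[OF that]]])
       (auto simp: inner_add_left algebra_simps)
  have cDX: "continuous_on Q (DX b)" for b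
    unfolding DX_def by (intro continuous_intros cV cDu cu V(2)) auto
  have X0: "X b x = 0" if "x \<in> Q - K" for x b using u0[OF that] by (simp add: X_def)
  note EX = extend_by_zero[OF Q(1) K' dX cDX X0]
  let ?DX = "\<lambda>b x. if x \<in> Q then DX b x else 0"
  have int0: "(\<integral>x. ?DX b x \<bullet> b \<partial>lborel) = 0" for b
    by (rule integral_partial_derivative_eq_0[OF EX(1) EX(2) K'(1)]) (use X0 in auto)
  have intDX: "integrable lborel (\<lambda>x. ?DX b x \<bullet> b)" for b
    by (rule integrable_continuous_compact_support[OF _ K'(1)])
       (use EX(2,3) K'(2) in \<open>auto intro!: continuous_intros\<close>)
  \<comment> \<open>The divergence of the field \<open>u V\<close>, extended by zero; its integral
    vanishes.\<close>
  define P where "P x = (\<Sum>b\<in>Basis. ?DX b x \<bullet> b)" for x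
  have intP: "integrable lborel P" "(\<integral>x. P x \<partial>lborel) = 0"
    unfolding P_def using int0 intDX by (auto intro: Bochner_Integration.integrable_sum simp del: inner_commute)
  have intDu: "integrable lborel (\<lambda>x. norm (?Du x))"
    by (rule integrable_continuous_compact_support[OF continuous_on_norm[OF EU(2)] K'(1)])
       (use EU(3) K'(2) in auto)
  \<comment> \<open>The factor 3 / 2 collects three errors of size G^2 / 2: the defect in
    \<open>ell\<close>, the term with f, which \<open>f * M\<close> bounds, and the one from Young's
    inequality for \<open>G * norm (Dz x)\<close>.\<close>
  have pt: "G * norm (?Du x) \<le> P x + (3 / 2 * G\<^sup>2) * indicator (A k) x" for x
  proof (cases "x \<in> A k")
    case True
    then have x: "x \<in> Q" "k < z x" by (auto simp: A_def)
    let ?e = "ramp' k k' (z x)"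
    have P: "P x = ?e * (V x \<bullet> Dz x) + u x * (\<Sum>b\<in>Basis. V' x b \<bullet> b)"
    proof -
      have "P x = (\<Sum>b\<in>Basis. (V x \<bullet> b) * (?e * (Dz x \<bullet> b)) + u x * (V' x b \<bullet> b))"
        unfolding P_def DX_def Du_def using x(1)
        by (simp add: inner_add_left inner_sum_left inner_Basis if_distrib sum.delta mult_ac cong: if_cong)
      also have "\<dots> = ?e * (\<Sum>b\<in>Basis. (V x \<bullet> b) * (Dz x \<bullet> b)) + u x * (\<Sum>b\<in>Basis. V' x b \<bullet> b)"
        by (simp add: sum.distrib sum_distrib_left mult_ac)
      finally show ?thesis by (simp only: euclidean_inner[of "V x" "Dz x"])
    qed
    have e: "0 \<le> ?e" "?e \<le> 1" using ramp_props[OF kk] by auto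
    have "?e * ((norm (Dz x))\<^sup>2 / 2 - G\<^sup>2 / 2) \<le> ?e * (V x \<bullet> Dz x)"
      by (rule mult_left_mono[OF ell[OF x] e(1)])
    moreover have "- (G\<^sup>2 / 2) \<le> u x * (\<Sum>b\<in>Basis. V' x b \<bullet> b)"
    proof -
      have "u x * - f \<le> u x * (\<Sum>b\<in>Basis. V' x b \<bullet> b)"
        by (rule mult_left_mono[OF div[OF x]]) (simp add: u_def ramp_props[OF kk])
      moreover have "u x * f \<le> M * f"
      proof (rule mult_right_mono[OF _ f(1)])
        show "u x \<le> M" using ramp_props(6)[OF kk, of "z x"] M[OF x(1)] x(2) by (simp add: u_def max_def)
      qed
      ultimately show ?thesis using f(2) by (simp add: mult.commute)
    qed
    moreover have "G * (?e * norm (Dz x)) \<le> ?e * ((norm (Dz x))\<^sup>2 / 2) + ?e * (G\<^sup>2 / 2)"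
    proof -
      have "0 \<le> (norm (Dz x) - G)\<^sup>2" by simp
      then have "2 * (G * norm (Dz x)) \<le> (norm (Dz x))\<^sup>2 + G\<^sup>2"
        by (simp add: power2_diff mult_ac)
      then have "G * norm (Dz x) \<le> (norm (Dz x))\<^sup>2 / 2 + G\<^sup>2 / 2" by linarith
      then have "?e * (G * norm (Dz x)) \<le> ?e * ((norm (Dz x))\<^sup>2 / 2 + G\<^sup>2 / 2)"
        by (rule mult_left_mono[OF _ e(1)])
      then show ?thesis by (simp add: algebra_simps)
    qed
    moreover have "?e * (G\<^sup>2 / 2) \<le> G\<^sup>2 / 2" using e by (simp add: mult_left_le_one_le)
    moreover have "norm (?Du x) = ?e * norm (Dz x)" using x e by (simp add: Du_def)
    ultimately show ?thesis unfolding P using True by (simp add: algebra_simps)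
  next
    case False
    have "?Du x = 0 \<and> P x = 0"
    proof (cases "x \<in> Q")
      case True
      then have "z x \<le> k" using False by (auto simp: A_def)
      then show ?thesis using True ramp_props(4,7)[OF kk, of "z x"]
        by (simp add: Du_def P_def DX_def u_def)
    qed (simp add: P_def)
    then show ?thesis using False by simp
  qed
  have iA: "integrable lborel (\<lambda>x. (3 / 2 * G\<^sup>2) * indicator (A k) x)"
    using Ab[of k] by (auto simp: fmeasurable_def)
  have "G * (\<integral>x. norm (?Du x) \<partial>lborel) = (\<integral>x. G * norm (?Du x) \<partial>lborel)" by simp
  also have "\<dots> \<le> (\<integral>x. P x + (3 / 2 * G\<^sup>2) * indicator (A k) x \<partial>lborel)"
    by (rule integral_mono) (use intDu intP iA pt in auto)
  also have "\<dots> = (3 / 2 * G\<^sup>2) * measure lborel (A k)"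
    using intP iA by (simp add: Bochner_Integration.integral_add)
  finally have "G * (\<integral>x. norm (?Du x) \<partial>lborel) \<le> G * (3 / 2 * G * measure lborel (A k))"
    by (simp add: power2_eq_square mult_ac)
  then have D: "(\<integral>x. norm (?Du x) \<partial>lborel) \<le> 3 / 2 * G * measure lborel (A k)"
    using G by (simp only: mult_le_cancel_left_pos)
  have iu: "integrable lborel ?u"
  proof (rule integrable_continuous_compact_support[OF _ K'(1)])
    show "continuous_on UNIV ?u"
      by (rule has_derivative_continuous_on) (use EU(1) in auto)
  qed (use u0 in auto)
  have un: "0 \<le> ?u x" for x using ramp_props(5)[OF kk] by (simp add: u_def)
  have FK: "(\<integral>x. ?u x \<partial>lborel) \<le> 4 * DIM('a) * measure lborel {x. ?u x \<noteq> 0} powr (1 / DIM('a)) * (\<integral>x. norm (?Du x) \<partial>lborel)"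
    by (rule faber_krahn[OF EU(1) EU(2) K'(1)]) (use u0 un in auto)
  have "(k' - k) / 2 * measure lborel (A k') = (\<integral>x. (k' - k) / 2 * indicator (A k') x \<partial>lborel)"
    by simp
  also have "\<dots> \<le> (\<integral>x. ?u x \<partial>lborel)"
  proof (rule integral_mono[OF _ iu])
    show "integrable lborel (\<lambda>x. (k' - k) / 2 * indicator (A k') x)"
      using Ab[of k'] by (auto simp: fmeasurable_def)
    show "(k' - k) / 2 * indicator (A k') x \<le> ?u x" for x
      using un[of x] ramp_props(8)[OF kk, of "z x"] by (auto simp: A_def u_def indicator_def)
  qed
  also note FK
  also have "4 * DIM('a) * measure lborel {x. ?u x \<noteq> 0} powr (1 / DIM('a)) * (\<integral>x. norm (?Du x) \<partial>lborel)
    \<le> 4 * DIM('a) * measure lborel (A k) powr (1 / DIM('a)) * (3 / 2 * G * measure lborel (A k))"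
  proof -
    have "measure lborel {x. ?u x \<noteq> 0} \<le> measure lborel (A k)"
    proof (rule measure_mono_fmeasurable[OF _ _ Ab])
      show "{x. ?u x \<noteq> 0} \<subseteq> A k"
        using ramp_props(7)[OF kk] by (force simp: A_def u_def not_le split: if_splits)
      have "?u \<in> borel_measurable lborel" using iu by (rule borel_measurable_integrable)
      then show "{x. ?u x \<noteq> 0} \<in> sets lborel" by measurable
    qed
    then have "measure lborel {x. ?u x \<noteq> 0} powr (1 / DIM('a)) \<le> measure lborel (A k) powr (1 / DIM('a))"
      by (rule powr_mono2[rotated 2]) auto
    then have "4 * DIM('a) * measure lborel {x. ?u x \<noteq> 0} powr (1 / DIM('a))
        \<le> 4 * DIM('a) * measure lborel (A k) powr (1 / DIM('a))"
      by (rule mult_left_mono) simp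
    then show ?thesis by (rule mult_mono[OF _ D]) auto
  qed
  also have "\<dots> = 6 * DIM('a) * G * measure lborel (A k) powr (1 + 1 / DIM('a))"
    by (cases "measure lborel (A k) = 0") (auto simp: powr_add zero_less_measure_iff mult_ac)
  finally show ?thesis unfolding A_def by (simp add: mult_ac)
qed


text \<open>\<open>level_gradient_estimate\<close> says that the measures of the superlevel sets
  satisfy the hypothesis of \<open>stampacchia\<close> with s = 1 / N, N the dimension. The initial
  set lies in a cube of side 2 \<delta>, so the N-th root of its measure contributes the factor
  \<delta>, and the bound is linear in G.\<close>

theorem sup_bound:
  fixes z :: "'a::euclidean_space \<Rightarrow> real" and V :: "'a \<Rightarrow> 'a" and f G M \<delta> :: real
  assumes Q: "open Q" "Q \<subseteq> cball a \<delta>"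
    and z: "\<And>x. x \<in> Q \<Longrightarrow> (z has_derivative (\<lambda>h. Dz x \<bullet> h)) (at x)" "continuous_on Q Dz"
    and V: "\<And>x. x \<in> Q \<Longrightarrow> (V has_derivative V' x) (at x)"
      "\<And>b. b \<in> Basis \<Longrightarrow> continuous_on Q (\<lambda>x. V' x b)"
    and K: "compact {x \<in> Q. k0 \<le> z x}"
    and div: "\<And>x. x \<in> Q \<Longrightarrow> k0 < z x \<Longrightarrow> - f \<le> (\<Sum>b\<in>Basis. V' x b \<bullet> b)"
    and ell: "\<And>x. x \<in> Q \<Longrightarrow> k0 < z x \<Longrightarrow> (norm (Dz x))\<^sup>2 / 2 - G\<^sup>2 / 2 \<le> V x \<bullet> Dz x"
    and M: "\<And>x. x \<in> Q \<Longrightarrow> z x - k0 \<le> M" and f: "0 \<le> f" "f * M \<le> G\<^sup>2 / 2" and G: "0 < G"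
    and \<delta>: "0 < \<delta>" and x: "x \<in> Q"
  shows "z x \<le> k0 + 48 * DIM('a) * 2 ^ DIM('a) * G * \<delta>"
proof (rule ccontr)
  let ?N = "DIM('a)"
  \<comment> \<open>This is 2^(1 + N) * (12 N G) * (2 \<delta>), the gap that
    \<open>stampacchia\<close> asks for with M = 12 N G.\<close>
  define d where "d = 48 * ?N * 2 ^ ?N * G * \<delta>"
  assume "\<not> ?thesis"
  then have zx: "k0 + d < z x" by (simp add: d_def)
  have bQ: "bounded Q" using Q(2) bounded_subset bounded_cball by blast
  have cz: "continuous_on Q z"
    by (rule has_derivative_continuous_on) (use z(1) has_derivative_at_withinI in blast)
  define A where "A k = {x \<in> Q. k < z x}" for k
  have Ao: "open (A k)" and Ab: "A k \<in> fmeasurable lborel" for k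
    unfolding A_def by (rule superlevel_set[OF Q(1) bQ cz])+
  define \<phi> where "\<phi> k = measure lborel (A k)" for k
  have anti: "\<phi> k' \<le> \<phi> k" if "k \<le> k'" for k k'
    unfolding \<phi>_def by (rule measure_mono_fmeasurable[OF _ _ Ab]) (use that Ao in \<open>auto simp: A_def\<close>)
  have "\<phi> (k0 + d) = 0"
  proof (rule stampacchia[where M = "12 * ?N * G" and s = "1 / ?N"])
    show "0 \<le> \<phi> k" for k by (simp add: \<phi>_def)
    show "\<phi> k' \<le> \<phi> k" if "k \<le> k'" for k k' by (rule anti[OF that])
    show "0 < d" using G \<delta> by (simp add: d_def)
    show "(k' - k) * \<phi> k' \<le> 12 * ?N * G * \<phi> k powr (1 + 1 / ?N)" if kk: "k0 \<le> k" "k < k'" for k k'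
      unfolding \<phi>_def A_def
    proof (rule level_gradient_estimate[where f = f and M = M, OF Q(1) bQ z V _ kk(2)])
      have cl: "closed {x \<in> {x \<in> Q. k0 \<le> z x}. k \<le> z x}"
        by (rule continuous_on_closed_Collect_le)
           (use continuous_on_subset[OF cz] compact_imp_closed[OF K] in auto)
      have "{x \<in> Q. k0 \<le> z x} \<inter> {x \<in> {x \<in> Q. k0 \<le> z x}. k \<le> z x} = {x \<in> Q. k \<le> z x}"
        using kk(1) by auto
      then show "compact {x \<in> Q. k \<le> z x}" using compact_Int_closed[OF K cl] by (simp only:)
      show "z x - k \<le> M" if "x \<in> Q" for x using M[OF that] kk by simp
    qed (use kk div ell f G in auto)
    show "2 powr (1 + 1 / (1 / ?N)) * (12 * ?N * G) * \<phi> k0 powr (1 / ?N) \<le> d"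
    proof -
      have "\<phi> k0 \<le> measure lborel (cbox (a - \<delta> *\<^sub>R One) (a + \<delta> *\<^sub>R One))"
        unfolding \<phi>_def
      proof (rule measure_mono_fmeasurable)
        have "cball a \<delta> \<subseteq> cbox (a - \<delta> *\<^sub>R One) (a + \<delta> *\<^sub>R One)"
        proof
          fix y assume "y \<in> cball a \<delta>"
          then have "norm (y - a) \<le> \<delta>" by (simp add: dist_norm norm_minus_commute)
          then have "\<bar>(y - a) \<bullet> b\<bar> \<le> \<delta>" if "b \<in> Basis" for b
            using Basis_le_norm[OF that, of "y - a"] by simp
          then show "y \<in> cbox (a - \<delta> *\<^sub>R One) (a + \<delta> *\<^sub>R One)"
            by (force simp: mem_box inner_diff_left inner_add_left inner_sum_left_Basis abs_le_iff)
        qed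
        then show "A k0 \<subseteq> cbox (a - \<delta> *\<^sub>R One) (a + \<delta> *\<^sub>R One)" using Q(2) by (auto simp: A_def)
      qed (use Ao in auto)
      also have "\<dots> = (2 * \<delta>) ^ ?N"
        using \<delta> by (simp add: measure_lborel_cbox_eq inner_diff_left inner_add_left inner_sum_left_Basis)
      finally have "\<phi> k0 powr (1 / ?N) \<le> ((2 * \<delta>) ^ ?N) powr (1 / ?N)"
        by (intro powr_mono2) (auto simp: \<phi>_def)
      also have "\<dots> = 2 * \<delta>"
        using \<delta> by (simp add: powr_realpow[of "2 * \<delta>", symmetric, simplified] powr_powr del: power_mult_distrib)
      finally have "2 powr (1 + 1 / (1 / ?N)) * (12 * ?N * G) * \<phi> k0 powr (1 / ?N)
         \<le> 2 powr (1 + 1 / (1 / ?N)) * (12 * ?N * G) * (2 * \<delta>)"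
        by (rule mult_left_mono) (use G in simp)
      moreover have e: "2 powr (1 + 1 / (1 / real ?N)) = 2 * 2 ^ ?N" by (simp add: powr_add powr_realpow)
      ultimately show ?thesis unfolding e d_def by (simp add: mult_ac)
    qed
  qed (use G in auto)
  \<comment> \<open>The superlevel set is open, so being null it is empty: the estimate of measures
    becomes a pointwise bound.\<close>
  then have "emeasure lborel (A (k0 + d)) = 0"
    using Ab[of "k0 + d"] unfolding \<phi>_def by (subst emeasure_eq_measure2) auto
  then have "A (k0 + d) \<in> null_sets lborel" using Ao by auto
  then have "A (k0 + d) = {}"
    using Ao[of "k0 + d"] open_not_negligible negligible_iff_null_sets null_sets_completionI by blast
  then show False using x zx by (auto simp: A_def)
qed

section \<open>Calculus in components and the strong maximum principle\<close>

definition grad :: "(real ^ 'k::finite \<Rightarrow> real) \<Rightarrow> real ^ 'k \<Rightarrow> real ^ 'k" where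
  "grad f x = (\<chi> i. pderivative i f x)"

definition C1 :: "(real ^ 'k::finite) set \<Rightarrow> (real ^ 'k \<Rightarrow> real) \<Rightarrow> bool" where
  "C1 S f \<longleftrightarrow> (\<exists>Df. (\<forall>x\<in>S. (f has_derivative (\<lambda>h. Df x \<bullet> h)) (at x)) \<and> continuous_on S Df)"

lemma grad_nth [simp]: "grad f x $ i = pderivative i f x"
  by (simp add: grad_def)

lemma norm_vec_squared: "(norm v)\<^sup>2 = (\<Sum>i\<in>UNIV. (v $ i)\<^sup>2)" for v :: "real ^ 'k::finite"
  unfolding power2_norm_eq_inner inner_vec_def by (simp add: power2_eq_square)

lemma grad_eqI:
  assumes "(f has_derivative (\<lambda>h. v \<bullet> h)) (at x)"
  shows "grad f x = v" "pderivative i f x = v $ i"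
proof -
  have "frechet_derivative f (at x) = (\<lambda>h. v \<bullet> h)"
    using frechet_derivative_at[OF assms] by simp
  then have "pderivative i f x = v $ i" for i
    by (simp add: pderivative_def inner_axis)
  then show "grad f x = v" "pderivative i f x = v $ i" by (auto simp: vec_eq_iff)
qed

lemma C1D:
  assumes "C1 S f"
  shows "x \<in> S \<Longrightarrow> (f has_derivative (\<lambda>h. grad f x \<bullet> h)) (at x)" "continuous_on S (grad f)"
    "continuous_on S (\<lambda>x. pderivative i f x)" "continuous_on S f"
proof -
  obtain Df where D: "\<And>x. x \<in> S \<Longrightarrow> (f has_derivative (\<lambda>h. Df x \<bullet> h)) (at x)" "continuous_on S Df"
    using assms unfolding C1_def by blast
  have eq: "grad f x = Df x" if "x \<in> S" for x using grad_eqI(1)[OF D(1)[OF that]] .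
  show "x \<in> S \<Longrightarrow> (f has_derivative (\<lambda>h. grad f x \<bullet> h)) (at x)" using D(1) eq by simp
  show c: "continuous_on S (grad f)" by (rule continuous_on_eq[OF D(2)]) (use eq in simp)
  show "continuous_on S (\<lambda>x. pderivative i f x)"
    using bounded_linear.continuous_on[OF bounded_linear_vec_nth c, of i] by simp
  show "continuous_on S f"
    by (rule has_derivative_continuous_on) (use D(1) has_derivative_at_withinI in blast)
qed

lemma C1I:
  assumes "\<And>x. x \<in> S \<Longrightarrow> (f has_derivative (\<lambda>h. Df x \<bullet> h)) (at x)" "continuous_on S Df"
  shows "C1 S f"
  unfolding C1_def using assms by blast

lemma C1_subset: "C1 S f \<Longrightarrow> T \<subseteq> S \<Longrightarrow> C1 T f"
  unfolding C1_def using continuous_on_subset by blast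

lemma C1_cong:
  assumes "C1 S f" "open S" "\<And>x. x \<in> S \<Longrightarrow> f x = g x"
  shows "C1 S g"
proof (rule C1I[OF _ C1D(2)[OF assms(1)]])
  show "(g has_derivative (\<lambda>h. grad f x \<bullet> h)) (at x)" if "x \<in> S" for x
    by (rule has_derivative_transform_within_open[OF C1D(1)[OF assms(1) that] assms(2) that assms(3)])
qed

lemma pderivative_cong:
  assumes "open S" "x \<in> S" "\<And>x. x \<in> S \<Longrightarrow> f x = g x" "C1 S f"
  shows "pderivative i f x = pderivative i g x"
proof -
  have "(g has_derivative (\<lambda>h. grad f x \<bullet> h)) (at x)"
    by (rule has_derivative_transform_within_open[OF C1D(1)[OF assms(4,2)] assms(1,2,3)])
  from grad_eqI(2)[OF this] show ?thesis by simp
qed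

lemma C1_const: "C1 S (\<lambda>_. c)"
  by (rule C1I[of _ _ "\<lambda>_. 0"]) (auto intro: continuous_intros)

lemma pderivative_const: "pderivative i (\<lambda>_. c) x = 0"
  using grad_eqI(2)[of "\<lambda>_. c" 0 x i] by simp

lemma has_derivative_nth: "((\<lambda>x::real^'k::finite. x $ i) has_derivative (\<lambda>h. axis i 1 \<bullet> h)) (at x)"
  by (rule has_derivative_eq_rhs[OF bounded_linear_imp_has_derivative[OF bounded_linear_vec_nth]])
     (simp add: inner_axis' fun_eq_iff)

lemma C1_nth: "C1 S (\<lambda>x. x $ i)"
  by (rule C1I[OF has_derivative_nth]) (auto intro: continuous_intros)

lemma pderivative_nth: "pderivative j (\<lambda>x. x $ i) x = (if i = j then 1 else 0)"
  using grad_eqI(2)[OF has_derivative_nth, of j i x] by (simp add: axis_def)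

lemma C1_add:
  assumes "C1 S f" "C1 S g"
  shows "C1 S (\<lambda>x. f x + g x)" "x \<in> S \<Longrightarrow> pderivative i (\<lambda>x. f x + g x) x = pderivative i f x + pderivative i g x"
proof -
  have d: "((\<lambda>x. f x + g x) has_derivative (\<lambda>h. (grad f x + grad g x) \<bullet> h)) (at x)" if "x \<in> S" for x
    by (rule has_derivative_eq_rhs[OF has_derivative_add[OF C1D(1)[OF assms(1) that] C1D(1)[OF assms(2) that]]])
       (auto simp: inner_add_left)
  show "C1 S (\<lambda>x. f x + g x)"
    by (rule C1I[OF d]) (auto intro!: continuous_intros C1D(2) assms)
  show "pderivative i (\<lambda>x. f x + g x) x = pderivative i f x + pderivative i g x" if "x \<in> S"
    using grad_eqI(2)[OF d[OF that]] by simp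
qed

lemma C1_mult:
  assumes "C1 S f" "C1 S g"
  shows "C1 S (\<lambda>x. f x * g x)"
    "x \<in> S \<Longrightarrow> pderivative i (\<lambda>x. f x * g x) x = f x * pderivative i g x + pderivative i f x * g x"
proof -
  have d: "((\<lambda>x. f x * g x) has_derivative (\<lambda>h. (f x *\<^sub>R grad g x + g x *\<^sub>R grad f x) \<bullet> h)) (at x)" if "x \<in> S" for x
    by (rule has_derivative_eq_rhs[OF has_derivative_mult[OF C1D(1)[OF assms(1) that] C1D(1)[OF assms(2) that]]])
       (auto simp: inner_add_left mult.commute)
  show "C1 S (\<lambda>x. f x * g x)"
    by (rule C1I[OF d]) (auto intro!: continuous_intros C1D(2,4) assms)
  show "pderivative i (\<lambda>x. f x * g x) x = f x * pderivative i g x + pderivative i f x * g x" if "x \<in> S"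
    using grad_eqI(2)[OF d[OF that]] by simp
qed

lemma C1_cmult:
  assumes "C1 S f"
  shows "C1 S (\<lambda>x. c * f x)" "x \<in> S \<Longrightarrow> pderivative i (\<lambda>x. c * f x) x = c * pderivative i f x"
  using C1_mult[OF C1_const[of S c] assms] by (auto simp: pderivative_const)

lemma C1_diff:
  assumes "C1 S f" "C1 S g"
  shows "C1 S (\<lambda>x. f x - g x)" "x \<in> S \<Longrightarrow> pderivative i (\<lambda>x. f x - g x) x = pderivative i f x - pderivative i g x"
  using C1_add[OF assms(1) C1_cmult(1)[OF assms(2), of "-1"]] C1_cmult(2)[OF assms(2), of _ _ "-1"] by auto

lemma C1_sum:
  assumes "finite I" "\<And>j. j \<in> I \<Longrightarrow> C1 S (f j)"
  shows "C1 S (\<lambda>x. \<Sum>j\<in>I. f j x) \<and> (\<forall>x\<in>S. pderivative i (\<lambda>x. \<Sum>j\<in>I. f j x) x = (\<Sum>j\<in>I. pderivative i (f j) x))"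
  using assms
proof (induction I)
  case empty
  then show ?case using C1_const[of S 0] pderivative_const[of i 0] by simp
next
  case (insert a I)
  then show ?case using C1_add[of S "f a" "\<lambda>x. \<Sum>j\<in>I. f j x"] by simp
qed

lemma C1_sum_UNIV:
  assumes "\<And>j::'i::finite. C1 S (f j)"
  shows "C1 S (\<lambda>x. \<Sum>j\<in>UNIV. f j x)"
    "x \<in> S \<Longrightarrow> pderivative i (\<lambda>x. \<Sum>j\<in>UNIV. f j x) x = (\<Sum>j\<in>UNIV. pderivative i (f j) x)"
  using C1_sum[of UNIV S f i] assms by auto

lemma C1_prod:
  assumes "finite I" "\<And>j. j \<in> I \<Longrightarrow> C1 S (f j)"
  shows "C1 S (\<lambda>x. \<Prod>j\<in>I. f j x)"
  using assms
proof (induction I)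
  case empty
  then show ?case using C1_const[of S 1] by simp
next
  case (insert a I)
  then show ?case using C1_mult(1)[of S "f a" "\<lambda>x. \<Prod>j\<in>I. f j x"] by simp
qed

lemma C1_compose:
  fixes \<phi> :: "real \<Rightarrow> real"
  assumes f: "C1 S f" and \<phi>: "\<And>x. x \<in> S \<Longrightarrow> (\<phi> has_real_derivative \<phi>' (f x)) (at (f x))"
    and c: "continuous_on S (\<lambda>x. \<phi>' (f x))"
  shows "C1 S (\<lambda>x. \<phi> (f x))" "x \<in> S \<Longrightarrow> pderivative i (\<lambda>x. \<phi> (f x)) x = \<phi>' (f x) * pderivative i f x"
proof -
  have d: "((\<lambda>x. \<phi> (f x)) has_derivative (\<lambda>h. (\<phi>' (f x) *\<^sub>R grad f x) \<bullet> h)) (at x)" if "x \<in> S" for x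
    using DERIV_compose_FDERIV[OF \<phi>[OF that] C1D(1)[OF f that]] by (simp add: mult.commute)
  show "C1 S (\<lambda>x. \<phi> (f x))"
    by (rule C1I[OF d]) (auto intro!: continuous_intros C1D(2) assms)
  show "pderivative i (\<lambda>x. \<phi> (f x)) x = \<phi>' (f x) * pderivative i f x" if "x \<in> S"
    using grad_eqI(2)[OF d[OF that]] by simp
qed

lemma C1_powr:
  assumes "C1 S f" "\<And>x. x \<in> S \<Longrightarrow> 0 < f x"
  shows "C1 S (\<lambda>x. f x powr a)"
    "x \<in> S \<Longrightarrow> pderivative i (\<lambda>x. f x powr a) x = a * f x powr (a - 1) * pderivative i f x"
proof -
  have d: "((\<lambda>t. t powr a) has_real_derivative a * f x powr (a - 1)) (at (f x))" if "x \<in> S" for x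
    using assms(2)[OF that] by (rule has_real_derivative_powr)
  have c: "continuous_on S (\<lambda>x. a * f x powr (a - 1))"
    by (intro continuous_intros C1D(4)[OF assms(1)]) (use assms(2) in force)
  show "C1 S (\<lambda>x. f x powr a)"
    "x \<in> S \<Longrightarrow> pderivative i (\<lambda>x. f x powr a) x = a * f x powr (a - 1) * pderivative i f x"
    using C1_compose[OF assms(1), of "\<lambda>t. t powr a" "\<lambda>t. a * t powr (a - 1)"] d c by blast+
qed

lemma sup_bound_vec:
  fixes z :: "real ^ 'k::finite \<Rightarrow> real" and V :: "'k \<Rightarrow> real ^ 'k \<Rightarrow> real" and f G M k0 \<delta> :: real
  assumes Q: "open Q" "Q \<subseteq> cball a \<delta>" and z: "C1 Q z" and V: "\<And>i. C1 Q (V i)"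
    and K: "compact {x \<in> Q. k0 \<le> z x}"
    and div: "\<And>x. x \<in> Q \<Longrightarrow> k0 < z x \<Longrightarrow> - f \<le> (\<Sum>i\<in>UNIV. pderivative i (V i) x)"
    and ell: "\<And>x. x \<in> Q \<Longrightarrow> k0 < z x \<Longrightarrow>
      (\<Sum>i\<in>UNIV. (pderivative i z x)\<^sup>2) / 2 - G\<^sup>2 / 2 \<le> (\<Sum>i\<in>UNIV. V i x * pderivative i z x)"
    and M: "\<And>x. x \<in> Q \<Longrightarrow> z x - k0 \<le> M" and f: "0 \<le> f" "f * M \<le> G\<^sup>2 / 2" and G: "0 < G"
    and \<delta>: "0 < \<delta>" and x: "x \<in> Q"
  shows "z x \<le> k0 + 48 * CARD('k) * 2 ^ CARD('k) * G * \<delta>"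
proof -
  have B: "(Basis :: (real^'k) set) = (\<lambda>i. axis i 1) ` UNIV" by (auto simp: Basis_vec_def)
  have inj: "inj (\<lambda>i::'k. axis i (1::real))" by (auto simp: inj_on_def axis_eq_axis)
  have "z x \<le> k0 + 48 * DIM(real^'k) * 2 ^ DIM(real^'k) * G * \<delta>"
  proof (rule sup_bound[where V = "\<lambda>x. \<chi> i. V i x" and V' = "\<lambda>x h. \<chi> i. grad (V i) x \<bullet> h" and Dz = "grad z"
        and M = M and f = f and a = a and Q = Q])
    show "((\<lambda>x. \<chi> i. V i x) has_derivative (\<lambda>h. \<chi> i. grad (V i) x \<bullet> h)) (at x)" if "x \<in> Q" for x
      unfolding has_derivative_componentwise_within[of "\<lambda>x. \<chi> i. V i x"]
      using C1D(1)[OF V that] by (auto simp: B inner_axis)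
    show "continuous_on Q (\<lambda>x. \<chi> i. grad (V i) x \<bullet> b)" for b
      by (intro continuous_intros C1D(2) V)
    show "- f \<le> (\<Sum>b\<in>Basis. (\<chi> i. grad (V i) x \<bullet> b) \<bullet> b)" if "x \<in> Q" "k0 < z x" for x
      unfolding B sum.reindex[OF inj] using div[OF that] by (simp add: inner_axis)
    show "(norm (grad z x))\<^sup>2 / 2 - G\<^sup>2 / 2 \<le> (\<chi> i. V i x) \<bullet> grad z x" if "x \<in> Q" "k0 < z x" for x
      unfolding norm_vec_squared using ell[OF that] by (simp add: inner_vec_def)
  qed (use assms C1D[OF z] in auto)
  then show ?thesis by simp
qed

section \<open>Elliptic quadratic forms and the spreading of positivity\<close>

lemma quadratic_form_expand:
  fixes A :: "real ^ 'k::finite ^ 'k" and v :: "real ^ 'k"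
  shows "v \<bullet> (A *v v) = (\<Sum>i\<in>UNIV. (\<Sum>j\<in>UNIV. A $ i $ j * v $ j) * v $ i)"
  by (simp add: inner_vec_def matrix_vector_mult_def mult.commute)

text \<open>The form attains a positive minimum on the product of K with the unit sphere, and
  homogeneity gives the rest.\<close>

lemma uniformly_elliptic_on_compact:
  fixes a :: "real ^ 'l::finite \<Rightarrow> real ^ 'k::finite ^ 'k"
  assumes K: "compact K" and c: "\<And>i j. continuous_on K (\<lambda>x. a x $ i $ j)"
    and pos: "\<And>x v. x \<in> K \<Longrightarrow> v \<noteq> 0 \<Longrightarrow> 0 < v \<bullet> (a x *v v)"
  obtains l where "0 < l" "\<And>x v. x \<in> K \<Longrightarrow> l * (norm v)\<^sup>2 \<le> v \<bullet> (a x *v v)"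
proof (cases "K = {}")
  case True
  then show ?thesis using that[of 1] by simp
next
  case False
  let ?q = "\<lambda>(x, v). \<Sum>i\<in>UNIV. (\<Sum>j\<in>UNIV. a x $ i $ j * v $ j) * v $ i"
  let ?S = "K \<times> sphere (0::real^'k) 1"
  have ne: "?S \<noteq> {}"
  proof -
    have "axis undefined 1 \<in> sphere (0::real^'k) 1" by simp
    then show ?thesis using False by blast
  qed
  have "continuous_on ?S ?q"
    unfolding case_prod_beta by (intro continuous_intros continuous_on_compose2[OF c continuous_on_fst[OF continuous_on_id]]) auto
  from continuous_attains_inf[OF compact_Times[OF K compact_sphere] ne this]
  obtain p where p: "p \<in> ?S" "\<And>y. y \<in> ?S \<Longrightarrow> ?q p \<le> ?q y" by blast
  have "fst p \<in> K" "snd p \<noteq> 0" using p(1) by auto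
  then have pp: "0 < ?q p" using pos[of "fst p" "snd p"] by (simp add: quadratic_form_expand case_prod_beta)
  show ?thesis
  proof (rule that[OF pp])
    fix x v assume x: "x \<in> K"
    show "?q p * (norm v)\<^sup>2 \<le> v \<bullet> (a x *v v)"
    proof (cases "v = 0")
      case False
      let ?w = "v /\<^sub>R norm v"
      have "?q p \<le> ?w \<bullet> (a x *v ?w)"
        using p(2)[of "(x, ?w)"] x False by (simp add: quadratic_form_expand)
      also have "\<dots> = (v \<bullet> (a x *v v)) / (norm v)\<^sup>2"
        by (simp add: matrix_vector_mult_scaleR power2_eq_square divide_simps)
      finally show ?thesis using False by (simp add: pos_le_divide_eq)
    qed simp
  qed
qed


text \<open>The barrier is the classical \<open>exp (- B |x - x1|\<^sup>2) - exp (- B R\<^sup>2)\<close> on an annulus.\<close>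

lemma positivity_propagates:
  fixes u K :: "real ^ 'k::finite \<Rightarrow> real" and a :: "real ^ 'k \<Rightarrow> real ^ 'k ^ 'k"
  assumes op: "open \<Omega>" and a: "\<And>i j. C1 \<Omega> (\<lambda>x. a x $ i $ j)"
    and pos: "\<And>x v. x \<in> \<Omega> \<Longrightarrow> v \<noteq> 0 \<Longrightarrow> 0 < v \<bullet> (a x *v v)"
    and u: "C1 \<Omega> u" "\<And>j. C1 \<Omega> (pderivative j u)" and u0: "\<And>x. x \<in> \<Omega> \<Longrightarrow> 0 \<le> u x"
    and K: "continuous_on \<Omega> K"
    and L: "\<And>x. x \<in> \<Omega> \<Longrightarrow> (\<Sum>i\<in>UNIV. pderivative i (\<lambda>x. \<Sum>j\<in>UNIV. a x $ i $ j * pderivative j u x) x) \<le> K x * u x"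
    and R: "0 < R" "cball x1 R \<subseteq> \<Omega>" and ux1: "0 < u x1" and y: "y \<in> ball x1 R"
  shows "0 < u y"
proof -
  have "continuous (at x1) u"
    using C1D(4)[OF u(1)] op R by (meson centre_in_cball continuous_on_eq_continuous_at less_imp_le subsetD)
  then obtain d where d: "0 < d" "\<And>x. dist x x1 < d \<Longrightarrow> dist (u x) (u x1) < u x1 / 2"
    using ux1 unfolding continuous_at_eps_delta by (metis half_gt_zero)
  define \<delta> where "\<delta> = min (d / 2) (R / 2)"
  have \<delta>: "0 < \<delta>" "\<delta> < R" using d R by (auto simp: \<delta>_def)
  define e where "e = u x1 / 2"
  have e: "0 < e" using ux1 by (simp add: e_def)
  have ue: "e \<le> u x" if "dist x x1 \<le> \<delta>" for x
    using d(2)[of x] that \<delta>_def d(1) by (auto simp: e_def dist_real_def abs_if split: if_splits)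
  show ?thesis
  proof (cases "dist y x1 \<le> \<delta>")
    case True
    then show ?thesis using ue[OF True] e by simp
  next
    case False
    let ?C = "cball x1 R"
    have cC: "compact ?C" by simp
    have sub: "continuous_on ?C f" if "continuous_on \<Omega> f" for f :: "real^'k \<Rightarrow> real"
      using that R(2) continuous_on_subset by blast
    obtain l where l: "0 < l" "\<And>x v. x \<in> ?C \<Longrightarrow> l * (norm v)\<^sup>2 \<le> v \<bullet> (a x *v v)"
      by (rule uniformly_elliptic_on_compact[OF cC, of a]) (use sub C1D(4)[OF a] pos R(2) in auto)
    define w where "w j x = x $ j - x1 $ j" for j and x :: "real^'k"
    define p where "p i x = (\<Sum>j\<in>UNIV. a x $ i $ j * w j x)" for i x
    have Cw: "C1 \<Omega> (w j)" for j
      unfolding w_def using C1_diff(1)[OF C1_nth C1_const] .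
    have dw: "pderivative i (w j) x = (if j = i then 1 else 0)" for i j x
      unfolding w_def using C1_diff(2)[OF C1_nth C1_const, of x UNIV i j "x1 $ j"]
      by (simp add: pderivative_nth pderivative_const)
    have Cp: "C1 \<Omega> (p i)" for i
      unfolding p_def by (intro C1_sum_UNIV(1) C1_mult(1)[OF a Cw])
    define D where "D x = (\<Sum>i\<in>UNIV. pderivative i (p i) x)" for x
    have cD: "continuous_on \<Omega> D" unfolding D_def by (intro continuous_intros C1D(3) Cp)
    have bd: "\<exists>B. \<forall>x\<in>?C. \<bar>f x\<bar> \<le> B" if "continuous_on \<Omega> f" for f :: "real^'k \<Rightarrow> real"
      using compact_imp_bounded[OF compact_continuous_image[OF sub[OF that] cC]] by (auto simp: bounded_iff)
    obtain D0 where D0: "\<And>x. x \<in> ?C \<Longrightarrow> \<bar>D x\<bar> \<le> D0" using bd[OF cD] by blast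
    obtain K0 where K0: "\<And>x. x \<in> ?C \<Longrightarrow> \<bar>K x\<bar> \<le> K0" using bd[OF K] by blast
    have x1C: "x1 \<in> ?C" using R by simp
    have D00: "0 \<le> D0" using D0[OF x1C] by linarith
    have K00: "0 \<le> K0" using K0[OF x1C] by linarith
    define s where "s x = (\<Sum>j\<in>UNIV. w j x * w j x)" for x
    have s: "s x = (dist x x1)\<^sup>2" for x
      by (simp add: s_def w_def dist_norm power2_norm_eq_inner inner_vec_def)
    have Cs: "C1 \<Omega> s" unfolding s_def by (intro C1_sum_UNIV(1) C1_mult(1)[OF Cw Cw])
    have ds: "pderivative i s x = 2 * w i x" if "x \<in> \<Omega>" for i x
    proof -
      have "pderivative i s x = (\<Sum>j\<in>UNIV. pderivative i (\<lambda>x. w j x * w j x) x)"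
        unfolding s_def by (rule C1_sum_UNIV(2)[OF C1_mult(1)[OF Cw Cw] that])
      also have "\<dots> = (\<Sum>j\<in>UNIV. if j = i then 2 * w j x else 0)"
        by (rule sum.cong) (auto simp: C1_mult(2)[OF Cw Cw that] dw)
      finally show ?thesis by simp
    qed
    \<comment> \<open>On the annulus the form \<open>?q\<close> is at least
      \<open>l * \<delta>\<^sup>2\<close>. With this B, the term \<open>4 * B\<^sup>2 * ?q\<close>
      from the second derivatives of the exponential outweighs both the derivatives of the
      coefficients, bounded by D0, and the zero order term, bounded by K0.\<close>
    define B where "B = max 1 ((D0 + K0) / (l * \<delta>\<^sup>2))"
    have B1: "1 \<le> B" by (simp add: B_def)
    have Bl: "D0 + K0 \<le> B * (l * \<delta>\<^sup>2)"
      using l(1) \<delta>(1) by (simp add: B_def pos_divide_le_eq[symmetric])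
    define E where "E x = exp (- B * s x)" for x
    have CE: "C1 \<Omega> E" and dE: "\<And>i x. x \<in> \<Omega> \<Longrightarrow> pderivative i E x = - 2 * B * w i x * E x"
    proof -
      have 1: "((\<lambda>t. exp (- B * t)) has_real_derivative - B * exp (- B * t)) (at t)" for t
        by (auto intro!: derivative_eq_intros)
      have 2: "continuous_on \<Omega> (\<lambda>x. - B * exp (- B * s x))"
        by (intro continuous_intros C1D(4)[OF Cs])
      note 3 = C1_compose[of \<Omega> s "\<lambda>t. exp (- B * t)" "\<lambda>t. - B * exp (- B * t)", OF Cs 1 2]
      show "C1 \<Omega> E" unfolding E_def by (rule 3(1))
      show "pderivative i E x = - 2 * B * w i x * E x" if "x \<in> \<Omega>" for i x
        using 3(2)[OF that, of i] ds[OF that, of i] unfolding E_def by simp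
    qed
    define v where "v x = E x - exp (- B * R\<^sup>2)" for x
    define z where "z x = e * v x - u x" for x
    have Cv: "C1 \<Omega> v" unfolding v_def using C1_diff(1)[OF CE C1_const] .
    have dv: "pderivative i v x = - 2 * B * w i x * E x" if "x \<in> \<Omega>" for i x
      unfolding v_def using C1_diff(2)[OF CE C1_const that] dE[OF that] by (simp add: pderivative_const)
    have Cz: "C1 \<Omega> z" unfolding z_def using C1_diff(1)[OF C1_cmult(1)[OF Cv] u(1)] .
    have dz: "pderivative i z x = e * (- 2 * B * w i x * E x) - pderivative i u x" if "x \<in> \<Omega>" for i x
      unfolding z_def using C1_diff(2)[OF C1_cmult(1)[OF Cv] u(1) that] C1_cmult(2)[OF Cv that] dv[OF that] by simp
    define W where "W i x = (\<Sum>j\<in>UNIV. a x $ i $ j * pderivative j u x)" for i x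
    have CW: "C1 \<Omega> (W i)" for i
      unfolding W_def by (intro C1_sum_UNIV(1) C1_mult(1)[OF a u(2)])
    \<comment> \<open>The flux of z divided by the ellipticity constant l, so that it meets the
      normalised condition of \<open>sup_bound_vec\<close>.\<close>
    define V where "V i x = (1 / l) * (e * (- 2 * B) * (E x * p i x) - W i x)" for i x
    have CEp: "C1 \<Omega> (\<lambda>x. E x * p i x)" for i by (rule C1_mult(1)[OF CE Cp])
    have CV: "C1 \<Omega> (V i)" for i
      unfolding V_def by (intro C1_cmult(1) C1_diff(1) CEp CW)
    define Q where "Q = ball x1 R - cball x1 \<delta>"
    have QO: "Q \<subseteq> \<Omega>" "Q \<subseteq> ?C" using R(2) by (auto simp: Q_def)
    have vle: "v x \<le> 1" for x
    proof -
      have "E x \<le> 1" using B1 by (simp add: E_def s)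
      then show ?thesis by (simp add: v_def) (smt (verit) exp_gt_zero)
    qed
    \<comment> \<open>Where z is positive, u lies below \<open>e * E x\<close>. This is how the zero
      order term of the equation is absorbed by the barrier.\<close>
    have divV: "0 \<le> (\<Sum>i\<in>UNIV. pderivative i (V i) x)" if x: "x \<in> Q" "0 < z x" for x
    proof -
      have xO: "x \<in> \<Omega>" "x \<in> ?C" using x(1) QO by auto
      have dV: "pderivative i (V i) x = (1 / l) * (e * (- 2 * B) * (E x * pderivative i (p i) x + (- 2 * B * w i x * E x) * p i x)
          - pderivative i (W i) x)" for i
        unfolding V_def
        by (simp only: C1_cmult(2)[OF C1_diff(1)[OF C1_cmult(1)[OF CEp] CW] xO(1)]
            C1_diff(2)[OF C1_cmult(1)[OF CEp] CW xO(1)] C1_cmult(2)[OF CEp xO(1)] C1_mult(2)[OF CE Cp xO(1)] dE[OF xO(1)])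
      let ?q = "\<Sum>i\<in>UNIV. w i x * p i x"
      have sum: "(\<Sum>i\<in>UNIV. pderivative i (V i) x)
         = (1 / l) * (e * E x * (4 * B\<^sup>2 * ?q - 2 * B * D x) - (\<Sum>i\<in>UNIV. pderivative i (W i) x))"
      proof -
        have "pderivative i (V i) x = (1 / l) * (e * E x * (4 * B\<^sup>2 * (w i x * p i x) - 2 * B * pderivative i (p i) x)
            - pderivative i (W i) x)" for i
          unfolding dV by (simp add: algebra_simps power2_eq_square)
        then show ?thesis unfolding D_def
          by (simp only: sum_distrib_left[symmetric] sum_subtractf)
      qed
      have q: "l * \<delta>\<^sup>2 \<le> ?q"
      proof -
        have "l * (norm (x - x1))\<^sup>2 \<le> (x - x1) \<bullet> (a x *v (x - x1))" by (rule l(2)[OF xO(2)])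
        also have "\<dots> = ?q" by (simp add: quadratic_form_expand p_def w_def mult.commute)
        moreover have "l * \<delta>\<^sup>2 \<le> l * (norm (x - x1))\<^sup>2"
          using x(1) l(1) \<delta>(1) by (intro mult_left_mono power_mono) (auto simp: Q_def dist_norm norm_minus_commute)
        ultimately show ?thesis by linarith
      qed
      have "K0 \<le> 4 * B\<^sup>2 * ?q - 2 * B * D x"
      proof -
        have "D0 + K0 \<le> B * ?q" using Bl mult_left_mono[OF q, of B] B1 by linarith
        then have "4 * B * (D0 + K0) \<le> 4 * B * (B * ?q)" using B1 by (intro mult_left_mono) auto
        moreover have "2 * B * D x \<le> 2 * B * D0" using D0[OF xO(2)] B1 by (intro mult_left_mono) auto
        moreover have "0 \<le> B * D0" "0 \<le> B * K0" "K0 \<le> B * K0" using B1 D00 K00 mult_right_mono[of 1 B K0] by auto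
        ultimately show ?thesis by (simp add: power2_eq_square algebra_simps)
      qed
      then have "e * E x * K0 \<le> e * E x * (4 * B\<^sup>2 * ?q - 2 * B * D x)"
        by (rule mult_left_mono) (use e in \<open>simp add: E_def\<close>)
      moreover have "(\<Sum>i\<in>UNIV. pderivative i (W i) x) \<le> K0 * u x"
      proof -
        have "(\<Sum>i\<in>UNIV. pderivative i (W i) x) \<le> K x * u x" unfolding W_def by (rule L[OF xO(1)])
        also have "\<dots> \<le> K0 * u x" using K0[OF xO(2)] u0[OF xO(1)] by (intro mult_right_mono) auto
        finally show ?thesis .
      qed
      moreover have "K0 * u x \<le> e * E x * K0"
      proof -
        have "u x \<le> e * v x" using x(2) by (simp add: z_def)
        also have "\<dots> \<le> e * E x" using e by (intro mult_left_mono) (auto simp: v_def)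
        finally show ?thesis using K00 mult_left_mono[of "u x" "e * E x" K0] by (simp add: mult.commute)
      qed
      ultimately show ?thesis unfolding sum using l(1) by simp
    qed
    have ell: "(\<Sum>i\<in>UNIV. (pderivative i z x)\<^sup>2) / 2 \<le> (\<Sum>i\<in>UNIV. V i x * pderivative i z x)" if x: "x \<in> Q" for x
    proof -
      have xO: "x \<in> \<Omega>" "x \<in> ?C" using x QO by auto
      have Vx: "V i x = (1 / l) * (\<Sum>j\<in>UNIV. a x $ i $ j * pderivative j z x)" for i
        unfolding V_def p_def W_def dz[OF xO(1)]
        by (simp add: sum_distrib_left sum_subtractf algebra_simps)
      have "l * (norm (grad z x))\<^sup>2 \<le> grad z x \<bullet> (a x *v grad z x)" by (rule l(2)[OF xO(2)])
      also have "\<dots> = l * (\<Sum>i\<in>UNIV. V i x * pderivative i z x)"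
      proof -
        have "l * V i x = (\<Sum>j\<in>UNIV. a x $ i $ j * pderivative j z x)" for i unfolding Vx using l(1) by simp
        then show ?thesis by (simp add: quadratic_form_expand sum_distrib_left mult.assoc[symmetric])
      qed
      finally have "(norm (grad z x))\<^sup>2 \<le> (\<Sum>i\<in>UNIV. V i x * pderivative i z x)" using l(1) by simp
      moreover have "(norm (grad z x))\<^sup>2 = (\<Sum>i\<in>UNIV. (pderivative i z x)\<^sup>2)" by (simp add: norm_vec_squared)
      moreover have "0 \<le> (\<Sum>i\<in>UNIV. (pderivative i z x)\<^sup>2)" by (simp add: sum_nonneg)
      ultimately show ?thesis by linarith
    qed
    have yQ: "y \<in> Q" using y False by (auto simp: Q_def dist_commute)
    \<comment> \<open>Here \<open>sup_bound_vec\<close> acts as a weak maximum principle. On both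
      spheres bounding the annulus z is at most 0, so its superlevel sets at positive levels are
      compact in Q; with f = 0 both k0 and G may then tend to 0.\<close>
    have main: "z y \<le> k0 + 48 * CARD('k) * 2 ^ CARD('k) * G * R" if k0: "0 < k0" and G: "0 < G" for k0 G :: real
    proof (rule sup_bound_vec[where a = x1 and V = V and f = 0 and M = e and Q = Q])
      show "open Q" by (simp add: Q_def open_Diff)
      show "Q \<subseteq> cball x1 R" by (rule QO(2))
      show "C1 Q z" "\<And>i. C1 Q (V i)" using Cz CV QO(1) C1_subset by blast+
      show "compact {x \<in> Q. k0 \<le> z x}"
      proof -
        let ?A = "cball x1 R - ball x1 \<delta>"
        have cA: "compact ?A" by (intro compact_diff) auto
        have "continuous_on ?A z" using C1D(4)[OF Cz] R(2) continuous_on_subset by blast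
        then have "closed {x \<in> ?A. k0 \<le> z x}"
          by (intro continuous_on_closed_Collect_le) (use cA compact_imp_closed in auto)
        moreover have "{x \<in> ?A. k0 \<le> z x} = {x \<in> Q. k0 \<le> z x}"
        proof -
          have "x \<in> Q" if x: "x \<in> ?A" "k0 \<le> z x" for x
          proof -
            have xO: "x \<in> \<Omega>" using x(1) R(2) by auto
            have "dist x x1 \<noteq> R"
            proof
              assume "dist x x1 = R"
              then have "v x = 0" by (simp add: v_def E_def s)
              then show False using x(2) k0 u0[OF xO] by (simp add: z_def)
            qed
            moreover have "dist x x1 \<noteq> \<delta>"
            proof
              assume "dist x x1 = \<delta>"
              then have "e \<le> u x" using ue by simp
              moreover have "e * v x \<le> e" using vle[of x] e by (simp add: mult_le_cancel_left2)
              ultimately show False using x(2) k0 by (simp add: z_def)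
            qed
            ultimately show ?thesis using x(1) by (auto simp: Q_def dist_commute)
          qed
          then show ?thesis by (auto simp: Q_def)
        qed
        moreover have "?A \<inter> {x \<in> ?A. k0 \<le> z x} = {x \<in> ?A. k0 \<le> z x}" by blast
        ultimately show ?thesis using compact_Int_closed[OF cA, of "{x \<in> ?A. k0 \<le> z x}"] by simp
      qed
      show "- 0 \<le> (\<Sum>i\<in>UNIV. pderivative i (V i) x)" if "x \<in> Q" "k0 < z x" for x
        using divV[OF that(1)] that(2) k0 by simp
      show "(\<Sum>i\<in>UNIV. (pderivative i z x)\<^sup>2) / 2 - G\<^sup>2 / 2 \<le> (\<Sum>i\<in>UNIV. V i x * pderivative i z x)" if "x \<in> Q" for x
        using ell[OF that] zero_le_power2[of G] by linarith
      show "z x - k0 \<le> e" if "x \<in> Q" for x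
      proof -
        have "e * v x \<le> e" using vle[of x] e by (simp add: mult_le_cancel_left2)
        then show ?thesis using u0[of x] that QO(1) k0 by (auto simp: z_def)
      qed
    qed (use G R(1) yQ in auto)
    have "z y \<le> 0 + t" if "0 < t" for t
    proof -
      let ?c = "48 * real CARD('k) * 2 ^ CARD('k) * R"
      have c: "0 < ?c" using R(1) by simp
      have "z y \<le> t / 2 + 48 * real CARD('k) * 2 ^ CARD('k) * (t / 2 / ?c) * R"
        using main[of "t / 2" "t / 2 / ?c"] that c R(1) by simp
      also have "48 * real CARD('k) * 2 ^ CARD('k) * (t / 2 / ?c) * R = t / 2"
        using R(1) by simp
      finally show ?thesis by simp
    qed
    then have "z y \<le> 0" by (rule field_le_epsilon)
    moreover have "0 < v y"
    proof -
      have "(dist y x1)\<^sup>2 < R\<^sup>2" using y by (intro power_strict_mono) (auto simp: dist_commute)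
      then show ?thesis using B1 by (simp add: v_def E_def s)
    qed
    ultimately have "0 < e * v y" "e * v y \<le> u y" using e by (simp_all add: z_def)
    then show ?thesis by linarith
  qed
qed

section \<open>The boundary iteration\<close>

lemma sum_UNIV_option: "(\<Sum>k\<in>(UNIV :: 'n::finite option set). f k) = f None + (\<Sum>i\<in>UNIV. f (Some i))"
  by (simp add: UNIV_option_conv sum.reindex)

text \<open>In the application p is the gradient of the difference z, s that of the barrier, e the
  perturbation \<open>a - r^m b\<close>, and \<rho> the weight r^m. Smallness of \<eta> costs half
  of \<mu>, Young's inequality for the term with s another quarter; \<mu> / 4 remains, together with
  the square of the size of that term.\<close>

lemma perturbed_quadratic_form_lower_bound:
  fixes b e :: "real ^ 'k::finite ^ 'k" and p s :: "real ^ 'k" and \<rho> \<mu> \<eta> \<sigma> :: real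
  assumes b: "\<And>v. \<mu> * (norm v)\<^sup>2 \<le> v \<bullet> (b *v v)" and \<mu>: "0 < \<mu>" and \<rho>: "0 \<le> \<rho>"
    and e: "\<And>i j. \<bar>e $ i $ j\<bar> \<le> \<rho> * \<eta>" and s: "\<And>j. \<bar>s $ j\<bar> \<le> \<sigma>" and \<eta>: "0 \<le> \<eta>" "2 * real CARD('k) * \<eta> \<le> \<mu>"
  shows "\<rho> * (\<mu> / 4 * (\<Sum>i\<in>UNIV. (p $ i)\<^sup>2) - CARD('k) * (CARD('k) * \<eta> * \<sigma>)\<^sup>2 / \<mu>)
    \<le> (\<Sum>i\<in>UNIV. (\<Sum>j\<in>UNIV. (\<rho> * b $ i $ j + e $ i $ j) * p $ j - e $ i $ j * s $ j) * p $ i)"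
proof -
  let ?N = "real CARD('k)" and ?P = "\<Sum>i\<in>UNIV. (p $ i)\<^sup>2"
  have P: "(norm p)\<^sup>2 = ?P" by (rule norm_vec_squared)
  have 1: "\<mu> * ?P \<le> (\<Sum>i\<in>UNIV. (\<Sum>j\<in>UNIV. b $ i $ j * p $ j) * p $ i)"
    using b[of p] unfolding P quadratic_form_expand .
  have \<sigma>: "0 \<le> \<sigma>" using s[of undefined] by linarith
  have 2: "- (\<rho> * (\<mu> / 2 * ?P)) \<le> (\<Sum>i\<in>UNIV. (\<Sum>j\<in>UNIV. e $ i $ j * p $ j) * p $ i)"
  proof -
    have t: "- (\<rho> * \<eta> * (((p $ i)\<^sup>2 + (p $ j)\<^sup>2) / 2)) \<le> e $ i $ j * p $ j * p $ i" for i j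
    proof -
      have "\<bar>e $ i $ j * p $ j * p $ i\<bar> \<le> (\<rho> * \<eta>) * \<bar>p $ j * p $ i\<bar>"
        using mult_right_mono[OF e[of i j], of "\<bar>p $ j * p $ i\<bar>"] by (simp add: abs_mult mult.assoc)
      also have "\<bar>p $ j * p $ i\<bar> \<le> ((p $ i)\<^sup>2 + (p $ j)\<^sup>2) / 2"
        using sum_squares_bound[of "\<bar>p $ i\<bar>" "\<bar>p $ j\<bar>"] by (simp add: abs_mult mult.commute mult.left_commute)
      finally show ?thesis using \<rho> \<eta>(1) by (smt (verit) mult_left_mono mult_nonneg_nonneg)
    qed
    have "- (\<rho> * (?N * \<eta> * ?P)) = (\<Sum>i\<in>UNIV. \<Sum>j\<in>UNIV. - (\<rho> * \<eta> * (((p $ i)\<^sup>2 + (p $ j)\<^sup>2) / 2)))"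
    proof -
      have "(\<Sum>i\<in>UNIV. \<Sum>j\<in>UNIV. ((p $ i)\<^sup>2 + (p $ j)\<^sup>2) / 2) = ?N * ?P"
        by (simp add: sum.distrib add_divide_distrib sum_divide_distrib[symmetric] sum_distrib_left[symmetric])
      then show ?thesis by (simp only: sum_negf sum_distrib_left[symmetric]) simp
    qed
    also have "\<dots> \<le> (\<Sum>i\<in>UNIV. \<Sum>j\<in>UNIV. e $ i $ j * p $ j * p $ i)"
      by (intro sum_mono t)
    finally have "- (\<rho> * (?N * \<eta> * ?P)) \<le> (\<Sum>i\<in>UNIV. (\<Sum>j\<in>UNIV. e $ i $ j * p $ j) * p $ i)"
      by (simp add: sum_distrib_right)
    moreover have "\<rho> * (?N * \<eta> * ?P) \<le> \<rho> * (\<mu> / 2 * ?P)"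
      by (intro mult_left_mono mult_right_mono) (use \<eta> \<rho> in \<open>auto intro: sum_nonneg\<close>)
    ultimately show ?thesis by linarith
  qed
  have 3: "(\<Sum>i\<in>UNIV. (\<Sum>j\<in>UNIV. e $ i $ j * s $ j) * p $ i) \<le> \<rho> * (\<mu> / 4 * ?P + ?N * (?N * \<eta> * \<sigma>)\<^sup>2 / \<mu>)"
  proof -
    have "(\<Sum>j\<in>UNIV. e $ i $ j * s $ j) * p $ i \<le> \<rho> * (\<mu> / 4 * (p $ i)\<^sup>2 + (?N * \<eta> * \<sigma>)\<^sup>2 / \<mu>)" for i
    proof -
      have "\<bar>\<Sum>j\<in>UNIV. e $ i $ j * s $ j\<bar> \<le> (\<Sum>j\<in>(UNIV::'k set). \<rho> * \<eta> * \<sigma>)"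
        by (rule order_trans[OF sum_abs sum_mono]) (use e s \<rho> \<eta> in \<open>auto simp: abs_mult intro!: mult_mono\<close>)
      then have "\<bar>\<Sum>j\<in>UNIV. e $ i $ j * s $ j\<bar> \<le> \<rho> * (?N * \<eta> * \<sigma>)" by (simp add: mult_ac)
      then have "\<bar>(\<Sum>j\<in>UNIV. e $ i $ j * s $ j) * p $ i\<bar> \<le> \<rho> * (?N * \<eta> * \<sigma>) * \<bar>p $ i\<bar>"
        unfolding abs_mult by (rule mult_right_mono) simp
      moreover have "(?N * \<eta> * \<sigma>) * \<bar>p $ i\<bar> \<le> \<mu> / 4 * (p $ i)\<^sup>2 + (?N * \<eta> * \<sigma>)\<^sup>2 / \<mu>"
      proof -
        let ?f = "?N * \<eta> * \<sigma>"
        have "0 \<le> (\<mu> / 2 * \<bar>p $ i\<bar> - ?f)\<^sup>2 / \<mu>" using \<mu> by simp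
        also have "\<dots> = \<mu> / 4 * (p $ i)\<^sup>2 + ?f\<^sup>2 / \<mu> - ?f * \<bar>p $ i\<bar>"
          using \<mu> by (simp add: power2_diff power_mult_distrib power2_eq_square field_simps)
        finally show ?thesis by simp
      qed
      then have "\<rho> * ((?N * \<eta> * \<sigma>) * \<bar>p $ i\<bar>) \<le> \<rho> * (\<mu> / 4 * (p $ i)\<^sup>2 + (?N * \<eta> * \<sigma>)\<^sup>2 / \<mu>)"
        by (rule mult_left_mono[OF _ \<rho>])
      ultimately show ?thesis by (simp add: mult.assoc)
    qed
    then have "(\<Sum>i\<in>UNIV. (\<Sum>j\<in>UNIV. e $ i $ j * s $ j) * p $ i)
      \<le> (\<Sum>i\<in>(UNIV::'k set). \<rho> * (\<mu> / 4 * (p $ i)\<^sup>2 + (?N * \<eta> * \<sigma>)\<^sup>2 / \<mu>))"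
      by (intro sum_mono) auto
    also have "\<dots> = \<rho> * (\<mu> / 4 * ?P + ?N * (?N * \<eta> * \<sigma>)\<^sup>2 / \<mu>)"
      by (simp only: sum_distrib_left[symmetric] sum.distrib) simp
    finally show ?thesis .
  qed
  have "(\<Sum>i\<in>UNIV. (\<Sum>j\<in>UNIV. (\<rho> * b $ i $ j + e $ i $ j) * p $ j - e $ i $ j * s $ j) * p $ i)
    = \<rho> * (\<Sum>i\<in>UNIV. (\<Sum>j\<in>UNIV. b $ i $ j * p $ j) * p $ i)
      + (\<Sum>i\<in>UNIV. (\<Sum>j\<in>UNIV. e $ i $ j * p $ j) * p $ i) - (\<Sum>i\<in>UNIV. (\<Sum>j\<in>UNIV. e $ i $ j * s $ j) * p $ i)"
    by (simp add: distrib_right left_diff_distrib sum.distrib sum_subtractf sum_distrib_left sum_distrib_right mult.assoc)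
  moreover have "\<rho> * (\<mu> * ?P) \<le> \<rho> * (\<Sum>i\<in>UNIV. (\<Sum>j\<in>UNIV. b $ i $ j * p $ j) * p $ i)"
    by (rule mult_left_mono[OF 1 \<rho>])
  moreover have "\<rho> * (\<mu> / 4 * ?P - ?N * (?N * \<eta> * \<sigma>)\<^sup>2 / \<mu>) =
     \<rho> * (\<mu> * ?P) - \<rho> * (\<mu> / 2 * ?P) - \<rho> * (\<mu> / 4 * ?P + ?N * (?N * \<eta> * \<sigma>)\<^sup>2 / \<mu>)"
    by (simp add: algebra_simps)
  ultimately show ?thesis using 2 3 by linarith
qed

text \<open>Used with t = r / R for both m and -m, so that positive and negative exponents are
  treated alike.\<close>

lemma powr_between:
  fixes t m :: real
  assumes "0 < t" "t \<le> 1" "-1 \<le> m" "m \<le> 1"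
  shows "t \<le> t powr m" "t powr m \<le> 1 / t"
proof -
  have "t powr 1 \<le> t powr m" by (rule powr_mono') (use assms in auto)
  then show "t \<le> t powr m" using assms by simp
  have "t powr m \<le> t powr (-1)" by (rule powr_mono') (use assms in auto)
  then show "t powr m \<le> 1 / t" using assms by (simp add: powr_minus_divide)
qed

text \<open>Here \<open>r\<close> is the coordinate \<open>None\<close>. Only the size of \<open>a - r\<^sup>m b\<close> is controlled, not its
  derivatives.\<close>

locale degenerate_supersolution =
  fixes x0 :: "real ^ ('n::finite option)" and \<Omega> :: "(real ^ ('n option)) set"
    and a :: "real ^ ('n option) \<Rightarrow> real ^ ('n option) ^ ('n option)"
    and b :: "real ^ ('n option) ^ ('n option)" and u :: "real ^ ('n option) \<Rightarrow> real"
    and m \<alpha> \<mu> C R0 :: real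
  fixes p2 :: "real ^ ('n option) \<Rightarrow> real" and Cyl Q :: "real \<Rightarrow> (real ^ ('n option)) set"
  defines p2_def: "p2 x \<equiv> \<Sum>i\<in>UNIV. (x $ Some i - x0 $ Some i) * (x $ Some i - x0 $ Some i)"
    and Cyl_def: "Cyl R \<equiv> {x. 0 \<le> x $ None \<and> x $ None \<le> R \<and> p2 x \<le> R\<^sup>2}"
    and Q_def: "Q R \<equiv> {x. 0 < x $ None \<and> x $ None < R \<and> p2 x < R\<^sup>2}"
  assumes x0: "x0 $ None = 0" and m: "-1 < m" "m < 1" and \<alpha>: "0 < \<alpha>" "\<alpha> \<le> 1"
    and R0: "0 < R0" "R0 \<le> 1" and \<mu>: "0 < \<mu>" and C: "0 \<le> C"
    and op: "open \<Omega>" and Cyl_sub: "\<And>x. x \<in> Cyl R0 \<Longrightarrow> 0 < x $ None \<Longrightarrow> x \<in> \<Omega>"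
    and Ca: "\<And>i j. C1 \<Omega> (\<lambda>x. a x $ i $ j)" and Cu: "C1 \<Omega> u" "\<And>j. C1 \<Omega> (pderivative j u)"
    and cont_u: "continuous_on (Cyl R0) u" and u_nonneg: "\<And>x. x \<in> Cyl R0 \<Longrightarrow> 0 \<le> u x"
    and u_pos: "\<And>x. x \<in> Cyl R0 \<Longrightarrow> 0 < x $ None \<Longrightarrow> 0 < u x"
    and b: "b $ None $ None = 1" "\<And>i. b $ None $ Some i = 0" "\<And>i. b $ Some i $ None = 0"
      "\<And>v. \<mu> * (norm v)\<^sup>2 \<le> v \<bullet> (b *v v)"
    and ab: "\<And>x i j. x \<in> Cyl R0 \<Longrightarrow> 0 < x $ None \<Longrightarrow>
      \<bar>a x $ i $ j - x $ None powr m * b $ i $ j\<bar> \<le> C * x $ None powr m * norm (x - x0) powr \<alpha>"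
    and super: "\<And>x. x \<in> Cyl R0 \<Longrightarrow> 0 < x $ None \<Longrightarrow>
      (\<Sum>i\<in>UNIV. pderivative i (\<lambda>x. \<Sum>j\<in>UNIV. a x $ i $ j * pderivative j u x) x) \<le> C * x $ None powr m * u x"
begin

section \<open>Exponents, constants and cylinders of the iteration\<close>

definition "ct = (\<Sum>i\<in>UNIV. b $ Some i $ Some i) / (1 + m)"
text \<open>The gain in the error per scale. The first bound gives
  \<open>\<beta> + 2 * \<beta>' \<le> \<alpha>\<close>, so that the coefficients converge fast
  enough to pay for the degeneracy; the second gives \<beta> < 1 + m, needed for the contraction by
  \<open>\<theta>\<close>.\<close>

definition "\<beta> = min (\<alpha> * (1 - m) / 4) ((1 + m) / 2)"
text \<open>The exponent for which r^(1-m) \<ge> R^(1-m+\<beta>) means r \<ge>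
  R^(1+\<beta>').\<close>

definition "\<beta>' = \<beta> / (1 - m)"
definition "N = real CARD('n option)"
text \<open>The first summand covers the perturbation of the coefficients, as 2 N (6 N C / \<mu>)^2
  is at most half its square; the second covers the zero order term, and the third makes
  \<open>H\<close> at most its square.\<close>

definition "H = 12 * N\<^sup>2 * C / \<mu> + 4 * C / \<mu> + 1"
text \<open>The summand 1 stands for the level k0 in \<open>barrier_step\<close>; the other is the
  constant of \<open>sup_bound_vec\<close> on a ball of radius 2 R, whence 96 instead of 48.\<close>

definition "E = 1 + 96 * N * 2 ^ CARD('n option) * H"

lemma \<beta>: "0 < \<beta>" "\<beta> < 1 + m" "0 < \<beta>'" "\<beta> + 2 * \<beta>' \<le> \<alpha>" "\<beta> \<le> 1"
proof -
  show b0: "0 < \<beta>" "\<beta> < 1 + m" using m \<alpha> by (auto simp: \<beta>_def min_def)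
  show "0 < \<beta>'" using b0 m by (simp add: \<beta>'_def)
  have "4 * \<beta> \<le> \<alpha> * (1 - m)" by (simp add: \<beta>_def min_def)
  then have 4: "4 * \<beta>' \<le> \<alpha>" using m by (simp add: \<beta>'_def pos_divide_le_eq mult.commute)
  have "\<beta> = \<beta>' * (1 - m)" using m by (simp add: \<beta>'_def)
  also have "\<dots> \<le> \<beta>' * 2" by (rule mult_left_mono) (use m \<open>0 < \<beta>'\<close> in auto)
  finally show "\<beta> + 2 * \<beta>' \<le> \<alpha>" using 4 by linarith
  then show "\<beta> \<le> 1" using \<open>0 < \<beta>'\<close> \<alpha> by linarith
qed

lemma ct: "0 \<le> ct"
proof -
  have "0 \<le> b $ Some i $ Some i" for i
  proof -
    have "\<mu> * (norm (axis (Some i) (1::real) :: real ^ 'n option))\<^sup>2 \<le> axis (Some i) 1 \<bullet> (b *v axis (Some i) 1)"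
      by (rule b(4))
    then show ?thesis using \<mu> by (simp add: inner_axis' matrix_vector_mult_basis column_def)
  qed
  then show ?thesis using m by (auto simp: ct_def intro!: divide_nonneg_nonneg sum_nonneg)
qed

lemma N1: "1 \<le> N"
proof -
  have "0 < CARD('n option)" by (rule zero_less_card_finite)
  then show ?thesis by (simp add: N_def)
qed

lemma H1: "1 \<le> H" using C \<mu> by (simp add: H_def)

lemma norm_x0: "(norm (x - x0))\<^sup>2 = (x $ None)\<^sup>2 + p2 x"
  unfolding norm_vec_squared sum_UNIV_option p2_def by (simp add: x0 power2_eq_square)

lemma Cyl_norm: assumes "x \<in> Cyl R" "0 \<le> R" shows "norm (x - x0) \<le> 2 * R"
proof (rule power2_le_imp_le)
  have "(x $ None)\<^sup>2 \<le> R\<^sup>2" using assms by (intro power_mono) (auto simp: Cyl_def)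
  moreover have "p2 x \<le> R\<^sup>2" using assms by (simp add: Cyl_def)
  ultimately show "(norm (x - x0))\<^sup>2 \<le> (2 * R)\<^sup>2"
    unfolding norm_x0 by (simp add: power_mult_distrib) (smt (verit) zero_le_power2)
qed (use assms in simp)

lemma p2_nonneg: "0 \<le> p2 x" unfolding p2_def by (intro sum_nonneg) auto

lemma Cyl_mono: "R \<le> R' \<Longrightarrow> 0 \<le> R \<Longrightarrow> Cyl R \<subseteq> Cyl R'"
  unfolding Cyl_def using power_mono[of R R' 2] by (auto intro: order_trans)

lemma Q_sub_Cyl: "Q R \<subseteq> Cyl R" by (auto simp: Q_def Cyl_def)

lemma Cw: "C1 S (\<lambda>x. x $ Some i - x0 $ Some i)"
  "pderivative k (\<lambda>x. x $ Some i - x0 $ Some i) x = (if k = Some i then 1 else 0)"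
  using C1_diff(1)[OF C1_nth C1_const, of S "Some i" "x0 $ Some i"]
    C1_diff(2)[OF C1_nth C1_const, of x UNIV k "Some i" "x0 $ Some i"]
  by (auto simp: pderivative_nth pderivative_const)

lemma Cp2: "C1 S p2" "pderivative None p2 x = 0" "pderivative (Some i) p2 x = 2 * (x $ Some i - x0 $ Some i)"
proof -
  have "C1 S (\<lambda>x. \<Sum>i\<in>UNIV. (x $ Some i - x0 $ Some i) * (x $ Some i - x0 $ Some i))"
    by (intro C1_sum_UNIV(1) C1_mult(1) Cw)
  then show "C1 S p2" unfolding p2_def[abs_def] .
  have d: "pderivative k p2 x = (\<Sum>j\<in>UNIV. 2 * (x $ Some j - x0 $ Some j) * (if k = Some j then 1 else 0))" for k
    unfolding p2_def[abs_def]
    by (subst C1_sum_UNIV(2)[where S = UNIV])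
       (auto intro!: C1_mult(1) Cw sum.cong simp: C1_mult(2)[OF Cw(1) Cw(1), where S = UNIV] Cw(2))
  show "pderivative None p2 x = 0" unfolding d by simp
  show "pderivative (Some i) p2 x = 2 * (x $ Some i - x0 $ Some i)" unfolding d
    by (simp add: if_distrib cong: if_cong)
qed

lemma cont_p2: "continuous_on S p2" using C1D(4)[OF Cp2(1)] .

lemma compact_Cyl: assumes "0 \<le> R" shows "compact (Cyl R)"
proof -
  have "closed (Cyl R)" unfolding Cyl_def
    by (intro closed_Collect_conj closed_Collect_le continuous_intros cont_p2)
  moreover have "bounded (Cyl R)"
    unfolding bounded_def using Cyl_norm[OF _ assms] by (metis dist_norm norm_minus_commute)
  ultimately show ?thesis using compact_eq_bounded_closed by blast
qed

lemma open_Q: "open (Q R)" unfolding Q_def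
  by (intro open_Collect_conj open_Collect_less continuous_intros cont_p2)


text \<open>The barrier is annihilated by \<open>div (r\<^sup>m b grad)\<close>, so that the perturbation enters only through
  the size of \<open>a - r\<^sup>m b\<close>. On the set where the barrier exceeds \<open>u / c\<close> by \<open>R powr (1 - m + \<beta>)\<close>,
  \<open>r\<close> is at least \<open>R powr (1 + \<beta>')\<close>, so the degeneracy of \<open>r\<^sup>m\<close> costs only a small power of
  \<open>R\<close> in \<open>sup_bound_vec\<close>.\<close>

lemma barrier_step:
  assumes R: "0 < R" "R \<le> R0" and small: "4 * N * C * R powr \<alpha> \<le> \<mu>" and c: "0 < c"
    and \<tau>: "0 \<le> \<tau>" "(ct + 1) * \<tau> \<le> 1 / 2"
    and hyp: "\<And>x. x \<in> Cyl R \<Longrightarrow> c * (x $ None powr (1 - m) - \<tau> * R powr (1 - m)) \<le> u x"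
    and x: "x \<in> Q R"
  shows "c * (x $ None powr (1 - m) * (1 - (ct + 1) * \<tau>) - \<tau> * R powr (-1 - m) * p2 x - E * R powr (1 - m + \<beta>)) \<le> u x"
proof -
  \<comment> \<open>Normalised so that T R^2 = \<tau> R^(1-m): on the lateral side, where p2 = R^2,
    the quadratic term provides exactly the deficit in \<open>hyp\<close>.\<close>
  define T where "T = \<tau> * R powr (-1 - m)"
  \<comment> \<open>One part \<open>ct * \<tau>\<close> pays for the positive term
    \<open>ct * T * r^2\<close> of the barrier; the other \<tau> yields the deficit in
    \<open>hyp\<close> on the top r = R.\<close>
  define A where "A = 1 - (ct + 1) * \<tau>"
  have R1: "R \<le> 1" using R R0 by simp
  have T0: "0 \<le> T" using \<tau> by (simp add: T_def)
  have A: "0 < A" "A \<le> 1" using \<tau> ct by (auto simp: A_def)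
  have ctt: "ct * \<tau> \<le> 1 / 2" "\<tau> \<le> 1 / 2"
    using \<tau> mult_nonneg_nonneg[OF ct \<tau>(1)] by (auto simp: distrib_right)
  \<comment> \<open>Comparing the barrier with u / c, instead of scaling the barrier by c, keeps c
    out of all bounds on gradients and fluxes.\<close>
  define ic where "ic = 1 / c"
  have ic: "0 < ic" using c by (simp add: ic_def)
  have icl: "s \<le> ic * v \<longleftrightarrow> c * s \<le> v" for s v
    using c by (simp add: ic_def pos_le_divide_eq mult.commute)
  have icr: "ic * v \<le> s \<longleftrightarrow> v \<le> c * s" for s v
    using c by (simp add: ic_def pos_divide_le_eq mult.commute)
  define S where "S x = A * x $ None powr (1 - m) - T * (p2 x - ct * (x $ None * x $ None))" for x
  define z where "z x = S x - ic * u x" for x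
  define k0 where "k0 = R powr (1 - m + \<beta>)"
  have k0: "0 < k0" using R by (simp add: k0_def)
  have CylR: "Cyl R \<subseteq> Cyl R0" using Cyl_mono R by simp
  have QC: "Q R \<subseteq> Cyl R" "Q R \<subseteq> Cyl R0" using Q_sub_Cyl CylR by blast+
  have Qp: "0 < x $ None" if "x \<in> Q R" for x using that by (simp add: Q_def)
  have Q\<Omega>: "Q R \<subseteq> \<Omega>" using Cyl_sub QC(2) Qp by blast
  have RT: "T * R\<^sup>2 = \<tau> * R powr (1 - m)"
  proof -
    have "R\<^sup>2 = R powr 2" using R by (simp add: powr_numeral)
    then have "T * R\<^sup>2 = \<tau> * (R powr (-1 - m) * R powr 2)" by (simp add: T_def)
    also have "R powr (-1 - m) * R powr 2 = R powr (1 - m)" by (simp add: powr_add[symmetric])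
    finally show ?thesis .
  qed
  have r2: "T * (x $ None * x $ None) \<le> \<tau> * x $ None powr (1 - m)" if "0 < x $ None" "x $ None \<le> R" for x :: "real ^ 'n option"
  proof -
    have "x $ None * x $ None = x $ None powr (1 - m) * x $ None powr (1 + m)"
      using that by (simp add: powr_add[symmetric] powr_numeral power2_eq_square)
    also have "\<dots> \<le> x $ None powr (1 - m) * R powr (1 + m)"
      by (intro mult_left_mono powr_mono2) (use that m in auto)
    finally have "T * (x $ None * x $ None) \<le> T * (x $ None powr (1 - m) * R powr (1 + m))"
      by (rule mult_left_mono[OF _ T0])
    also have "\<dots> = \<tau> * (R powr (-1 - m) * R powr (1 + m)) * x $ None powr (1 - m)" by (simp add: T_def)
    also have "R powr (-1 - m) * R powr (1 + m) = 1" using R by (simp add: powr_add[symmetric])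
    finally show ?thesis by simp
  qed
  have S_le: "S x \<le> x $ None powr (1 - m) * (1 - \<tau>) - T * p2 x" if "0 < x $ None" "x $ None \<le> R" for x
  proof -
    have "S x = A * x $ None powr (1 - m) + ct * (T * (x $ None * x $ None)) - T * p2 x"
      by (simp add: S_def algebra_simps)
    also have "\<dots> \<le> A * x $ None powr (1 - m) + ct * (\<tau> * x $ None powr (1 - m)) - T * p2 x"
      using mult_left_mono[OF r2[OF that] ct] by simp
    also have "\<dots> = x $ None powr (1 - m) * (1 - \<tau>) - T * p2 x" by (simp add: A_def algebra_simps)
    finally show ?thesis .
  qed
  have S_le': "S x \<le> x $ None powr (1 - m)" if "0 < x $ None" "x $ None \<le> R" for x
  proof -
    have "x $ None powr (1 - m) * (1 - \<tau>) \<le> x $ None powr (1 - m)" using \<tau> by (simp add: mult_left_le)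
    then show ?thesis using S_le[OF that] mult_nonneg_nonneg[OF T0 p2_nonneg[of x]] by linarith
  qed
  have cS: "continuous_on (Cyl R) S" unfolding S_def
    by (intro continuous_intros continuous_on_powr' cont_p2) (use m in \<open>auto simp: Cyl_def\<close>)
  have cz: "continuous_on (Cyl R) z" unfolding z_def
    by (intro continuous_intros cS continuous_on_subset[OF cont_u CylR])
  \<comment> \<open>On every part of the boundary of the cylinder z is at most 0: at the bottom
    because S is, on the top and the lateral side by \<open>hyp\<close>. The continuity of u up to r
    = 0 makes the set closed.\<close>
  have compK: "compact {x \<in> Q R. k0 \<le> z x}"
  proof -
    have cC: "compact (Cyl R)" by (rule compact_Cyl) (use R in simp)
    have "closed {x \<in> Cyl R. k0 \<le> z x}"
      by (intro continuous_on_closed_Collect_le cz compact_imp_closed[OF cC] continuous_intros)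
    moreover have "{x \<in> Cyl R. k0 \<le> z x} = {x \<in> Q R. k0 \<le> z x}"
    proof -
      have "x \<in> Q R" if x: "x \<in> Cyl R" "k0 \<le> z x" for x
      proof (rule ccontr)
        assume nQ: "x \<notin> Q R"
        have ux: "0 \<le> u x" using u_nonneg x(1) CylR by blast
        have r: "0 \<le> x $ None" "x $ None \<le> R" "p2 x \<le> R\<^sup>2" using x(1) by (auto simp: Cyl_def)
        have "z x \<le> 0"
        proof (cases "x $ None = 0")
          case True
          have "S x \<le> 0" using True m mult_nonneg_nonneg[OF T0 p2_nonneg[of x]] by (simp add: S_def)
          moreover have "0 \<le> ic * u x" using ux ic by simp
          ultimately show ?thesis unfolding z_def by linarith
        next
          case False
          then have r0: "0 < x $ None" using r by simp
          have "S x \<le> x $ None powr (1 - m) - \<tau> * R powr (1 - m)"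
          proof (cases "x $ None = R")
            case True
            then have "S x \<le> R powr (1 - m) * (1 - \<tau>)"
              using S_le[OF r0 r(2)] mult_nonneg_nonneg[OF T0 p2_nonneg[of x]] by simp
            then show ?thesis using True by (simp add: algebra_simps)
          next
            case False
            then have "p2 x = R\<^sup>2" using nQ r r0 by (auto simp: Q_def)
            then have "S x \<le> x $ None powr (1 - m) * (1 - \<tau>) - \<tau> * R powr (1 - m)"
              using S_le[OF r0 r(2)] RT by simp
            moreover have "x $ None powr (1 - m) * (1 - \<tau>) \<le> x $ None powr (1 - m)"
              using \<tau> by (simp add: mult_left_le)
            ultimately show ?thesis by linarith
          qed
          then have "c * S x \<le> c * (x $ None powr (1 - m) - \<tau> * R powr (1 - m))"
            using c by (intro mult_left_mono) auto
          then have "c * S x \<le> u x" using hyp[OF x(1)] by linarith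
          then show ?thesis using icl[of "S x" "u x"] by (simp add: z_def)
        qed
        then show False using x(2) k0 by linarith
      qed
      then show ?thesis using QC(1) by auto
    qed
    ultimately have "closed {x \<in> Q R. k0 \<le> z x}" by simp
    moreover have "Cyl R \<inter> {x \<in> Q R. k0 \<le> z x} = {x \<in> Q R. k0 \<le> z x}" using QC(1) by auto
    ultimately show ?thesis using compact_Int_closed[OF cC, of "{x \<in> Q R. k0 \<le> z x}"] by simp
  qed

  have Cr: "C1 (Q R) (\<lambda>x. x $ None powr q)"
    and dr: "\<And>x k. x \<in> Q R \<Longrightarrow> pderivative k (\<lambda>x. x $ None powr q) x = (if k = None then q * x $ None powr (q - 1) else 0)" for q
    using C1_powr[where f = "\<lambda>x. x $ None" and S = "Q R" and a = q, OF C1_nth Qp] by (auto simp: pderivative_nth)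
  have Crr: "C1 (Q R) (\<lambda>x. x $ None * x $ None)"
    and drr: "\<And>x k. x \<in> Q R \<Longrightarrow> pderivative k (\<lambda>x. x $ None * x $ None) x = (if k = None then 2 * x $ None else 0)"
    using C1_mult[where f = "\<lambda>x. x $ None" and g = "\<lambda>x. x $ None" and S = "Q R", OF C1_nth C1_nth] by (auto simp: pderivative_nth)
  note CuQ = C1_subset[OF Cu(1) Q\<Omega>] and CduQ = C1_subset[OF Cu(2) Q\<Omega>] and CaQ = C1_subset[OF Ca Q\<Omega>]
  have CS: "C1 (Q R) S" unfolding S_def[abs_def]
    by (intro C1_diff(1) C1_cmult(1) Cr Cp2(1) Crr)
  define s where "s k x = (if k = None then A * (1 - m) * x $ None powr (- m) + 2 * ct * T * x $ None
      else - 2 * T * (x $ k - x0 $ k))" for k and x :: "real ^ 'n option"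
  have dS: "pderivative k S x = s k x" if x: "x \<in> Q R" for k x
  proof -
    have "pderivative k S x = A * pderivative k (\<lambda>x. x $ None powr (1 - m)) x
      - T * (pderivative k p2 x - ct * pderivative k (\<lambda>x. x $ None * x $ None) x)"
      unfolding S_def[abs_def]
      using C1_diff(2)[OF C1_cmult(1)[OF Cr] C1_cmult(1)[OF C1_diff(1)[OF Cp2(1) C1_cmult(1)[OF Crr]]] x]
        C1_cmult(2)[OF Cr x] C1_cmult(2)[OF C1_diff(1)[OF Cp2(1) C1_cmult(1)[OF Crr]] x]
        C1_diff(2)[OF Cp2(1) C1_cmult(1)[OF Crr] x] C1_cmult(2)[OF Crr x] by simp
    then show ?thesis by (cases k) (simp_all add: dr[OF x] drr[OF x] Cp2 s_def algebra_simps)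
  qed
  have Cz: "C1 (Q R) z" unfolding z_def[abs_def] by (intro C1_diff(1) C1_cmult(1) CS CuQ)
  have dz: "pderivative k z x = s k x - ic * pderivative k u x" if x: "x \<in> Q R" for k x
    unfolding z_def[abs_def] using C1_diff(2)[OF CS C1_cmult(1)[OF CuQ] x] C1_cmult(2)[OF CuQ x] dS[OF x] by simp
  define W where "W k x = (\<Sum>j\<in>UNIV. a x $ k $ j * pderivative j u x)" for k x
  have CW: "C1 (Q R) (W k)" for k unfolding W_def by (intro C1_sum_UNIV(1) C1_mult(1) CaQ CduQ)
  \<comment> \<open>The flux r^m b grad S with the powers of r multiplied out: in the normal
    component r^m cancels the singular factor r^(-m) of the derivative of r^(1-m).\<close>
  define Y where "Y k x = (case k of None \<Rightarrow> A * (1 - m) + 2 * ct * T * x $ None powr (1 + m)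
     | Some i \<Rightarrow> (- 2 * T) * (x $ None powr m * (\<Sum>j\<in>UNIV. b $ Some i $ Some j * (x $ Some j - x0 $ Some j))))" for k x
  have CY: "C1 (Q R) (Y k)" for k
  proof (cases k)
    case None
    show ?thesis unfolding Y_def None option.case by (intro C1_add(1) C1_const C1_cmult(1) Cr)
  next
    case (Some i)
    show ?thesis unfolding Y_def Some option.case
      by (intro C1_cmult(1) C1_mult(1) Cr C1_sum_UNIV(1) Cw)
  qed
  have Yb: "Y k x = x $ None powr m * (\<Sum>j\<in>UNIV. b $ k $ j * s j x)" if x: "x \<in> Q R" for k x
  proof (cases k)
    case None
    have "x $ None powr m * x $ None powr (- m) = 1" using Qp[OF x] by (simp add: powr_add[symmetric])
    moreover have "x $ None powr m * x $ None = x $ None powr (1 + m)"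
      using Qp[OF x] by (simp add: powr_add)
    ultimately show ?thesis
      by (simp add: None Y_def s_def sum_UNIV_option b distrib_left mult.left_commute)
  next
    case (Some i)
    then show ?thesis
      by (simp add: Y_def s_def sum_UNIV_option b sum_distrib_left algebra_simps)
  qed
  \<comment> \<open>The value of \<open>ct\<close> comes from here: r^2 contributes 2 (1 + m) r^m to
    the divergence, and p2 contributes 2 r^m times the trace of the tangential block of b.\<close>
  have divY: "(\<Sum>k\<in>UNIV. pderivative k (Y k) x) = 0" if x: "x \<in> Q R" for x
  proof -
    have "pderivative None (Y None) x = 2 * ct * T * ((1 + m) * x $ None powr m)"
      unfolding Y_def using C1_add(2)[OF C1_const C1_cmult(1)[OF Cr] x] C1_cmult(2)[OF Cr x]
      by (simp add: pderivative_const dr[OF x])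
    moreover have "pderivative (Some i) (Y (Some i)) x = (- 2 * T) * (x $ None powr m * b $ Some i $ Some i)" for i
    proof -
      let ?L = "\<lambda>x. \<Sum>j\<in>UNIV. b $ Some i $ Some j * (x $ Some j - x0 $ Some j)"
      have CL: "C1 (Q R) ?L" by (intro C1_sum_UNIV(1) C1_cmult(1) Cw)
      have "pderivative (Some i) ?L x = (\<Sum>j\<in>UNIV. pderivative (Some i) (\<lambda>x. b $ Some i $ Some j * (x $ Some j - x0 $ Some j)) x)"
        by (rule C1_sum_UNIV(2)[OF C1_cmult(1)[OF Cw(1)] x])
      also have "\<dots> = (\<Sum>j\<in>UNIV. if i = j then b $ Some i $ Some j else 0)"
        by (rule sum.cong) (auto simp: C1_cmult(2)[OF Cw(1) x] Cw(2))
      finally have dL: "pderivative (Some i) ?L x = b $ Some i $ Some i" by simp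
      have "pderivative (Some i) (\<lambda>x. (- 2 * T) * (x $ None powr m * ?L x)) x
        = (- 2 * T) * (x $ None powr m * pderivative (Some i) ?L x + pderivative (Some i) (\<lambda>x. x $ None powr m) x * ?L x)"
        by (simp only: C1_cmult(2)[OF C1_mult(1)[OF Cr CL] x] C1_mult(2)[OF Cr CL x])
      then show ?thesis unfolding Y_def option.case dL dr[OF x] by simp
    qed
    ultimately have "(\<Sum>k\<in>UNIV. pderivative k (Y k) x)
        = 2 * T * x $ None powr m * (ct * (1 + m) - (\<Sum>i\<in>UNIV. b $ Some i $ Some i))"
      by (simp add: sum_UNIV_option sum_negf sum_distrib_left algebra_simps)
    also have "ct * (1 + m) = (\<Sum>i\<in>UNIV. b $ Some i $ Some i)" using m by (simp add: ct_def)
    finally show ?thesis by simp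
  qed

  \<comment> \<open>In this proof \<open>\<rho>\<close> and \<open>\<kappa>\<close> are numbers:
    \<open>\<rho>\<close> is a lower bound for r^m where z exceeds k0, and \<open>\<kappa>\<close>
    is chosen so that the coefficient \<mu> / 4 from
    \<open>perturbed_quadratic_form_lower_bound\<close> becomes at least 1 / 2.\<close>
  define \<rho> where "\<rho> = R powr (m + \<beta>')"
  have \<rho>: "0 < \<rho>" using R by (simp add: \<rho>_def)
  define \<kappa> where "\<kappa> = 2 / (\<mu> * \<rho>)"
  have \<kappa>: "0 < \<kappa>" using \<rho> \<mu> by (simp add: \<kappa>_def)
  define V where "V k x = \<kappa> * (Y k x - ic * W k x)" for k x
  have CV: "C1 (Q R) (V k)" for k unfolding V_def by (intro C1_cmult(1) C1_diff(1) CY CW)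
  \<comment> \<open>The exponent adds \<alpha> from the coefficients, -m - \<beta>' from the
    gradient of the barrier, and -\<beta>' from the square root of the oscillation of r^m.\<close>
  define G where "G = H * R powr (\<alpha> - m - 2 * \<beta>')"
  have G: "0 < G" using H1 R by (simp add: G_def)
  define f where "f = 2 * C / \<mu> * R powr (1 - m - 2 * \<beta>')"
  have f: "0 \<le> f" using C \<mu> by (simp add: f_def)

  \<comment> \<open>Where z exceeds k0, S is at least R^(1-m+\<beta>), while S is at most r^(1-m).
    This keeps r away from 0, and with t = r / R all the weights are controlled.\<close>
  have level: "x \<in> Q R \<Longrightarrow> k0 < z x \<Longrightarrow> \<rho> \<le> x $ None powr m \<and> x $ None powr m \<le> R powr (m - \<beta>') \<and>
      x $ None powr (- m) \<le> R powr (- m - \<beta>') \<and> u x \<le> c * R powr (1 - m)" for x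
  proof -
    assume x: "x \<in> Q R" and zx: "k0 < z x"
    have r: "0 < x $ None" "x $ None \<le> R" using x by (auto simp: Q_def)
    have u0: "0 \<le> u x" using u_nonneg QC x by blast
    have uS: "u x \<le> c * S x" using zx k0 icr[of "u x" "S x"] by (simp add: z_def)
    have Sk: "k0 \<le> S x" 
    proof -
      have "0 \<le> ic * u x" using u0 ic by simp
      then show ?thesis using zx unfolding z_def by linarith
    qed
    have "k0 \<le> x $ None powr (1 - m)" using Sk S_le'[OF r] by linarith
    then have "k0 powr (1 / (1 - m)) \<le> (x $ None powr (1 - m)) powr (1 / (1 - m))"
      by (rule powr_mono2[rotated 2]) (use m k0 in auto)
    then have "R powr (1 + \<beta>') \<le> x $ None"
      using m R r by (simp add: k0_def powr_powr \<beta>'_def add_divide_distrib)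
    then have t: "R powr \<beta>' \<le> x $ None / R" using R by (simp add: powr_add pos_le_divide_eq mult.commute)
    let ?t = "x $ None / R"
    have t0: "0 < ?t" "?t \<le> 1" using r R by auto
    have it: "1 / ?t \<le> R powr (- \<beta>')"
      using t R t0 by (simp add: powr_minus_divide frac_le del: divide_divide_eq_right)
    have rt: "x $ None powr q = R powr q * ?t powr q" for q
      using r R by (simp add: powr_mult[symmetric])
    have "\<rho> = R powr m * R powr \<beta>'" by (simp add: \<rho>_def powr_add)
    also have "\<dots> \<le> R powr m * ?t powr m"
      using powr_between(1)[OF t0, of m] t m by (intro mult_left_mono) auto
    finally have 1: "\<rho> \<le> x $ None powr m" using rt by simp
    have 2: "x $ None powr m \<le> R powr (m - \<beta>')"
    proof -
      have "R powr m * ?t powr m \<le> R powr m * R powr (- \<beta>')"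
        using powr_between(2)[OF t0, of m] it m by (intro mult_left_mono) auto
      then show ?thesis using rt[of m] by (simp add: powr_add[symmetric])
    qed
    have 3: "x $ None powr (- m) \<le> R powr (- m - \<beta>')"
    proof -
      have "R powr (- m) * ?t powr (- m) \<le> R powr (- m) * R powr (- \<beta>')"
        using powr_between(2)[OF t0, of "- m"] it m by (intro mult_left_mono) auto
      then show ?thesis using rt[of "- m"] by (simp add: powr_add[symmetric])
    qed
    have "S x \<le> R powr (1 - m)"
      using S_le'[OF r] powr_mono2[of "1 - m" "x $ None" R] r m by simp
    then have "u x \<le> c * R powr (1 - m)" using uS c mult_left_mono[of "S x" "R powr (1 - m)" c] by linarith
    then show "\<rho> \<le> x $ None powr m \<and> x $ None powr m \<le> R powr (m - \<beta>') \<and>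
      x $ None powr (- m) \<le> R powr (- m - \<beta>') \<and> u x \<le> c * R powr (1 - m)" using 1 2 3 by blast
  qed

  have divV: "- f \<le> (\<Sum>k\<in>UNIV. pderivative k (V k) x)" if x: "x \<in> Q R" "k0 < z x" for x
  proof -
    have "(\<Sum>k\<in>UNIV. pderivative k (V k) x) = (\<Sum>k\<in>UNIV. \<kappa> * (pderivative k (Y k) x - ic * pderivative k (W k) x))"
      unfolding V_def using C1_cmult(2)[OF C1_diff(1)[OF CY C1_cmult(1)[OF CW]] x(1)]
        C1_diff(2)[OF CY C1_cmult(1)[OF CW] x(1)] C1_cmult(2)[OF CW x(1)] by simp
    also have "\<dots> = \<kappa> * ((\<Sum>k\<in>UNIV. pderivative k (Y k) x) - ic * (\<Sum>k\<in>UNIV. pderivative k (W k) x))"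
      by (simp only: sum_distrib_left[symmetric] sum_subtractf)
    also have "\<dots> = - (\<kappa> * (ic * (\<Sum>k\<in>UNIV. pderivative k (W k) x)))"
      using divY[OF x(1)] by simp
    finally have eq: "(\<Sum>k\<in>UNIV. pderivative k (V k) x) = - (\<kappa> * (ic * (\<Sum>k\<in>UNIV. pderivative k (W k) x)))" .
    have "(\<Sum>k\<in>UNIV. pderivative k (W k) x) \<le> C * x $ None powr m * u x"
      unfolding W_def using super[of x] QC(2) x(1) Qp by blast
    also have "\<dots> \<le> (C * R powr (m - \<beta>')) * (c * R powr (1 - m))"
      using level[OF x] C u_nonneg[of x] QC(2) x(1) by (intro mult_mono mult_left_mono) auto
    finally have "ic * (\<Sum>k\<in>UNIV. pderivative k (W k) x) \<le> ic * ((C * R powr (m - \<beta>')) * (c * R powr (1 - m)))"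
      using ic by (intro mult_left_mono) auto
    also have "\<dots> = C * (R powr (m - \<beta>') * R powr (1 - m))" using c by (simp add: ic_def)
    also have "\<dots> = C * R powr (1 - \<beta>')" by (simp add: powr_add[symmetric])
    finally have "\<kappa> * (ic * (\<Sum>k\<in>UNIV. pderivative k (W k) x)) \<le> \<kappa> * (C * R powr (1 - \<beta>'))"
      using \<kappa> by (intro mult_left_mono) auto
    also have "\<dots> = f"
    proof -
      have "R powr (1 - \<beta>') = R powr (1 - m - 2 * \<beta>') * \<rho>" by (simp add: \<rho>_def powr_add[symmetric])
      then show ?thesis using \<rho> \<mu> by (simp add: \<kappa>_def f_def)
    qed
    finally show ?thesis unfolding eq by simp
  qed

  have ellV: "(\<Sum>k\<in>UNIV. (pderivative k z x)\<^sup>2) / 2 - G\<^sup>2 / 2 \<le> (\<Sum>k\<in>UNIV. V k x * pderivative k z x)"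
    if x: "x \<in> Q R" "k0 < z x" for x
  proof -
    let ?rm = "x $ None powr m"
    have r: "0 < x $ None" "x $ None \<le> R" using x by (auto simp: Q_def)
    note lv = level[OF x]
    define \<eta> where "\<eta> = 2 * C * R powr \<alpha>"
    define \<sigma> where "\<sigma> = 3 * R powr (- m - \<beta>')"
    define p where "p = (\<chi> k. pderivative k z x)"
    define sv where "sv = (\<chi> k. s k x)"
    define e where "e = (\<chi> i j. a x $ i $ j - ?rm * b $ i $ j)"
    have Rm: "R powr (- m) \<le> R powr (- m - \<beta>')" by (rule powr_mono') (use R R1 \<beta>(3) in auto)
    have e: "\<bar>e $ i $ j\<bar> \<le> ?rm * \<eta>" for i j
    proof -
      have "norm (x - x0) powr \<alpha> \<le> (2 * R) powr \<alpha>"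
        using Cyl_norm[of x R] QC(1) x(1) R \<alpha> by (intro powr_mono2) auto
      also have "\<dots> \<le> 2 * R powr \<alpha>"
      proof -
        have "2 powr \<alpha> \<le> 2 powr 1" using \<alpha> by (intro powr_mono) auto
        then show ?thesis using R by (simp add: powr_mult)
      qed
      finally have "C * ?rm * norm (x - x0) powr \<alpha> \<le> C * ?rm * (2 * R powr \<alpha>)"
        using C by (intro mult_left_mono) auto
      have xC: "x \<in> Cyl R0" using QC(2) x(1) by blast
      have "\<bar>e $ i $ j\<bar> \<le> C * ?rm * (2 * R powr \<alpha>)"
        using ab[OF xC r(1), of i j] \<open>C * ?rm * norm (x - x0) powr \<alpha> \<le> _\<close> by (simp add: e_def)
      then show ?thesis by (simp add: \<eta>_def mult_ac)
    qed
    have s: "\<bar>sv $ k\<bar> \<le> \<sigma>" for k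
    proof (cases k)
      case None
      have "0 \<le> A * (1 - m) * x $ None powr (- m)" using A m by simp
      moreover have "A * (1 - m) * x $ None powr (- m) \<le> 2 * R powr (- m - \<beta>')"
      proof -
        have "A * (1 - m) \<le> 1 * 2" using A m by (intro mult_mono) auto
        then show ?thesis using lv A m by (intro mult_mono) auto
      qed
      moreover have "0 \<le> 2 * ct * T * x $ None" using ct T0 r by simp
      moreover have "2 * ct * T * x $ None \<le> R powr (- m)"
      proof -
        have "2 * ct * T * x $ None \<le> 2 * ct * T * R" using ct T0 r by (intro mult_left_mono) auto
        also have "\<dots> = 2 * (ct * \<tau>) * (R powr (-1 - m) * R)" by (simp add: T_def)
        also have "R powr (-1 - m) * R = R powr (- m)" using R powr_add[of R "-1 - m" 1] by simp
        also have "2 * (ct * \<tau>) * R powr (- m) \<le> 1 * R powr (- m)" using ctt by (intro mult_right_mono) auto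
        finally show ?thesis by simp
      qed
      ultimately show ?thesis using Rm by (simp add: None sv_def s_def \<sigma>_def)
    next
      case (Some i)
      have "(x $ Some i - x0 $ Some i) * (x $ Some i - x0 $ Some i) \<le> p2 x"
        unfolding p2_def by (rule member_le_sum) auto
      then have "(x $ Some i - x0 $ Some i)\<^sup>2 \<le> R\<^sup>2" using x(1) by (simp add: Q_def power2_eq_square)
      then have "\<bar>x $ Some i - x0 $ Some i\<bar> \<le> R" using R by (simp add: abs_le_square_iff[symmetric])
      then have "2 * T * \<bar>x $ Some i - x0 $ Some i\<bar> \<le> 2 * T * R" using T0 by (intro mult_left_mono) auto
      also have "\<dots> = 2 * \<tau> * (R powr (-1 - m) * R)" by (simp add: T_def)
      also have "R powr (-1 - m) * R = R powr (- m)" using R powr_add[of R "-1 - m" 1] by simp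
      also have "2 * \<tau> * R powr (- m) \<le> 1 * R powr (- m)" using ctt by (intro mult_right_mono) auto
      finally have "\<bar>sv $ k\<bar> \<le> R powr (- m)" using T0 by (simp add: Some sv_def s_def abs_mult)
      then show ?thesis using Rm by (simp add: \<sigma>_def)
    qed
    have \<eta>: "0 \<le> \<eta>" "2 * N * \<eta> \<le> \<mu>" using small C by (simp_all add: \<eta>_def mult_ac)
    have Nes: "N * \<eta> * \<sigma> = 6 * N * C * R powr (\<alpha> - m - \<beta>')"
    proof -
      have "R powr \<alpha> * R powr (- m - \<beta>') = R powr (\<alpha> - m - \<beta>')"
        using powr_add[of R \<alpha> "- m - \<beta>'"] by (simp add: algebra_simps)
      then show ?thesis by (simp add: \<eta>_def \<sigma>_def)
    qed
    let ?P = "\<Sum>k\<in>UNIV. (p $ k)\<^sup>2"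
    have P0: "0 \<le> ?P" by (simp add: sum_nonneg)
    have "?rm * (\<mu> / 4 * ?P - N * (N * \<eta> * \<sigma>)\<^sup>2 / \<mu>)
      \<le> (\<Sum>i\<in>UNIV. (\<Sum>j\<in>UNIV. (?rm * b $ i $ j + e $ i $ j) * p $ j - e $ i $ j * sv $ j) * p $ i)"
      unfolding N_def
      by (rule perturbed_quadratic_form_lower_bound[OF b(4) \<mu> _ e s \<eta>(1) \<eta>(2)[unfolded N_def]]) simp
    \<comment> \<open>Algebraically, a grad z - (a - r^m b) grad S = r^m b grad S - a grad u / c.
      The flux is thus elliptic in grad z, up to a term in which the perturbation meets only the
      explicit barrier.\<close>
    also have "\<dots> = (\<Sum>i\<in>UNIV. (Y i x - ic * W i x) * p $ i)"
    proof (rule sum.cong[OF refl])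
      fix i
      have "(?rm * b $ i $ j + e $ i $ j) * p $ j - e $ i $ j * sv $ j
          = ?rm * (b $ i $ j * s j x) - ic * (a x $ i $ j * pderivative j u x)" for j
        by (simp add: e_def p_def sv_def dz[OF x(1)] algebra_simps)
      then have "(\<Sum>j\<in>UNIV. (?rm * b $ i $ j + e $ i $ j) * p $ j - e $ i $ j * sv $ j) = Y i x - ic * W i x"
        unfolding Yb[OF x(1)] W_def by (simp only: sum_subtractf sum_distrib_left[symmetric])
      then show "(\<Sum>j\<in>UNIV. (?rm * b $ i $ j + e $ i $ j) * p $ j - e $ i $ j * sv $ j) * p $ i = (Y i x - ic * W i x) * p $ i"
        by simp
    qed
    finally have "\<kappa> * (?rm * (\<mu> / 4 * ?P - N * (N * \<eta> * \<sigma>)\<^sup>2 / \<mu>)) \<le> \<kappa> * (\<Sum>i\<in>UNIV. (Y i x - ic * W i x) * p $ i)"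
      using \<kappa> by (intro mult_left_mono) auto
    also have "\<dots> = (\<Sum>k\<in>UNIV. V k x * pderivative k z x)"
      by (simp add: V_def p_def sum_distrib_left mult.assoc)
    finally have low: "\<kappa> * (?rm * (\<mu> / 4 * ?P - N * (N * \<eta> * \<sigma>)\<^sup>2 / \<mu>)) \<le> (\<Sum>k\<in>UNIV. V k x * pderivative k z x)" .
    \<comment> \<open>The oscillation of the weight on the set in question, between 1 and R^(-2
      \<beta>').\<close>
    define t where "t = ?rm / \<rho>"
    have t1: "1 \<le> t" using lv \<rho> by (simp add: t_def)
    have t2: "t \<le> R powr (- 2 * \<beta>')"
    proof -
      have "?rm \<le> R powr (- 2 * \<beta>') * \<rho>" using lv by (simp add: \<rho>_def powr_add[symmetric])
      then show ?thesis using \<rho> by (simp add: t_def pos_divide_le_eq)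
    qed
    have "\<kappa> * (?rm * (\<mu> / 4 * ?P - N * (N * \<eta> * \<sigma>)\<^sup>2 / \<mu>)) = t * (?P / 2) - t * (2 * N * (N * \<eta> * \<sigma>)\<^sup>2 / \<mu>\<^sup>2)"
      using \<rho> \<mu> by (simp add: \<kappa>_def t_def field_simps power2_eq_square)
    moreover have "?P / 2 \<le> t * (?P / 2)" using mult_right_mono[OF t1, of "?P / 2"] P0 by simp
    moreover have "t * (2 * N * (N * \<eta> * \<sigma>)\<^sup>2 / \<mu>\<^sup>2) \<le> G\<^sup>2 / 2"
    proof -
      have "t * (2 * N * (N * \<eta> * \<sigma>)\<^sup>2 / \<mu>\<^sup>2) \<le> R powr (- 2 * \<beta>') * (2 * N * (N * \<eta> * \<sigma>)\<^sup>2 / \<mu>\<^sup>2)"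
        using t2 N1 \<mu> by (intro mult_right_mono) auto
      also have "R powr (- 2 * \<beta>') * (2 * N * (N * \<eta> * \<sigma>)\<^sup>2 / \<mu>\<^sup>2)
        = N * (72 * (N * C / \<mu>)\<^sup>2) * (R powr (- \<beta>') * R powr (\<alpha> - m - \<beta>'))\<^sup>2"
      proof -
        have "R powr (- 2 * \<beta>') = (R powr (- \<beta>'))\<^sup>2" using R by (simp add: powr_power)
        then show ?thesis unfolding Nes by (simp add: power_mult_distrib power_divide)
      qed
      also have "R powr (- \<beta>') * R powr (\<alpha> - m - \<beta>') = R powr (\<alpha> - m - 2 * \<beta>')"
        using powr_add[of R "- \<beta>'" "\<alpha> - m - \<beta>'"] by (simp add: algebra_simps)
      also have "N * (72 * (N * C / \<mu>)\<^sup>2) * (R powr (\<alpha> - m - 2 * \<beta>'))\<^sup>2 \<le> (H\<^sup>2 / 2) * (R powr (\<alpha> - m - 2 * \<beta>'))\<^sup>2"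
      proof (rule mult_right_mono)
        have "N * (72 * (N * C / \<mu>)\<^sup>2) \<le> N\<^sup>2 * (72 * (N * C / \<mu>)\<^sup>2)"
          using N1 by (intro mult_right_mono) (auto simp: power2_eq_square)
        also have "\<dots> = (12 * N\<^sup>2 * C / \<mu>)\<^sup>2 / 2" by (simp add: power2_eq_square)
        also have "\<dots> \<le> H\<^sup>2 / 2"
          using C \<mu> N1 by (intro divide_right_mono power_mono) (auto simp: H_def)
        finally show "N * (72 * (N * C / \<mu>)\<^sup>2) \<le> H\<^sup>2 / 2" .
      qed simp
      finally show ?thesis by (simp add: G_def power_mult_distrib)
    qed
    ultimately have "?P / 2 - G\<^sup>2 / 2 \<le> (\<Sum>k\<in>UNIV. V k x * pderivative k z x)" using low by linarith
    then show ?thesis by (simp add: p_def)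
  qed

  have fM: "f * R powr (1 - m) \<le> G\<^sup>2 / 2"
  proof -
    have "f * R powr (1 - m) = 2 * C / \<mu> * R powr (2 - 2 * m - 2 * \<beta>')"
      using powr_add[of R "1 - m - 2 * \<beta>'" "1 - m"] by (simp add: f_def algebra_simps)
    also have "\<dots> \<le> 2 * C / \<mu> * R powr (2 * (\<alpha> - m - 2 * \<beta>'))"
      using C \<mu> R R1 \<alpha> \<beta>(3) by (intro mult_left_mono powr_mono') auto
    also have "\<dots> \<le> (H\<^sup>2 / 2) * R powr (2 * (\<alpha> - m - 2 * \<beta>'))"
    proof (rule mult_right_mono)
      have "4 * C / \<mu> \<le> H" using C \<mu> N1 by (simp add: H_def)
      also have "H \<le> H\<^sup>2" using H1 by (simp add: power2_eq_square mult_le_cancel_left1)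
      finally show "2 * C / \<mu> \<le> H\<^sup>2 / 2" by simp
    qed simp
    also have "R powr (2 * (\<alpha> - m - 2 * \<beta>')) = (R powr (\<alpha> - m - 2 * \<beta>'))\<^sup>2"
      using R by (simp add: powr_power)
    finally show ?thesis by (simp add: G_def power_mult_distrib)
  qed

  have "z x \<le> k0 + 48 * CARD('n option) * 2 ^ CARD('n option) * G * (2 * R)"
  proof (rule sup_bound_vec[where a = x0 and V = V and f = f and M = "R powr (1 - m)" and Q = "Q R"])
    show "Q R \<subseteq> cball x0 (2 * R)"
      using Cyl_norm QC(1) R by (auto simp: dist_norm norm_minus_commute)
    show "z x - k0 \<le> R powr (1 - m)" if "x \<in> Q R" for x
    proof -
      have r: "0 < x $ None" "x $ None \<le> R" using that by (auto simp: Q_def)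
      have "S x \<le> R powr (1 - m)"
        using S_le'[OF r] powr_mono2[of "1 - m" "x $ None" R] r m by simp
      moreover have "0 \<le> ic * u x" using u_nonneg QC(2) that ic by (intro mult_nonneg_nonneg) auto
      ultimately show ?thesis using k0 by (simp add: z_def)
    qed
  qed (use open_Q Cz CV compK divV ellV f fM G R x in auto)
  \<comment> \<open>G times the radius has the exponent 1 + \<alpha> - m - 2 \<beta>', which is at
    least 1 - m + \<beta> by the choice of \<beta>.\<close>
  also have "\<dots> \<le> E * R powr (1 - m + \<beta>)"
  proof -
    have "48 * CARD('n option) * 2 ^ CARD('n option) * G * (2 * R) = (E - 1) * (R powr (\<alpha> - m - 2 * \<beta>') * R)"
      by (simp add: G_def E_def N_def)
    also have "R powr (\<alpha> - m - 2 * \<beta>') * R = R powr (1 + \<alpha> - m - 2 * \<beta>')"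
      using R powr_add[of R "\<alpha> - m - 2 * \<beta>'" 1] by (simp add: algebra_simps)
    also have "(E - 1) * R powr (1 + \<alpha> - m - 2 * \<beta>') \<le> (E - 1) * R powr (1 - m + \<beta>)"
      using R R1 \<beta>(4) N1 H1 by (intro mult_left_mono powr_mono') (auto simp: E_def)
    finally show ?thesis by (simp add: k0_def algebra_simps)
  qed
  finally have "S x - ic * u x \<le> E * R powr (1 - m + \<beta>)" by (simp add: z_def)
  moreover have "x $ None powr (1 - m) * (1 - (ct + 1) * \<tau>) - \<tau> * R powr (-1 - m) * p2 x \<le> S x"
    using mult_nonneg_nonneg[OF mult_nonneg_nonneg[OF T0 ct], of "x $ None * x $ None"]
    by (simp add: S_def A_def T_def[symmetric] algebra_simps)
  ultimately have "x $ None powr (1 - m) * (1 - (ct + 1) * \<tau>) - \<tau> * R powr (-1 - m) * p2 x - E * R powr (1 - m + \<beta>) \<le> ic * u x"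
    by linarith
  then show ?thesis using icl by simp
qed


section \<open>The contraction over shrinking cylinders\<close>

lemma small_radius:
  assumes "0 < \<gamma>" "0 < y"
  shows "\<forall>\<^sub>F R in at_right (0::real). X * R powr \<gamma> < y"
proof -
  have "((\<lambda>R. X * R powr \<gamma>) \<longlongrightarrow> X * 0) (at_right 0)"
    by (intro tendsto_intros tendsto_zero_powrI[where b = \<gamma>])
       (use assms in \<open>auto simp: eventually_at_right_less intro: eventually_at_rightI[of 0 1]\<close>)
  then show ?thesis using assms by (auto dest: order_tendstoD(2))
qed

definition "\<theta> = (1 / 4) powr (1 / (1 + m - \<beta>))"
text \<open>Makes the error E R^(1-m+\<beta>) of \<open>barrier_step\<close> a quarter of the
  admissible error K (\<theta> R)^(1-m+\<beta>) at the next radius.\<close>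

definition "K = 4 * E / \<theta> powr (1 - m + \<beta>)"
text \<open>The decrease of 1 + D R^\<beta> from R to \<theta> R is 4 (ct + 1) K R^\<beta>, enough
  to pay for the factor 1 - (ct + 1) \<tau> of the barrier with \<tau> = K R^\<beta>.\<close>

definition "D = 4 * (ct + 1) * K / (1 - \<theta> powr \<beta>)"

lemma \<theta>: "0 < \<theta>" "\<theta> < 1" "\<theta> powr (1 + m - \<beta>) = 1 / 4"
proof -
  show "0 < \<theta>" by (simp add: \<theta>_def)
  show "\<theta> powr (1 + m - \<beta>) = 1 / 4" using \<beta>(2) by (simp add: \<theta>_def powr_powr)
  have "(1 / 4 :: real) powr (1 / (1 + m - \<beta>)) < 1 powr (1 / (1 + m - \<beta>))"
    using \<beta>(2) by (intro powr_less_mono2) auto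
  then show "\<theta> < 1" by (simp add: \<theta>_def)
qed

lemma K0: "0 < K"
proof -
  have "0 \<le> 96 * N * 2 ^ CARD('n option) * H" using H1 N1 by (intro mult_nonneg_nonneg) auto
  then have "0 < E" unfolding E_def by linarith
  then show ?thesis using \<theta> by (simp add: K_def)
qed

lemma \<theta>\<beta>: "\<theta> powr \<beta> < 1"
  using powr_less_mono2[of \<beta> \<theta> 1] \<theta> \<beta> by simp

lemma D0: "0 < D" using K0 ct \<theta>\<beta> by (simp add: D_def)

text \<open>The factor 1 + D R^\<beta> is a reserve spent during the iteration. It replaces an
  infinite product of losses, so that the same c serves at every scale.\<close>

definition "lower R c \<longleftrightarrow>
  (\<forall>x\<in>Cyl R. c * (1 + D * R powr \<beta>) * (x $ None powr (1 - m) - K * R powr \<beta> * R powr (1 - m)) \<le> u x)"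

text \<open>Use \<open>barrier_step\<close> with \<tau> = K R^\<beta>. The quadratic term and the De
  Giorgi error together take half of the admissible error at radius \<theta> R; the other half
  covers the change from the old constant in front to the new one, which is at least half as
  large.\<close>

lemma lower_step:
  assumes R: "0 < R" "R \<le> R0" and small: "4 * N * C * R powr \<alpha> \<le> \<mu>"
    and small': "(ct + 1) * K * R powr \<beta> \<le> 1 / 2" "D * R powr \<beta> \<le> 1"
    and c: "0 < c" and lower: "lower R c"
  shows "lower (\<theta> * R) c"
  unfolding lower_def
proof
  fix x assume x: "x \<in> Cyl (\<theta> * R)"
  let ?r = "x $ None powr (1 - m)"
  define d where "d = R powr \<beta>"
  have d0: "0 < d" using R by (simp add: d_def)
  have Rd: "(\<theta> * R) powr \<beta> = \<theta> powr \<beta> * d" using R \<theta> by (simp add: d_def powr_mult)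
  define c'' where "c'' = c * (1 + D * (\<theta> * R) powr \<beta>)"
  define c' where "c' = c * (1 + D * R powr \<beta>)"
  have c': "0 < c'" using c D0 d0 unfolding c'_def d_def by (intro mult_pos_pos add_pos_pos) auto
  have c''0: "0 < c''" using c D0 unfolding c''_def by (intro mult_pos_pos add_pos_nonneg) auto
  have tR: "\<theta> * R < R" using \<theta> R by simp
  have xC: "x \<in> Cyl R" "x \<in> Cyl R0"
    using Cyl_mono[of "\<theta> * R" R] Cyl_mono[of R R0] x tR R \<theta> by (auto simp: less_imp_le)
  show "c * (1 + D * (\<theta> * R) powr \<beta>) * (?r - K * (\<theta> * R) powr \<beta> * (\<theta> * R) powr (1 - m)) \<le> u x"
  proof (cases "x $ None = 0")
    case True
    have "c'' * (0 - K * (\<theta> * R) powr \<beta> * (\<theta> * R) powr (1 - m)) \<le> 0"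
      using c''0 K0 by (simp add: mult_le_0_iff)
    then show ?thesis using True m u_nonneg[OF xC(2)] by (simp add: c''_def)
  next
    case False
    have xQ: "x \<in> Q R"
    proof -
      have "p2 x \<le> (\<theta> * R)\<^sup>2" using x by (simp add: Cyl_def)
      also have "\<dots> < R\<^sup>2" by (rule power_strict_mono) (use tR \<theta> R in auto)
      finally show ?thesis using x False tR by (auto simp: Q_def Cyl_def)
    qed
    define q where "q = \<theta> powr (1 - m + \<beta>)"
    have q0: "0 < q" using \<theta> by (simp add: q_def)
    define X where "X = R powr (1 - m + \<beta>)"
    have X0: "0 < X" using R by (simp add: X_def)
    have qX: "(\<theta> * R) powr \<beta> * (\<theta> * R) powr (1 - m) = q * X"
      using R \<theta> by (simp add: powr_add[symmetric] q_def X_def powr_mult[symmetric] add.commute)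
    have "c' * (?r * (1 - (ct + 1) * (K * d)) - (K * d) * R powr (-1 - m) * p2 x - E * X) \<le> u x"
      unfolding X_def
    proof (rule barrier_step[OF R small c' _ _ _ xQ])
      show "0 \<le> K * d" using K0 d0 by simp
      show "(ct + 1) * (K * d) \<le> 1 / 2" using small'(1) by (simp add: d_def mult.assoc)
      show "c' * (x $ None powr (1 - m) - K * d * R powr (1 - m)) \<le> u x" if "x \<in> Cyl R" for x
        using lower that unfolding lower_def c'_def d_def by blast
    qed
    moreover have "(K * d) * R powr (-1 - m) * p2 x + E * X \<le> K * q * X / 2"
    proof -
      have "p2 x \<le> (\<theta> * R)\<^sup>2" using x by (simp add: Cyl_def)
      then have "(K * d) * R powr (-1 - m) * p2 x \<le> (K * d) * R powr (-1 - m) * (\<theta> * R)\<^sup>2"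
        using K0 d0 by (intro mult_left_mono) auto
      also have "\<dots> = K * \<theta>\<^sup>2 * (d * (R powr (-1 - m) * R\<^sup>2))" by (simp add: power_mult_distrib)
      also have "R\<^sup>2 = R powr 2" using R by (simp add: powr_numeral)
      also have "d * (R powr (-1 - m) * R powr 2) = X"
        by (simp add: d_def X_def powr_add[symmetric] algebra_simps)
      also have "\<theta>\<^sup>2 = q / 4"
      proof -
        have "\<theta>\<^sup>2 = \<theta> powr 2" using \<theta> by (simp add: powr_numeral)
        also have "\<dots> = \<theta> powr (1 + m - \<beta>) * q" by (simp add: q_def powr_add[symmetric])
        finally show ?thesis using \<theta>(3) by simp
      qed
      finally have "(K * d) * R powr (-1 - m) * p2 x \<le> K * q * X / 4" by simp
      moreover have "E * X = K * q * X / 4" using q0 by (simp add: K_def q_def)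
      ultimately show ?thesis by linarith
    qed
    then have "c' * ((K * d) * R powr (-1 - m) * p2 x + E * X) \<le> c' * (K * q * X / 2)"
      using c' by (intro mult_left_mono) auto
    moreover have "c' * (K * q * X / 2) \<le> c'' * (K * q * X)"
    proof -
      have "c' \<le> 2 * c''"
      proof -
        have "0 \<le> D * (\<theta> powr \<beta> * d)" using D0 d0 by simp
        then have "1 + D * d \<le> 2 * (1 + D * (\<theta> powr \<beta> * d))"
          using small'(2) unfolding d_def[symmetric] by (simp only: distrib_left)
        then have "c * (1 + D * d) \<le> c * (2 * (1 + D * (\<theta> powr \<beta> * d)))" using c by (intro mult_left_mono) auto
        then show ?thesis unfolding c'_def c''_def Rd d_def[symmetric] by (simp only: mult.left_commute)
      qed
      then have "c' * (K * q * X / 2) \<le> (2 * c'') * (K * q * X / 2)"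
        using K0 q0 X0 by (intro mult_right_mono) auto
      then show ?thesis by simp
    qed
    moreover have "c'' * ?r \<le> c' * (?r * (1 - (ct + 1) * (K * d)))"
    proof -
      \<comment> \<open>As D d is at most 1, the last factor costs at most 2 (ct + 1) K d, whereas
        the two reserves differ by 4 (ct + 1) K d.\<close>
      have "1 + D * (\<theta> powr \<beta> * d) \<le> (1 + D * d) * (1 - (ct + 1) * (K * d))"
      proof -
        have e: "D * d - D * (\<theta> powr \<beta> * d) = 4 * ((ct + 1) * (K * d))"
        proof -
          have "D * (1 - \<theta> powr \<beta>) = 4 * (ct + 1) * K" using \<theta>\<beta> by (simp add: D_def)
          then have "D * (1 - \<theta> powr \<beta>) * d = 4 * (ct + 1) * K * d" by simp
          then show ?thesis by (simp add: algebra_simps)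
        qed
        have "(D * d) * ((ct + 1) * (K * d)) \<le> 1 * ((ct + 1) * (K * d))"
          using small'(2) ct K0 d0 by (intro mult_right_mono) (auto simp: d_def)
        moreover have "0 \<le> (ct + 1) * (K * d)" using ct K0 d0 by simp
        moreover have "(1 + D * d) * (1 - (ct + 1) * (K * d)) = 1 + D * d - (ct + 1) * (K * d) - (D * d) * ((ct + 1) * (K * d))"
          by (simp only: distrib_right right_diff_distrib mult_1_left mult_1_right)
        ultimately show ?thesis using e by linarith
      qed
      then have "c * (1 + D * (\<theta> powr \<beta> * d)) * ?r \<le> c * ((1 + D * d) * (1 - (ct + 1) * (K * d))) * ?r"
        using c by (intro mult_right_mono mult_left_mono) auto
      then show ?thesis unfolding c'_def c''_def Rd d_def[symmetric] by (simp add: mult_ac)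
    qed
    ultimately have "c'' * ?r - c'' * (K * q * X) \<le> u x"
      by (simp add: right_diff_distrib distrib_left)
    moreover have "c'' * (?r - K * (\<theta> * R) powr \<beta> * (\<theta> * R) powr (1 - m)) = c'' * ?r - c'' * (K * q * X)"
      using qX by (simp add: right_diff_distrib mult.assoc)
    ultimately show ?thesis unfolding c''_def by linarith
  qed
qed

text \<open>On the compact set where the left side is nonnegative, r stays away from 0, so u has a
  positive minimum there; elsewhere u \<ge> 0 is enough. The constant may depend on R in any way,
  since this is used for the first radius only.\<close>

lemma lower_start:
  assumes R: "0 < R" "R \<le> R0" and small: "D * R powr \<beta> \<le> 1"
  obtains c where "0 < c" "lower R c"
proof -
  let ?L = "\<lambda>x. x $ None powr (1 - m) - K * R powr \<beta> * R powr (1 - m)"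
  define S where "S = {x \<in> Cyl R. 0 \<le> ?L x}"
  have CylR: "Cyl R \<subseteq> Cyl R0" using Cyl_mono R by simp
  have k: "0 < K * R powr \<beta> * R powr (1 - m)" using K0 R by simp
  have cC: "compact (Cyl R)" by (rule compact_Cyl) (use R in simp)
  have cL: "continuous_on (Cyl R) ?L"
    by (intro continuous_intros continuous_on_powr') (use m in \<open>auto simp: Cyl_def\<close>)
  have "closed S" unfolding S_def
    by (intro continuous_on_closed_Collect_le cL compact_imp_closed[OF cC] continuous_intros)
  then have cS: "compact S" using compact_Int_closed[OF cC, of S] by (simp add: S_def Int_absorb1 Collect_conj_eq)
  have pos: "0 < x $ None" if "x \<in> S" for x
  proof (rule ccontr)
    assume "\<not> 0 < x $ None"
    then have "x $ None = 0" using that by (auto simp: S_def Cyl_def)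
    then show False using that k m by (simp add: S_def)
  qed
  obtain l where l: "0 < l" "\<And>x. x \<in> S \<Longrightarrow> l \<le> u x"
  proof (cases "S = {}")
    case True
    then show ?thesis using that[of 1] by simp
  next
    case False
    have "continuous_on S u" by (rule continuous_on_subset[OF cont_u]) (use CylR in \<open>auto simp: S_def\<close>)
    from continuous_attains_inf[OF cS False this] obtain y where y: "y \<in> S" "\<And>x. x \<in> S \<Longrightarrow> u y \<le> u x" by blast
    have "0 < u y" using u_pos[of y] pos[OF y(1)] y(1) CylR by (auto simp: S_def)
    then show ?thesis using that[of "u y"] y(2) by blast
  qed
  define c where "c = l / (2 * R powr (1 - m))"
  have c: "0 < c" using l R by (simp add: c_def)
  have "lower R c" unfolding lower_def
  proof
    fix x assume x: "x \<in> Cyl R"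
    have D1: "0 \<le> 1 + D * R powr \<beta>" "1 + D * R powr \<beta> \<le> 2" using D0 small by auto
    show "c * (1 + D * R powr \<beta>) * ?L x \<le> u x"
    proof (cases "x \<in> S")
      case True
      have "?L x \<le> R powr (1 - m)"
        using k powr_mono2[of "1 - m" "x $ None" R] m x by (auto simp: Cyl_def)
      then have "c * (1 + D * R powr \<beta>) * ?L x \<le> c * 2 * R powr (1 - m)"
        using D1 c True by (intro mult_mono mult_left_mono) (auto simp: S_def)
      also have "\<dots> = l" using R by (simp add: c_def)
      finally show ?thesis using l(2)[OF True] by simp
    next
      case False
      then have "?L x \<le> 0" using x by (simp add: S_def)
      then have "c * (1 + D * R powr \<beta>) * ?L x \<le> 0" using c D1 by (intro mult_nonneg_nonpos) auto
      then show ?thesis using u_nonneg[of x] x CylR by (meson order_trans subsetD)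
    qed
  qed
  then show thesis using that c by blast
qed

text \<open>At the axis point of height R the deficit K R^\<beta> is at most 1 / 2, so
  \<open>lower R c\<close> leaves half of c R^(1-m). The iteration supplies this for R = R1
  \<theta>^k.\<close>

theorem axis_lower_bound:
  obtains c q R1 where "0 < c" "0 < q" "q < 1" "0 < R1" "R1 \<le> R0"
    "\<And>k. c * (R1 * q ^ k) powr (1 - m) \<le> u (x0 + (R1 * q ^ k) *\<^sub>R axis None 1)"
proof -
  have "\<forall>\<^sub>F R in at_right (0::real). 0 < R \<and> R < R0 \<and> 4 * N * C * R powr \<alpha> < \<mu> \<and> (ct + 1) * K * R powr \<beta> < 1 / 2 \<and> D * R powr \<beta> < 1"
    using eventually_at_right_less[of "0::real"] small_radius[OF \<alpha>(1) \<mu>, of "4 * N * C"]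
      small_radius[OF \<beta>(1), of "1/2" "(ct + 1) * K"] small_radius[OF \<beta>(1), of 1 D]
      eventually_at_rightI[of 0 R0 "\<lambda>R. R < R0"] R0
    by (auto intro!: eventually_conj)
  then obtain R1 where R1: "0 < R1" "R1 < R0" "4 * N * C * R1 powr \<alpha> < \<mu>" "(ct + 1) * K * R1 powr \<beta> < 1 / 2" "D * R1 powr \<beta> < 1"
    using eventually_happens'[OF trivial_limit_at_right_real] by blast
  obtain c where c: "0 < c" "lower R1 c" using lower_start[of R1] R1 by auto
  have small: "4 * N * C * R powr \<alpha> \<le> \<mu>" "(ct + 1) * K * R powr \<beta> \<le> 1 / 2" "D * R powr \<beta> \<le> 1"
    if "0 < R" "R \<le> R1" for R
  proof -
    have a: "R powr \<alpha> \<le> R1 powr \<alpha>" and b: "R powr \<beta> \<le> R1 powr \<beta>"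
      using that \<alpha> \<beta> by (auto intro!: powr_mono2)
    show "4 * N * C * R powr \<alpha> \<le> \<mu>"
    proof -
      have "4 * N * C * R powr \<alpha> \<le> 4 * N * C * R1 powr \<alpha>" by (rule mult_left_mono[OF a]) (use N1 C in simp)
      then show ?thesis using R1(3) by linarith
    qed
    show "(ct + 1) * K * R powr \<beta> \<le> 1 / 2"
    proof -
      have "(ct + 1) * K * R powr \<beta> \<le> (ct + 1) * K * R1 powr \<beta>" by (rule mult_left_mono[OF b]) (use ct K0 in simp)
      then show ?thesis using R1(4) by linarith
    qed
    show "D * R powr \<beta> \<le> 1" 
    proof -
      have "D * R powr \<beta> \<le> D * R1 powr \<beta>" by (rule mult_left_mono[OF b]) (use D0 in simp)
      then show ?thesis using R1(5) by linarith
    qed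
  qed
  have Rk: "0 < R1 * \<theta> ^ k" "R1 * \<theta> ^ k \<le> R1" for k
    using R1(1) \<theta> by (auto simp: mult_le_cancel_left2 power_le_one)
  have low: "lower (R1 * \<theta> ^ k) c" for k
  proof (induction k)
    case 0 then show ?case using c by simp
  next
    case (Suc k)
    have "lower (\<theta> * (R1 * \<theta> ^ k)) c"
      by (rule lower_step[OF Rk(1) _ _ _ _ c(1) Suc]) 
         (use small[OF Rk] order_trans[OF Rk(2) less_imp_le[OF R1(2)]] in auto)
    then show ?case by (simp add: mult_ac)
  qed
  have "c / 2 * R powr (1 - m) \<le> u (x0 + R *\<^sub>R axis None 1)" if R: "0 < R" "R \<le> R1" "lower R c" for R
  proof -
    let ?x = "x0 + R *\<^sub>R axis None 1"
    have xN: "?x $ None = R" using x0 by simp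
    have "p2 ?x = 0" unfolding p2_def by (simp add: axis_def)
    then have "?x \<in> Cyl R" using R xN by (simp add: Cyl_def)
    then have "c * (1 + D * R powr \<beta>) * (R powr (1 - m) - K * R powr \<beta> * R powr (1 - m)) \<le> u ?x"
      using R(3) xN unfolding lower_def by metis
    moreover have "c * 1 * (1 / 2 * R powr (1 - m)) \<le> c * (1 + D * R powr \<beta>) * (R powr (1 - m) - K * R powr \<beta> * R powr (1 - m))"
    proof (intro mult_mono mult_left_mono)
      have "K * R powr \<beta> \<le> 1 / 2"
      proof -
        have "1 * (K * R powr \<beta>) \<le> (ct + 1) * (K * R powr \<beta>)" by (rule mult_right_mono) (use ct K0 in auto)
        then show ?thesis using small(2)[OF R(1,2)] by (simp only: mult.assoc mult_1_left)
      qed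
      then have "K * R powr \<beta> * R powr (1 - m) \<le> 1 / 2 * R powr (1 - m)" by (rule mult_right_mono) simp
      then show "1 / 2 * R powr (1 - m) \<le> R powr (1 - m) - K * R powr \<beta> * R powr (1 - m)" by simp
    qed (use c D0 in auto)
    ultimately show ?thesis by simp
  qed
  then show thesis using that[of "c / 2" \<theta> R1] c \<theta> R1 Rk low by auto
qed

end

section \<open>Smooth maps, matrices and rates of convergence\<close>

lemma Ck_on_subset: "Ck_on k S f \<Longrightarrow> T \<subseteq> S \<Longrightarrow> Ck_on k T f"
  by (induction k arbitrary: f) (auto intro: continuous_on_subset)

lemma C1_local:
  assumes "\<And>x. x \<in> S \<Longrightarrow> \<exists>W. open W \<and> x \<in> W \<and> C1 W f"
  shows "C1 S f"
proof (rule C1I[where Df = "grad f"])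
  show "(f has_derivative (\<lambda>h. grad f x \<bullet> h)) (at x)" if "x \<in> S" for x
  proof -
    obtain W where W: "x \<in> W" "C1 W f" using assms[OF \<open>x \<in> S\<close>] by blast
    show ?thesis by (rule C1D(1)[OF W(2,1)])
  qed
  show "continuous_on S (grad f)"
  proof (rule continuous_at_imp_continuous_on, rule ballI)
    fix x assume "x \<in> S"
    then obtain W where W: "open W" "x \<in> W" "C1 W f" using assms by blast
    show "isCont (grad f) x"
      using C1D(2)[OF W(3)] W(1,2) by (simp add: continuous_on_eq_continuous_at)
  qed
qed

lemma Ck_on_1_imp_C1:
  fixes F :: "real ^ 'k::finite \<Rightarrow> 'b::real_normed_vector" and L :: "'b \<Rightarrow> real"
  assumes F: "Ck_on (Suc 0) W F" and L: "bounded_linear L"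
  shows "C1 W (\<lambda>x. L (F x))"
proof (rule C1I[where Df = "\<lambda>x. \<chi> i. L (frechet_derivative F (at x) (axis i 1))"])
  fix x assume x: "x \<in> W"
  have d: "(F has_derivative frechet_derivative F (at x)) (at x)"
    using F x by (auto simp: frechet_derivative_works[symmetric])
  have l: "linear (\<lambda>h. L (frechet_derivative F (at x) h))"
    using has_derivative_linear[OF bounded_linear.has_derivative[OF L d]] .
  have "L (frechet_derivative F (at x) h) = (\<chi> i. L (frechet_derivative F (at x) (axis i 1))) \<bullet> h" for h
  proof -
    have "h = (\<Sum>i\<in>UNIV. h $ i *\<^sub>R axis i 1)"
      by (simp add: vec_eq_iff axis_def if_distrib cong: if_cong)
    then have "L (frechet_derivative F (at x) h) = (\<Sum>i\<in>UNIV. h $ i * L (frechet_derivative F (at x) (axis i 1)))"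
      using linear_sum[OF l, of "\<lambda>i. h $ i *\<^sub>R axis i 1" UNIV] linear_cmul[OF l] by simp
    then show ?thesis by (simp add: inner_vec_def mult.commute)
  qed
  then have "(\<lambda>h. L (frechet_derivative F (at x) h)) = (\<lambda>h. (\<chi> i. L (frechet_derivative F (at x) (axis i 1))) \<bullet> h)"
    by (rule ext)
  then show "((\<lambda>x. L (F x)) has_derivative (\<lambda>h. (\<chi> i. L (frechet_derivative F (at x) (axis i 1))) \<bullet> h)) (at x)"
    using bounded_linear.has_derivative[OF L d] by simp
next
  have "continuous_on W (\<lambda>x. frechet_derivative F (at x) (axis i 1))" for i
    using F axis_in_Basis_iff[of i "1::real"] by simp
  then show "continuous_on W (\<lambda>x. \<chi> i. L (frechet_derivative F (at x) (axis i 1)))"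
    by (intro continuous_intros bounded_linear.continuous_on[OF L])
qed

lemma smooth_on_imp_C1:
  fixes f :: "real ^ 'k::finite \<Rightarrow> 'b::real_normed_vector" and L :: "'b \<Rightarrow> real"
  assumes S: "open S" and f: "smooth_on S f" and L: "bounded_linear L"
  shows "C1 S (\<lambda>x. L (f x))"
proof (rule C1_local)
  fix x assume "x \<in> S"
  then obtain W F where "open W" "x \<in> W" "\<forall>k. Ck_on k W F" "\<forall>y\<in>W \<inter> S. F y = f y"
    using bspec[OF f[unfolded smooth_on_def]] by blast
  then have W: "open W" "x \<in> W" "\<And>k. Ck_on k W F" "\<And>y. y \<in> W \<inter> S \<Longrightarrow> F y = f y" by auto
  have "C1 (W \<inter> S) (\<lambda>x. L (F x))"
    by (rule Ck_on_1_imp_C1[OF Ck_on_subset[OF W(3)] L]) auto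
  then have "C1 (W \<inter> S) (\<lambda>x. L (f x))"
    by (rule C1_cong) (use W S in auto)
  then show "\<exists>W. open W \<and> x \<in> W \<and> C1 W (\<lambda>x. L (f x))"
    using W S \<open>x \<in> S\<close> by blast
qed

lemma smooth_on_imp_C1_pderivative:
  fixes f :: "real ^ 'k::finite \<Rightarrow> real"
  assumes S: "open S" and f: "smooth_on S f"
  shows "C1 S f" "C1 S (pderivative j f)"
proof -
  show C: "C1 S f" using smooth_on_imp_C1[OF S f bounded_linear_ident] .
  show "C1 S (pderivative j f)"
  proof (rule C1_local)
    fix x assume "x \<in> S"
    then obtain W F where "open W" "x \<in> W" "\<forall>k. Ck_on k W F" "\<forall>y\<in>W \<inter> S. F y = f y"
      using bspec[OF f[unfolded smooth_on_def]] by blast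
    then have W: "open W" "x \<in> W" "\<And>k. Ck_on k W F" "\<And>y. y \<in> W \<inter> S \<Longrightarrow> F y = f y" by auto
    have "Ck_on (Suc 0) W (\<lambda>x. frechet_derivative F (at x) (axis j 1))"
      using W(3)[of "Suc (Suc 0)"] axis_in_Basis_iff[of j "1::real"] by simp
    then have "C1 W (\<lambda>x. frechet_derivative F (at x) (axis j 1))"
      by (rule Ck_on_1_imp_C1[OF _ bounded_linear_ident])
    then have "C1 (W \<inter> S) (pderivative j F)"
      unfolding pderivative_def[abs_def] by (rule C1_subset) auto
    moreover have "C1 (W \<inter> S) f" using C C1_subset by blast
    ultimately have "C1 (W \<inter> S) (pderivative j f)"
    proof (rule_tac C1_cong)
      fix y assume y: "y \<in> W \<inter> S"
      show "pderivative j F y = pderivative j f y"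
        using pderivative_cong[OF open_Int[OF W(1) S] y _ \<open>C1 (W \<inter> S) f\<close>, of F j] W(4) by simp
    qed (use W S in auto)
    then show "\<exists>W. open W \<and> x \<in> W \<and> C1 W (pderivative j f)" using W S \<open>x \<in> S\<close> by blast
  qed
qed

section \<open>Inverses and determinants of positive definite matrices\<close>

lemma matrix_inv_unique:
  fixes A B :: "real ^ 'k::finite ^ 'k"
  assumes "A ** B = mat 1"
  shows "matrix_inv A = B"
proof -
  have BA: "B ** A = mat 1" using assms by (simp add: matrix_left_right_inverse)
  have "A ** matrix_inv A = mat 1 \<and> matrix_inv A ** A = mat 1"
    unfolding matrix_inv_def by (rule someI[of _ B]) (use assms BA in simp)
  then have "matrix_inv A = matrix_inv A ** (A ** B)" using assms by simp
  also have "\<dots> = B" using \<open>A ** matrix_inv A = mat 1 \<and> _\<close> by (simp add: matrix_mul_assoc)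
  finally show ?thesis .
qed

lemma matrix_inv_mult:
  fixes A :: "real ^ 'k::finite ^ 'k"
  assumes "det A \<noteq> 0"
  shows "A ** matrix_inv A = mat 1" "matrix_inv A ** A = mat 1"
proof -
  obtain B where B: "A ** B = mat 1" using assms invertible_det_nz[of A] unfolding invertible_def by blast
  show "A ** matrix_inv A = mat 1" using B matrix_inv_unique[OF B] by simp
  then show "matrix_inv A ** A = mat 1" by (simp add: matrix_left_right_inverse)
qed

text \<open>Cramer's rule. It writes the entries of the inverse as quotients of determinants, so
  that differentiability and rates of convergence pass to the inverse.\<close>

lemma matrix_inv_nth:
  fixes A :: "real ^ 'k::finite ^ 'k"
  assumes "det A \<noteq> 0"
  shows "matrix_inv A $ i $ j = det (\<chi> k l. if l = i then axis j 1 $ k else A $ k $ l) / det A"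
proof -
  have "A *v (matrix_inv A *v axis j 1) = axis j 1"
    using matrix_inv_mult[OF assms] by (simp add: matrix_vector_mul_assoc)
  then have "matrix_inv A *v axis j 1 = (\<chi> k. det (\<chi> i l. if l = k then axis j 1 $ i else A $ i $ l) / det A)"
    using cramer[OF assms] by blast
  moreover have "matrix_inv A $ i $ j = (matrix_inv A *v axis j 1) $ i"
    by (simp add: matrix_vector_mult_basis column_def)
  ultimately show ?thesis by simp
qed

lemma posdef_det_nonzero:
  fixes A :: "real ^ 'k::finite ^ 'k"
  assumes "\<And>v. v \<noteq> 0 \<Longrightarrow> 0 < v \<bullet> (A *v v)"
  shows "det A \<noteq> 0"
proof
  assume "det A = 0"
  then have "\<not> invertible A" by (simp add: invertible_det_nz)
  then have "\<not> (\<exists>B. B ** A = mat 1)" using invertible_left_inverse[of A] by blast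
  then obtain v where "A *v v = 0" "v \<noteq> 0" using matrix_left_invertible_ker[of A] by auto
  then show False using assms[of v] by simp
qed

text \<open>The determinant does not vanish on the segment from \<open>mat 1\<close> to \<open>A\<close>.\<close>

lemma posdef_det_pos:
  fixes A :: "real ^ 'k::finite ^ 'k"
  assumes A: "\<And>v. v \<noteq> 0 \<Longrightarrow> 0 < v \<bullet> (A *v v)"
  shows "0 < det A"
proof (rule ccontr)
  assume "\<not> 0 < det A"
  define P where "P t = (\<chi> i j. (1 - t) * mat 1 $ i $ j + t * A $ i $ j :: real ^ 'k ^ 'k)" for t :: real
  have c: "continuous_on {0..1} (\<lambda>t. det (P t))"
    unfolding det_def P_def by (intro continuous_intros)
  have P01: "P 0 = mat 1" "P 1 = A" by (simp_all add: P_def vec_eq_iff)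
  have "\<exists>t. 0 \<le> t \<and> t \<le> 1 \<and> det (P t) = 0"
    by (rule IVT2') (use c P01 \<open>\<not> 0 < det A\<close> in auto)
  then obtain t where t: "0 \<le> t" "t \<le> 1" "det (P t) = 0" by blast
  have "0 < v \<bullet> (P t *v v)" if "v \<noteq> 0" for v
  proof -
    have "P t *v v = (1 - t) *\<^sub>R v + t *\<^sub>R (A *v v)"
    proof -
      have "P t = (1 - t) *\<^sub>R mat 1 + t *\<^sub>R A" by (simp add: P_def vec_eq_iff)
      then show ?thesis by (simp add: matrix_vector_mult_add_rdistrib scaleR_matrix_vector_assoc[symmetric])
    qed
    then have "v \<bullet> (P t *v v) = (1 - t) * (v \<bullet> v) + t * (v \<bullet> (A *v v))"
      by (simp add: inner_add_right)
    moreover have "0 < v \<bullet> v" using that by simp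
    then have "0 < (1 - t) * (v \<bullet> v) + t * (v \<bullet> (A *v v))"
    proof (cases "t = 0")
      case False
      then have "0 < t * (v \<bullet> (A *v v))" using t A[OF that] by simp
      moreover have "0 \<le> (1 - t) * (v \<bullet> v)" using t by simp
      ultimately show ?thesis by linarith
    qed simp
    ultimately show ?thesis by simp
  qed
  then show False using posdef_det_nonzero[of "P t"] t(3) by blast
qed

text \<open>With w the image of v under the inverse, the form of the inverse at v is the form of A
  at w.\<close>

lemma posdef_inverse:
  fixes A :: "real ^ 'k::finite ^ 'k"
  assumes A: "\<And>v. v \<noteq> 0 \<Longrightarrow> 0 < v \<bullet> (A *v v)" and v: "v \<noteq> 0"
  shows "0 < v \<bullet> (matrix_inv A *v v)"
proof -
  define w where "w = matrix_inv A *v v"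
  have Aw: "A *v w = v"
    using matrix_inv_mult(1)[OF posdef_det_nonzero[OF A]] by (simp add: w_def matrix_vector_mul_assoc)
  then have "w \<noteq> 0" using v by auto
  then show ?thesis using A[of w] Aw by (simp add: inner_commute w_def)
qed

lemma C1_det:
  assumes "\<And>i j. C1 S (\<lambda>x. M x $ i $ j)"
  shows "C1 S (\<lambda>x. det (M x :: real ^ 'k::finite ^ 'k))"
  unfolding det_def
  by (rule C1_sum[THEN conjunct1]) (auto intro!: C1_cmult(1) C1_prod assms)

lemma C1_divide:
  assumes "C1 S f" "C1 S g" "\<And>x. x \<in> S \<Longrightarrow> g x \<noteq> 0"
  shows "C1 S (\<lambda>x. f x / g x)"
proof -
  have "C1 S (\<lambda>x. inverse (g x))"
    by (rule C1_compose(1)[OF assms(2), of inverse "\<lambda>t. - (inverse t ^ Suc (Suc 0))"])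
       (use assms(3) in \<open>auto intro!: DERIV_inverse[unfolded power_Suc power_0 mult_1_right] continuous_intros C1D(4)[OF assms(2)]\<close>)
  then show ?thesis using C1_mult(1)[OF assms(1)] by (simp add: divide_inverse)
qed

lemma C1_matrix_inv:
  assumes "\<And>i j. C1 S (\<lambda>x. M x $ i $ j)" "open S" "\<And>x. x \<in> S \<Longrightarrow> det (M x) \<noteq> 0"
  shows "C1 S (\<lambda>x. matrix_inv (M x :: real ^ 'k::finite ^ 'k) $ i $ j)"
proof (rule C1_cong[OF _ assms(2)])
  show "C1 S (\<lambda>x. det (\<chi> k l. if l = i then axis j 1 $ k else M x $ k $ l) / det (M x))"
  proof (intro C1_divide C1_det assms)
    show "C1 S (\<lambda>x. (\<chi> k l. if l = i then axis j 1 $ k else M x $ k $ l) $ k $ l)" for k l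
      by (cases "l = i") (auto intro: C1_const assms)
  qed
qed (use matrix_inv_nth[OF assms(3)] in simp)

lemma C1_sqrt:
  assumes "C1 S f" "\<And>x. x \<in> S \<Longrightarrow> 0 < f x"
  shows "C1 S (\<lambda>x. sqrt (f x))"
  using C1_compose(1)[OF assms(1), of sqrt "\<lambda>t. inverse (sqrt t) / 2"] assms(2) C1D(4)[OF assms(1)]
  by (force intro!: continuous_intros DERIV_real_sqrt simp: less_imp_neq)

text \<open>Convergence of f to c at the speed d. The calculus below carries the expansions of
  \<rho> and g, about whose derivatives nothing is known, through products, determinants, inverses
  and powers.\<close>

definition rate :: "('a \<Rightarrow> real) \<Rightarrow> 'a filter \<Rightarrow> ('a \<Rightarrow> real) \<Rightarrow> real \<Rightarrow> bool" where
  "rate d F f c \<longleftrightarrow> (\<exists>K. \<forall>\<^sub>F x in F. \<bar>f x - c\<bar> \<le> K * d x)"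

lemma rateE:
  assumes "rate d F f c" "\<And>x. 0 \<le> d x"
  obtains K where "0 \<le> K" "\<forall>\<^sub>F x in F. \<bar>f x - c\<bar> \<le> K * d x"
proof -
  obtain K where K: "\<forall>\<^sub>F x in F. \<bar>f x - c\<bar> \<le> K * d x" using assms(1) unfolding rate_def by blast
  have "\<forall>\<^sub>F x in F. \<bar>f x - c\<bar> \<le> \<bar>K\<bar> * d x"
    using K
  proof eventually_elim
    case (elim x)
    then show ?case using mult_right_mono[OF abs_ge_self assms(2), of K x] by linarith
  qed
  then show thesis using that[of "\<bar>K\<bar>"] by simp
qed

lemma rate_const: "(\<And>x. 0 \<le> d x) \<Longrightarrow> rate d F (\<lambda>_. c) c"
  unfolding rate_def by (rule exI[of _ 0]) simp

lemma rate_cong: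
  assumes "rate d F f c" "\<forall>\<^sub>F x in F. f x = g x"
  shows "rate d F g c"
proof -
  obtain K where "\<forall>\<^sub>F x in F. \<bar>f x - c\<bar> \<le> K * d x" using assms(1) unfolding rate_def by blast
  with assms(2) have "\<forall>\<^sub>F x in F. \<bar>g x - c\<bar> \<le> K * d x" by eventually_elim simp
  then show ?thesis unfolding rate_def by blast
qed

lemma rate_tendsto:
  assumes "rate d F f c" "(d \<longlongrightarrow> 0) F"
  shows "(f \<longlongrightarrow> c) F"
proof -
  obtain K where K: "\<forall>\<^sub>F x in F. \<bar>f x - c\<bar> \<le> K * d x" using assms(1) unfolding rate_def by blast
  have "((\<lambda>x. K * d x) \<longlongrightarrow> 0) F" using tendsto_mult_left[OF assms(2), of K] by simp
  then have "((\<lambda>x. f x - c) \<longlongrightarrow> 0) F"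
    using Lim_null_comparison[of "\<lambda>x. f x - c" "\<lambda>x. K * d x" F] K by simp
  then show ?thesis by (simp add: LIM_zero_iff)
qed

lemma rate_add:
  assumes "rate d F f c" "rate d F g c'"
  shows "rate d F (\<lambda>x. f x + g x) (c + c')"
proof -
  obtain K K' where K: "\<forall>\<^sub>F x in F. \<bar>f x - c\<bar> \<le> K * d x" "\<forall>\<^sub>F x in F. \<bar>g x - c'\<bar> \<le> K' * d x"
    using assms unfolding rate_def by blast
  have "\<forall>\<^sub>F x in F. \<bar>f x + g x - (c + c')\<bar> \<le> (K + K') * d x"
    using K by eventually_elim (simp add: distrib_right)
  then show ?thesis unfolding rate_def by blast
qed

lemma rate_mult:
  assumes f: "rate d F f c" and g: "rate d F g c'" and d: "(d \<longlongrightarrow> 0) F" "\<And>x. 0 \<le> d x"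
  shows "rate d F (\<lambda>x. f x * g x) (c * c')"
proof -
  obtain K where K: "0 \<le> K" "\<forall>\<^sub>F x in F. \<bar>f x - c\<bar> \<le> K * d x" using rateE[OF f d(2)] .
  obtain K' where K': "0 \<le> K'" "\<forall>\<^sub>F x in F. \<bar>g x - c'\<bar> \<le> K' * d x" using rateE[OF g d(2)] .
  have "((\<lambda>x. \<bar>g x\<bar>) \<longlongrightarrow> \<bar>c'\<bar>) F" by (rule tendsto_rabs[OF rate_tendsto[OF g d(1)]])
  then have "\<forall>\<^sub>F x in F. \<bar>g x\<bar> < \<bar>c'\<bar> + 1" by (rule order_tendstoD) simp
  with K(2) K'(2) have "\<forall>\<^sub>F x in F. \<bar>f x * g x - c * c'\<bar> \<le> (K * (\<bar>c'\<bar> + 1) + \<bar>c\<bar> * K') * d x"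
  proof eventually_elim
    case (elim x)
    have "f x * g x - c * c' = (f x - c) * g x + c * (g x - c')" by (simp add: algebra_simps)
    then have "\<bar>f x * g x - c * c'\<bar> \<le> \<bar>f x - c\<bar> * \<bar>g x\<bar> + \<bar>c\<bar> * \<bar>g x - c'\<bar>"
      by (metis abs_mult abs_triangle_ineq)
    also have "\<dots> \<le> (K * d x) * (\<bar>c'\<bar> + 1) + \<bar>c\<bar> * (K' * d x)"
      using elim K(1) d(2)[of x] by (intro add_mono mult_mono mult_left_mono) auto
    finally show ?case by (simp add: algebra_simps)
  qed
  then show ?thesis unfolding rate_def by blast
qed

lemma rate_sum:
  assumes "finite I" "\<And>i. i \<in> I \<Longrightarrow> rate d F (f i) (c i)" "\<And>x. 0 \<le> d x"
  shows "rate d F (\<lambda>x. \<Sum>i\<in>I. f i x) (\<Sum>i\<in>I. c i)"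
  using assms(1,2)
proof (induction I)
  case empty
  show ?case using rate_const[of d F 0] assms(3) by simp
next
  case (insert i I)
  then show ?case using rate_add[of d F "f i" "c i" "\<lambda>x. \<Sum>i\<in>I. f i x"] by simp
qed

lemma rate_prod:
  assumes "finite I" "\<And>i. i \<in> I \<Longrightarrow> rate d F (f i) (c i)" "(d \<longlongrightarrow> 0) F" "\<And>x. 0 \<le> d x"
  shows "rate d F (\<lambda>x. \<Prod>i\<in>I. f i x) (\<Prod>i\<in>I. c i)"
  using assms(1,2)
proof (induction I)
  case empty
  show ?case using rate_const[of d F 1] assms(4) by simp
next
  case (insert i I)
  then show ?case using rate_mult[of d F "f i" "c i" "\<lambda>x. \<Prod>i\<in>I. f i x"] assms(3,4) by simp
qed

text \<open>A derivative at the single point c already gives a Lipschitz bound at c, and this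
  preserves the rate.\<close>

lemma rate_compose:
  fixes \<phi> :: "real \<Rightarrow> real"
  assumes f: "rate d F f c" and \<phi>: "(\<phi> has_real_derivative D) (at c)" and d: "(d \<longlongrightarrow> 0) F" "\<And>x. 0 \<le> d x"
  shows "rate d F (\<lambda>x. \<phi> (f x)) (\<phi> c)"
proof -
  obtain K where K: "0 \<le> K" "\<forall>\<^sub>F x in F. \<bar>f x - c\<bar> \<le> K * d x" using rateE[OF f d(2)] .
  have "((\<lambda>y. (\<phi> y - \<phi> c) / (y - c)) \<longlongrightarrow> D) (at c)" using \<phi> by (simp add: has_field_derivative_iff)
  then have "((\<lambda>y. \<bar>(\<phi> y - \<phi> c) / (y - c)\<bar>) \<longlongrightarrow> \<bar>D\<bar>) (at c)" by (rule tendsto_rabs)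
  then have "\<forall>\<^sub>F y in at c. \<bar>(\<phi> y - \<phi> c) / (y - c)\<bar> < \<bar>D\<bar> + 1" by (rule order_tendstoD) simp
  then have "\<forall>\<^sub>F y in nhds c. \<bar>\<phi> y - \<phi> c\<bar> \<le> (\<bar>D\<bar> + 1) * \<bar>y - c\<bar>"
    unfolding eventually_at_filter by eventually_elim (auto simp: abs_divide divide_simps split: if_splits)
  then have "\<forall>\<^sub>F x in F. \<bar>\<phi> (f x) - \<phi> c\<bar> \<le> (\<bar>D\<bar> + 1) * \<bar>f x - c\<bar>"
    using rate_tendsto[OF f d(1)] by (rule eventually_compose_filterlim)
  with K(2) have "\<forall>\<^sub>F x in F. \<bar>\<phi> (f x) - \<phi> c\<bar> \<le> ((\<bar>D\<bar> + 1) * K) * d x"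
  proof eventually_elim
    case (elim x)
    then show ?case using mult_left_mono[OF elim(1), of "\<bar>D\<bar> + 1"] by simp
  qed
  then show ?thesis unfolding rate_def by blast
qed

lemma rate_det:
  fixes M :: "'a \<Rightarrow> real ^ 'k::finite ^ 'k"
  assumes "\<And>i j. rate d F (\<lambda>x. M x $ i $ j) (M0 $ i $ j)" "(d \<longlongrightarrow> 0) F" "\<And>x. 0 \<le> d x"
  shows "rate d F (\<lambda>x. det (M x)) (det M0)"
  unfolding det_def
  by (intro rate_sum rate_mult rate_prod rate_const assms) auto

lemma rate_matrix_inv:
  fixes M :: "'a \<Rightarrow> real ^ 'k::finite ^ 'k"
  assumes M: "\<And>i j. rate d F (\<lambda>x. M x $ i $ j) (M0 $ i $ j)" and d: "(d \<longlongrightarrow> 0) F" "\<And>x. 0 \<le> d x"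
    and M0: "det M0 \<noteq> 0"
  shows "rate d F (\<lambda>x. matrix_inv (M x) $ i $ j) (matrix_inv M0 $ i $ j)"
proof -
  have rd: "rate d F (\<lambda>x. det (M x)) (det M0)" by (rule rate_det[OF M d])
  have ev: "\<forall>\<^sub>F x in F. det (M x) \<noteq> 0"
    using tendsto_imp_eventually_ne[OF rate_tendsto[OF rd d(1)] M0] .
  have "rate d F (\<lambda>x. det (\<chi> k l. if l = i then axis j 1 $ k else M x $ k $ l) * inverse (det (M x)))
     (det (\<chi> k l. if l = i then axis j 1 $ k else M0 $ k $ l) * inverse (det M0))"
  proof (rule rate_mult[OF rate_det[OF _ d] _ d])
    show "rate d F (\<lambda>x. inverse (det (M x))) (inverse (det M0))"
      by (rule rate_compose[OF rd DERIV_inverse[OF M0] d])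
    show "rate d F (\<lambda>x. (\<chi> k l. if l = i then axis j 1 $ k else M x $ k $ l) $ k $ l)
       ((\<chi> k l. if l = i then axis j 1 $ k else M0 $ k $ l) $ k $ l)" for k l
      by (cases "l = i") (auto intro: rate_const d(2) M)
  qed
  moreover have "\<forall>\<^sub>F x in F. det (\<chi> k l. if l = i then axis j 1 $ k else M x $ k $ l) * inverse (det (M x)) = matrix_inv (M x) $ i $ j"
    using ev by eventually_elim (simp add: matrix_inv_nth divide_inverse)
  ultimately have "rate d F (\<lambda>x. matrix_inv (M x) $ i $ j) (det (\<chi> k l. if l = i then axis j 1 $ k else M0 $ k $ l) * inverse (det M0))"
    by (rule rate_cong)
  then show ?thesis using matrix_inv_nth[OF M0, of i j] by (simp add: divide_inverse)
qed

section \<open>Block matrices and conformal factors\<close>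

lemma dr2_plus_nth [simp]:
  "dr2_plus t $ None $ None = 1" "dr2_plus t $ None $ Some j = 0" "dr2_plus t $ Some i $ None = 0"
  "dr2_plus t $ Some i $ Some j = t $ i $ j"
  by (simp_all add: dr2_plus_def)

lemma dr2_plus_quadratic_form:
  fixes t :: "real ^ 'n::finite ^ 'n" and v :: "real ^ 'n option"
  shows "v \<bullet> (dr2_plus t *v v) = (v $ None)\<^sup>2 + (\<chi> i. v $ Some i) \<bullet> (t *v (\<chi> i. v $ Some i))"
  unfolding quadratic_form_expand sum_UNIV_option by (simp add: power2_eq_square)

lemma dr2_plus_posdef:
  fixes t :: "real ^ 'n::finite ^ 'n"
  assumes t: "\<And>v. v \<noteq> 0 \<Longrightarrow> 0 < v \<bullet> (t *v v)" and v: "v \<noteq> 0"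
  shows "0 < v \<bullet> (dr2_plus t *v v)"
proof (cases "(\<chi> i. v $ Some i) = (0 :: real ^ 'n)")
  case True
  have "v $ None \<noteq> 0"
  proof
    assume "v $ None = 0"
    moreover have "v $ Some i = 0" for i
      using arg_cong[OF True, of "\<lambda>w. w $ i"] by simp
    ultimately have "v $ k = 0" for k by (cases k) simp_all
    then show False using v by (simp add: vec_eq_iff)
  qed
  then have "0 < (v $ None)\<^sup>2" by simp
  moreover have "(\<chi> i. v $ Some i) \<bullet> (t *v (\<chi> i. v $ Some i)) = 0" by (simp only: True inner_zero_left)
  ultimately show ?thesis by (simp only: dr2_plus_quadratic_form[of v t])
next
  case False
  show ?thesis
    by (subst dr2_plus_quadratic_form) (rule add_nonneg_pos[OF zero_le_power2 t[OF False]])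
qed

lemma matrix_inv_dr2_plus:
  fixes t :: "real ^ 'n::finite ^ 'n"
  assumes "det t \<noteq> 0"
  shows "matrix_inv (dr2_plus t) = dr2_plus (matrix_inv t)"
proof (rule matrix_inv_unique)
  have *: "(\<Sum>k\<in>UNIV. t $ i $ k * matrix_inv t $ k $ j) = (if i = j then 1 else 0)" for i j
  proof -
    have "(t ** matrix_inv t) $ i $ j = mat 1 $ i $ j" using matrix_inv_mult(1)[OF assms] by simp
    then show ?thesis by (simp add: matrix_matrix_mult_def mat_def)
  qed
  have "(dr2_plus t ** dr2_plus (matrix_inv t)) $ k $ l = (\<Sum>i\<in>UNIV. dr2_plus t $ k $ i * dr2_plus (matrix_inv t) $ i $ l)" for k l
    by (simp add: matrix_matrix_mult_def)
  moreover have "(\<Sum>i\<in>UNIV. dr2_plus t $ k $ i * dr2_plus (matrix_inv t) $ i $ l) = mat 1 $ k $ l" for k l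
    unfolding sum_UNIV_option by (cases k; cases l) (simp_all add: mat_def *)
  ultimately have "(dr2_plus t ** dr2_plus (matrix_inv t)) $ k $ l = mat 1 $ k $ l" for k l by simp
  then show "dr2_plus t ** dr2_plus (matrix_inv t) = mat 1" by (simp add: vec_eq_iff)
qed

lemma det_scaleR: "det (c *\<^sub>R A :: real ^ 'k::finite ^ 'k) = c ^ CARD('k) * det A"
  by (simp add: det_def sum_distrib_left prod.distrib mult_ac)

lemma matrix_inv_scaleR:
  fixes A :: "real ^ 'k::finite ^ 'k"
  assumes "c \<noteq> 0" "det A \<noteq> 0"
  shows "matrix_inv (c *\<^sub>R A) = inverse c *\<^sub>R matrix_inv A"
proof (rule matrix_inv_unique)
  have "(c *\<^sub>R A) ** (inverse c *\<^sub>R matrix_inv A) = A ** matrix_inv A"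
    using assms(1) by (simp add: matrix_matrix_mult_def vec_eq_iff field_simps)
  then show "(c *\<^sub>R A) ** (inverse c *\<^sub>R matrix_inv A) = mat 1"
    using matrix_inv_mult[OF assms(2)] by simp
qed

section \<open>The collar charts\<close>

definition tang :: "real ^ ('n::finite option) \<Rightarrow> real ^ 'n" where
  "tang x = (\<chi> i. x $ Some i)"

definition cons_vec :: "real \<Rightarrow> real ^ 'n::finite \<Rightarrow> real ^ ('n option)" where
  "cons_vec r y = (\<chi> k. case k of None \<Rightarrow> r | Some i \<Rightarrow> y $ i)"

lemma cons_vec_nth [simp]: "cons_vec r y $ None = r" "cons_vec r y $ Some i = y $ i"
  by (simp_all add: cons_vec_def)

lemma tang_nth [simp]: "tang x $ i = x $ Some i"
  by (simp add: tang_def)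

lemma tang_cons_vec [simp]: "tang (cons_vec r y) = y"
  by (simp add: vec_eq_iff)

lemma cons_vec_tang [simp]: "cons_vec (x $ None) (tang x) = x"
proof -
  have "cons_vec (x $ None) (tang x) $ k = x $ k" for k by (cases k) simp_all
  then show ?thesis by (simp add: vec_eq_iff)
qed

lemma continuous_on_tang: "continuous_on S tang"
  unfolding tang_def[abs_def] by (intro continuous_intros)

lemma continuous_on_cons_vec:
  assumes "continuous_on S f" "continuous_on S g"
  shows "continuous_on S (\<lambda>x. cons_vec (f x) (g x))"
  unfolding cons_vec_def
proof (rule continuous_on_vec_lambda)
  show "continuous_on S (\<lambda>x. case k of None \<Rightarrow> f x | Some i \<Rightarrow> g x $ i)" for k
    by (cases k) (use assms bounded_linear.continuous_on[OF bounded_linear_vec_nth assms(2)] in auto)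
qed

lemma norm_tang_le: "norm (tang x) \<le> norm x"
proof -
  have "(norm (tang x))\<^sup>2 \<le> (norm x)\<^sup>2"
    unfolding norm_vec_squared[of x] norm_vec_squared[of "tang x"] sum_UNIV_option by simp
  then show ?thesis using power2_le_imp_le norm_ge_zero by blast
qed

lemma tang_diff: "tang (x - y) = tang x - tang y"
  by (simp add: vec_eq_iff)

locale collar_space =
  fixes A :: "('x::{t2_space, second_countable_topology}, real ^ ('n::finite option)) chart set"
    and g :: "('x, 'n option) tensor2"
    and h h1 :: "('x, 'n) tensor2"
    and \<rho> \<phi> \<Phi> \<rho>1 \<psi> :: "'x \<Rightarrow> real"
    and \<kappa> :: "real \<times> 'x \<Rightarrow> 'x"
    and m \<epsilon> :: real
  assumes mfd: "manifold_with_boundary A"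
    and cpt: "compact (UNIV :: 'x set)"
    and g: "riemannian_metric (inner_charts A) g"
    and m: "m \<in> {-1<..<1}"
    and \<rho>_smooth: "smooth_function (inner_charts A) \<rho>" and \<rho>_cont: "continuous_on UNIV \<rho>"
    and \<rho>_nonneg: "\<And>q. 0 \<le> \<rho> q" and \<rho>_zero: "{q. \<rho> q = 0} = bdry A"
    and \<phi>: "\<And>q. q \<in> manifold_interior A \<Longrightarrow> \<rho> q powr m = exp (- \<phi> q)"
    and collar: "is_collar A \<epsilon> \<kappa>"
    and \<Phi>_smooth: "smooth_function (bdry_charts A) \<Phi>" and \<rho>1_smooth: "smooth_function (bdry_charts A) \<rho>1"
    and h: "riemannian_metric (bdry_charts A) h"
    and h1: "smooth_tensor (bdry_charts A) h1"
    and \<rho>_exp: "rho_expansion A \<kappa> m \<rho> \<Phi> \<rho>1"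
    and g_exp: "metric_expansion A \<epsilon> \<kappa> \<rho> g h h1"
    and \<rho>_coord: "rho_is_coordinate A \<epsilon> \<kappa> \<rho>"
    and \<psi>_cont: "continuous_on UNIV \<psi>"
begin

abbreviation cc where "cc d \<equiv> collar_chart A \<epsilon> \<kappa> d"

text \<open>The image of the collar chart over d, written without the collar map.\<close>

definition Om where "Om d = {x. 0 < x $ None \<and> x $ None < \<epsilon> \<and> tang x \<in> snd d ` fst d}"

lemma \<epsilon>: "0 < \<epsilon>" using collar by (simp add: is_collar_def)

lemma m': "-1 < m" "m < 1" using m by auto

lemma \<kappa>_0: "x \<in> bdry A \<Longrightarrow> \<kappa> (0, x) = x"
  using collar by (simp add: is_collar_def)

lemma \<kappa>_homeo:
  obtains \<kappa>' where "homeomorphism ({0..<\<epsilon>} \<times> bdry A) (\<kappa> ` ({0..<\<epsilon>} \<times> bdry A)) \<kappa> \<kappa>'"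
  using collar by (auto simp: is_collar_def)

lemma \<kappa>_inj: "inj_on \<kappa> ({0..<\<epsilon>} \<times> bdry A)"
proof -
  obtain \<kappa>' where \<kappa>': "homeomorphism ({0..<\<epsilon>} \<times> bdry A) (\<kappa> ` ({0..<\<epsilon>} \<times> bdry A)) \<kappa> \<kappa>'"
    by (rule \<kappa>_homeo)
  show ?thesis by (rule inj_on_inverseI[of _ \<kappa>']) (use \<kappa>' in \<open>auto simp: homeomorphism_def\<close>)
qed

lemma \<kappa>_cont: "continuous_on ({0..<\<epsilon>} \<times> bdry A) \<kappa>"
proof -
  obtain \<kappa>' where \<kappa>': "homeomorphism ({0..<\<epsilon>} \<times> bdry A) (\<kappa> ` ({0..<\<epsilon>} \<times> bdry A)) \<kappa> \<kappa>'"
    by (rule \<kappa>_homeo)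
  then show ?thesis by (simp add: homeomorphism_def)
qed

lemma cc_inner: "d \<in> bdry_charts A \<Longrightarrow> cc d \<in> inner_charts A"
  using collar by (simp add: is_collar_def)

lemma fst_bdry_chart: "d \<in> bdry_charts A \<Longrightarrow> fst d \<subseteq> bdry A"
  by (auto simp: bdry_charts_def)

lemma bdry_chart_cover: "q \<in> bdry A \<Longrightarrow> \<exists>d\<in>bdry_charts A. q \<in> fst d"
  by (auto simp: bdry_charts_def bdry_def)

lemma bdry_chart_cont:
  assumes "d \<in> bdry_charts A"
  shows "continuous_on (fst d) (snd d)" "openin (top_of_set (bdry A)) (fst d)"
proof -
  obtain c where c: "c \<in> A" "d = (fst c \<inter> bdry A, \<lambda>q. \<chi> i. snd c q $ Some i)"
    using assms by (auto simp: bdry_charts_def)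
  have ic: "is_chart UNIV halfspace c" using mfd c(1) by (simp add: manifold_with_boundary_def)
  then have "continuous_on (fst c) (snd c)" by (simp add: is_chart_def homeomorphism_def)
  then have "continuous_on (fst c \<inter> bdry A) (snd c)" by (rule continuous_on_subset) auto
  then show "continuous_on (fst d) (snd d)"
    unfolding c(2) fst_conv snd_conv
    by (intro continuous_on_vec_lambda bounded_linear.continuous_on[OF bounded_linear_vec_nth])
  have "open (fst c)" using ic by (simp add: is_chart_def)
  then show "openin (top_of_set (bdry A)) (fst d)"
    unfolding c(2) fst_conv by (metis Int_commute openin_open)
qed

lemma inv_\<kappa>: "r \<in> {0..<\<epsilon>} \<Longrightarrow> q \<in> bdry A \<Longrightarrow> inv_into ({0..<\<epsilon>} \<times> bdry A) \<kappa> (\<kappa> (r, q)) = (r, q)"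
  by (rule inv_into_f_f[OF \<kappa>_inj]) auto

lemma snd_cc:
  assumes "d \<in> bdry_charts A" "r \<in> {0..<\<epsilon>}" "q \<in> fst d"
  shows "snd (cc d) (\<kappa> (r, q)) = cons_vec r (snd d q)"
  using assms fst_bdry_chart[OF assms(1)]
  by (auto simp: collar_chart_def inv_\<kappa> cons_vec_def Let_def subset_iff)

lemma fst_cc: "fst (cc d) = \<kappa> ` ({0<..<\<epsilon>} \<times> fst d)"
  by (simp add: collar_chart_def)

lemma image_cc:
  assumes "d \<in> bdry_charts A"
  shows "snd (cc d) ` fst (cc d) = Om d"
proof
  show "snd (cc d) ` fst (cc d) \<subseteq> Om d"
    unfolding fst_cc using snd_cc[OF assms] by (auto simp: Om_def)
  show "Om d \<subseteq> snd (cc d) ` fst (cc d)"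
  proof
    fix x assume x: "x \<in> Om d"
    then obtain q where q: "q \<in> fst d" "tang x = snd d q" by (auto simp: Om_def)
    have "snd (cc d) (\<kappa> (x $ None, q)) = cons_vec (x $ None) (snd d q)"
      by (rule snd_cc[OF assms _ q(1)]) (use x in \<open>auto simp: Om_def\<close>)
    then have "snd (cc d) (\<kappa> (x $ None, q)) = x" by (simp only: q(2)[symmetric] cons_vec_tang)
    moreover have "\<kappa> (x $ None, q) \<in> fst (cc d)" unfolding fst_cc using x q by (auto simp: Om_def)
    ultimately show "x \<in> snd (cc d) ` fst (cc d)" by (metis imageI)
  qed
qed

lemma cc_chart:
  assumes "d \<in> bdry_charts A"
  shows "open (Om d)" "homeomorphism (fst (cc d)) (Om d) (snd (cc d)) (chart_inv (cc d))"
    "fst (cc d) \<subseteq> manifold_interior A"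
proof -
  have "is_chart (manifold_interior A) UNIV (cc d)"
    using cc_inner[OF assms] by (simp add: inner_charts_def)
  then have *: "openin (top_of_set (manifold_interior A)) (fst (cc d))" "open (snd (cc d) ` fst (cc d))"
    "homeomorphism (fst (cc d)) (snd (cc d) ` fst (cc d)) (snd (cc d)) (chart_inv (cc d))"
    by (simp_all add: is_chart_def)
  show "open (Om d)" "homeomorphism (fst (cc d)) (Om d) (snd (cc d)) (chart_inv (cc d))"
    using *(2,3) unfolding image_cc[OF assms] .
  show "fst (cc d) \<subseteq> manifold_interior A" using openin_imp_subset[OF *(1)] .
qed

text \<open>The slice r = \<epsilon> / 2 of the collar chart is a copy of d inside a genuine chart
  of the interior, whose homeomorphism property passes to d. The openness of the image and the
  continuity of the inverse are read off the same slice below.\<close>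

lemma bdry_chart_inj:
  assumes d: "d \<in> bdry_charts A"
  shows "inj_on (snd d) (fst d)"
proof (rule inj_onI)
  fix q q' assume q: "q \<in> fst d" "q' \<in> fst d" "snd d q = snd d q'"
  have e2: "\<epsilon> / 2 \<in> {0..<\<epsilon>}" "\<epsilon> / 2 \<in> {0<..<\<epsilon>}" using \<epsilon> by auto
  have "snd (cc d) (\<kappa> (\<epsilon> / 2, q)) = snd (cc d) (\<kappa> (\<epsilon> / 2, q'))"
    using snd_cc[OF d e2(1)] q by simp
  moreover have "\<kappa> (\<epsilon> / 2, q) \<in> fst (cc d)" "\<kappa> (\<epsilon> / 2, q') \<in> fst (cc d)"
    unfolding fst_cc using q e2 by auto
  ultimately have "\<kappa> (\<epsilon> / 2, q) = \<kappa> (\<epsilon> / 2, q')"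
    using cc_chart(2)[OF d] unfolding homeomorphism_def by metis
  then have "(\<epsilon> / 2, q) = (\<epsilon> / 2, q')"
    by (rule inj_onD[OF \<kappa>_inj]) (use q e2 fst_bdry_chart[OF d] in auto)
  then show "q = q'" by simp
qed

lemma chart_inv_bdry:
  assumes d: "d \<in> bdry_charts A"
  shows "q \<in> fst d \<Longrightarrow> chart_inv d (snd d q) = q"
    "y \<in> snd d ` fst d \<Longrightarrow> chart_inv d y \<in> fst d" "y \<in> snd d ` fst d \<Longrightarrow> snd d (chart_inv d y) = y"
  unfolding chart_inv_def
  by (auto simp: inv_into_f_f[OF bdry_chart_inj[OF d]] inv_into_into f_inv_into_f)

lemma chart_inv_cc:
  assumes d: "d \<in> bdry_charts A" and x: "x \<in> Om d"
  shows "chart_inv (cc d) x = \<kappa> (x $ None, chart_inv d (tang x))"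
proof -
  let ?q = "chart_inv d (tang x)"
  have x': "0 < x $ None" "x $ None < \<epsilon>" "tang x \<in> snd d ` fst d" using x by (auto simp: Om_def)
  have q: "?q \<in> fst d" "snd d ?q = tang x" using chart_inv_bdry(2,3)[OF d x'(3)] by auto
  have "snd (cc d) (\<kappa> (x $ None, ?q)) = x"
    using snd_cc[OF d, of "x $ None" ?q] x' q by simp
  moreover have "\<kappa> (x $ None, ?q) \<in> fst (cc d)" unfolding fst_cc using x' q by auto
  ultimately show ?thesis using cc_chart(2)[OF d] unfolding homeomorphism_def by metis
qed

lemma bdry_chart_open:
  assumes d: "d \<in> bdry_charts A"
  shows "open (snd d ` fst d)"
proof -
  have "snd d ` fst d = cons_vec (\<epsilon> / 2) -` Om d" using \<epsilon> by (auto simp: Om_def)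
  moreover have "open (cons_vec (\<epsilon> / 2) -` Om d)"
    by (rule open_vimage[OF cc_chart(1)[OF d]])
       (intro continuous_on_cons_vec continuous_on_const continuous_on_id)
  ultimately show ?thesis by simp
qed

lemma chart_inv_bdry_cont:
  assumes d: "d \<in> bdry_charts A"
  shows "continuous_on (snd d ` fst d) (chart_inv d)"
proof -
  obtain \<kappa>' where \<kappa>': "homeomorphism ({0..<\<epsilon>} \<times> bdry A) (\<kappa> ` ({0..<\<epsilon>} \<times> bdry A)) \<kappa> \<kappa>'"
    by (rule \<kappa>_homeo)
  have Om: "cons_vec (\<epsilon> / 2) y \<in> Om d" if "y \<in> snd d ` fst d" for y
    using that \<epsilon> by (auto simp: Om_def)
  have cA: "continuous_on (Om d) (chart_inv (cc d))" using cc_chart(2)[OF d] by (simp add: homeomorphism_def)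
  have cB: "continuous_on (snd d ` fst d) (cons_vec (\<epsilon> / 2))"
    by (intro continuous_on_cons_vec continuous_on_const continuous_on_id)
  have "continuous_on (snd d ` fst d) (\<lambda>y. chart_inv (cc d) (cons_vec (\<epsilon> / 2) y))"
    by (rule continuous_on_compose2[OF cA cB]) (use Om in auto)
  moreover have eq: "chart_inv (cc d) (cons_vec (\<epsilon> / 2) y) = \<kappa> (\<epsilon> / 2, chart_inv d y)" if "y \<in> snd d ` fst d" for y
    using chart_inv_cc[OF d Om[OF that]] by simp
  ultimately have c: "continuous_on (snd d ` fst d) (\<lambda>y. \<kappa> (\<epsilon> / 2, chart_inv d y))"
    by (rule continuous_on_eq)
  have B: "chart_inv d y \<in> bdry A" if "y \<in> snd d ` fst d" for y
    using chart_inv_bdry(2)[OF d that] fst_bdry_chart[OF d] by blast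
  have cK: "continuous_on (\<kappa> ` ({0..<\<epsilon>} \<times> bdry A)) \<kappa>'" using \<kappa>' by (simp add: homeomorphism_def)
  have "continuous_on (snd d ` fst d) (\<lambda>y. \<kappa>' (\<kappa> (\<epsilon> / 2, chart_inv d y)))"
    by (rule continuous_on_compose2[OF cK c]) (use B \<epsilon> in auto)
  then have "continuous_on (snd d ` fst d) (\<lambda>y. snd (\<kappa>' (\<kappa> (\<epsilon> / 2, chart_inv d y))))"
    by (rule continuous_on_snd)
  moreover have "snd (\<kappa>' (\<kappa> (\<epsilon> / 2, chart_inv d y))) = chart_inv d y" if "y \<in> snd d ` fst d" for y
    using \<kappa>' B[OF that] \<epsilon> by (simp add: homeomorphism_def)
  ultimately show ?thesis by (rule continuous_on_eq)
qed

text \<open>U in collar coordinates, meaningful also at r = 0, which the chart of the interior does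
  not reach; it carries the continuity of U up to the boundary.\<close>

definition rep where "rep U d x = U (\<kappa> (x $ None, chart_inv d (tang x)))"

lemma rep_eq: "d \<in> bdry_charts A \<Longrightarrow> x \<in> Om d \<Longrightarrow> (U \<circ> chart_inv (cc d)) x = rep U d x"
  by (simp add: chart_inv_cc rep_def)

lemma rep_cont:
  fixes U :: "'x \<Rightarrow> real"
  assumes d: "d \<in> bdry_charts A" and U: "continuous_on UNIV U"
  shows "continuous_on {x. 0 \<le> x $ None \<and> x $ None < \<epsilon> \<and> tang x \<in> snd d ` fst d} (rep U d)"
proof -
  let ?S = "{x. 0 \<le> x $ None \<and> x $ None < \<epsilon> \<and> tang x \<in> snd d ` fst d}"
  have c1: "continuous_on ?S (\<lambda>x. (x $ None, chart_inv d (tang x)))"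
    by (intro continuous_on_Pair continuous_on_compose2[OF chart_inv_bdry_cont[OF d] continuous_on_tang] continuous_intros) auto
  have "continuous_on ?S (\<lambda>x. \<kappa> (x $ None, chart_inv d (tang x)))"
    by (rule continuous_on_compose2[OF \<kappa>_cont c1])
       (use chart_inv_bdry(2)[OF d] fst_bdry_chart[OF d] in auto)
  from continuous_on_compose2[OF U this] show ?thesis unfolding rep_def by simp
qed

section \<open>The weighted Laplacian in a collar chart\<close>

lemma interior_\<rho>: "q \<in> manifold_interior A \<Longrightarrow> 0 < \<rho> q"
  using \<rho>_zero \<rho>_nonneg[of q] by (auto simp: manifold_interior_def order_less_le)

lemma \<phi>_eq: "q \<in> manifold_interior A \<Longrightarrow> \<phi> q = - ln (\<rho> q powr m)"
  using \<phi> by simp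

lemma smooth_C1:
  assumes d: "d \<in> bdry_charts A" and U: "smooth_function (inner_charts A) U"
  shows "C1 (Om d) (U \<circ> chart_inv (cc d))" "C1 (Om d) (pderivative j (U \<circ> chart_inv (cc d)))"
proof -
  have "smooth_on (Om d) (U \<circ> chart_inv (cc d))"
    using U cc_inner[OF d] unfolding smooth_function_def image_cc[OF d, symmetric] by blast
  then show "C1 (Om d) (U \<circ> chart_inv (cc d))" "C1 (Om d) (pderivative j (U \<circ> chart_inv (cc d)))"
    using smooth_on_imp_C1_pderivative[OF cc_chart(1)[OF d]] by blast+
qed

abbreviation G where "G d \<equiv> g (cc d) \<circ> chart_inv (cc d)"

lemma chart_inv_cc_in:
  assumes "d \<in> bdry_charts A" "x \<in> Om d"
  shows "chart_inv (cc d) x \<in> fst (cc d)" "chart_inv (cc d) x \<in> manifold_interior A" "snd (cc d) (chart_inv (cc d) x) = x"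
  using cc_chart(2,3)[OF assms(1)] assms(2) unfolding homeomorphism_def by auto

lemma G_props:
  assumes d: "d \<in> bdry_charts A"
  shows "C1 (Om d) (\<lambda>x. G d x $ i $ j)" "x \<in> Om d \<Longrightarrow> v \<noteq> 0 \<Longrightarrow> 0 < v \<bullet> (G d x *v v)"
    "x \<in> Om d \<Longrightarrow> 0 < det (G d x)"
proof -
  have "smooth_on (Om d) (G d)"
    using g cc_inner[OF d] unfolding riemannian_metric_def smooth_tensor_def image_cc[OF d, symmetric] by blast
  then have "C1 (Om d) (\<lambda>x. (\<lambda>M. M $ i $ j) (G d x))"
    by (rule smooth_on_imp_C1[OF cc_chart(1)[OF d]])
       (rule bounded_linear_compose[OF bounded_linear_vec_nth bounded_linear_vec_nth])
  then show "C1 (Om d) (\<lambda>x. G d x $ i $ j)" .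
  show *: "0 < v \<bullet> (G d x *v v)" if "x \<in> Om d" "v \<noteq> 0" for x v
    using g cc_inner[OF d] chart_inv_cc_in(1)[OF d that(1)] that(2)
    unfolding riemannian_metric_def by auto
  show "0 < det (G d x)" if "x \<in> Om d"
    by (rule posdef_det_pos) (use *[OF that] in auto)
qed

text \<open>The density of the weighted measure \<rho>^m dvol in the collar chart.\<close>

definition wt where "wt d x = (\<rho> \<circ> chart_inv (cc d)) x powr m * sqrt (det (G d x))"

lemma wt_props:
  assumes d: "d \<in> bdry_charts A"
  shows "C1 (Om d) (wt d)" "x \<in> Om d \<Longrightarrow> 0 < wt d x"
proof -
  have p: "0 < (\<rho> \<circ> chart_inv (cc d)) x" if "x \<in> Om d" for x
    using interior_\<rho>[OF chart_inv_cc_in(2)[OF d that]] by simp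
  show "C1 (Om d) (wt d)" unfolding wt_def[abs_def]
    by (intro C1_mult(1) C1_powr(1) smooth_C1(1)[OF d \<rho>_smooth] p C1_sqrt C1_det G_props[OF d])
  show "0 < wt d x" if "x \<in> Om d" using p[OF that] G_props(3)[OF d that] by (simp add: wt_def)
qed

text \<open>The number s is a normalisation. The boundary analysis takes for it the limit of wt /
  r^m at q0, so that the leading coefficient becomes r^m; the maximum principle takes 1.\<close>

definition aa where "aa s d x = (wt d x / s) *\<^sub>R matrix_inv (G d x)"

lemma aa_props:
  assumes d: "d \<in> bdry_charts A" and s: "0 < s"
  shows "C1 (Om d) (\<lambda>x. aa s d x $ i $ j)" "x \<in> Om d \<Longrightarrow> v \<noteq> 0 \<Longrightarrow> 0 < v \<bullet> (aa s d x *v v)"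
proof -
  have "C1 (Om d) (\<lambda>x. (1 / s) * wt d x * matrix_inv (G d x) $ i $ j)"
    by (intro C1_mult(1) C1_cmult(1) wt_props(1)[OF d] C1_matrix_inv G_props(1)[OF d] cc_chart(1)[OF d])
       (use G_props(3)[OF d] in force)
  then show "C1 (Om d) (\<lambda>x. aa s d x $ i $ j)" by (simp add: aa_def)
  assume x: "x \<in> Om d" "v \<noteq> 0"
  have "0 < v \<bullet> (matrix_inv (G d x) *v v)"
    by (rule posdef_inverse[OF G_props(2)[OF d x(1)] x(2)])
  then show "0 < v \<bullet> (aa s d x *v v)"
    using wt_props(2)[OF d x(1)] s
    by (simp add: aa_def scaleR_matrix_vector_assoc[symmetric])
qed

text \<open>In the collar chart, \<open>\<rho>\<^sup>m sqrt (det g) \<Delta>\<^sub>\<phi> U = div (\<rho>\<^sup>m sqrt (det g) g\<^sup>-\<^sup>1 grad U)\<close>.\<close>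

lemma divergence_form:
  assumes d: "d \<in> bdry_charts A" and s: "0 < s" and U: "smooth_function (inner_charts A) U"
    and super: "\<And>c q. c \<in> inner_charts A \<Longrightarrow> q \<in> fst c \<Longrightarrow> 0 \<le> - weighted_laplacian g \<phi> c U q + \<psi> q * U q"
    and x: "x \<in> Om d"
  shows "(\<Sum>i\<in>UNIV. pderivative i (\<lambda>x. \<Sum>j\<in>UNIV. aa s d x $ i $ j * pderivative j (U \<circ> chart_inv (cc d)) x) x)
    \<le> (\<psi> (chart_inv (cc d) x) * (wt d x / s)) * (U \<circ> chart_inv (cc d)) x"
proof -
  let ?u = "U \<circ> chart_inv (cc d)" and ?q = "chart_inv (cc d) x"
  define e where "e x = (\<rho> \<circ> chart_inv (cc d)) x powr m" for x
  have p: "0 < (\<rho> \<circ> chart_inv (cc d)) x" if "x \<in> Om d" for x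
    using interior_\<rho>[OF chart_inv_cc_in(2)[OF d that]] by simp
  have Ce: "C1 (Om d) e" unfolding e_def[abs_def] by (intro C1_powr(1) smooth_C1(1)[OF d \<rho>_smooth] p)
  have e0: "0 < e x" if "x \<in> Om d" for x using p[OF that] by (simp add: e_def)
  have dn: "det (G d x) \<noteq> 0" if "x \<in> Om d" for x using G_props(3)[OF d that] by simp
  define F where "F i y = sqrt (det (G d y)) * (\<Sum>j\<in>UNIV. matrix_inv (G d y) $ i $ j * pderivative j ?u y)" for i y
  have CF: "C1 (Om d) (F i)" for i unfolding F_def[abs_def]
    by (intro C1_mult(1) C1_sqrt C1_det C1_sum_UNIV(1) C1_matrix_inv[OF G_props(1)[OF d] cc_chart(1)[OF d] dn]
        G_props[OF d] smooth_C1(2)[OF d U])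
  \<comment> \<open>Since e = exp (- \<phi>), the drift term of the weighted Laplacian is what the
    product rule yields when e is moved under the divergence.\<close>
  have dln: "pderivative i (\<phi> \<circ> chart_inv (cc d)) x = - (inverse (e x) * pderivative i e x)" for i
  proof -
    have 1: "(ln has_real_derivative inverse (e y)) (at (e y))" if "y \<in> Om d" for y
      using DERIV_ln[OF e0[OF that]] .
    have 2: "continuous_on (Om d) (\<lambda>x. inverse (e x))"
      using e0 by (intro continuous_intros C1D(4)[OF Ce]) force
    have L1: "C1 (Om d) (\<lambda>x. ln (e x))" by (rule C1_compose(1)[OF Ce _ 2]) (rule 1)
    have L2: "pderivative i (\<lambda>x. ln (e x)) x = inverse (e x) * pderivative i e x"
      by (rule C1_compose(2)[OF Ce _ 2 x]) (rule 1)
    have "pderivative i (\<lambda>x. - 1 * ln (e x)) x = - (inverse (e x) * pderivative i e x)"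
      unfolding C1_cmult(2)[OF L1 x] L2 by simp
    moreover have "pderivative i (\<lambda>x. - 1 * ln (e x)) x = pderivative i (\<phi> \<circ> chart_inv (cc d)) x"
      by (rule pderivative_cong[OF cc_chart(1)[OF d] x _ C1_cmult(1)[OF L1]])
         (simp add: e_def \<phi>_eq[OF chart_inv_cc_in(2)[OF d]])
    ultimately show ?thesis by simp
  qed
  let ?S = "sqrt (det (G d x))"
  have S0: "0 < ?S" using G_props(3)[OF d x] by simp
  have sq: "snd (cc d) ?q = x" using chart_inv_cc_in(3)[OF d x] .
  have lap: "laplacian g (cc d) U ?q = (\<Sum>i\<in>UNIV. pderivative i (F i) x) / ?S"
    unfolding laplacian_def Let_def sq F_def by simp
  have gr: "?S * grad_inner g (cc d) \<phi> U ?q = (\<Sum>i\<in>UNIV. pderivative i (\<phi> \<circ> chart_inv (cc d)) x * F i x)"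
    unfolding grad_inner_def sq F_def by (simp add: sum_distrib_left mult_ac)
  have "(\<Sum>i\<in>UNIV. pderivative i (\<lambda>x. e x * F i x) x) = e x * (\<Sum>i\<in>UNIV. pderivative i (F i) x)
      + (\<Sum>i\<in>UNIV. pderivative i e x * F i x)"
    by (simp add: C1_mult(2)[OF Ce CF x] sum.distrib sum_distrib_left)
  also have "(\<Sum>i\<in>UNIV. pderivative i e x * F i x) = - (e x * (?S * grad_inner g (cc d) \<phi> U ?q))"
    unfolding gr dln using e0[OF x] by (simp add: sum_distrib_left sum_negf mult.assoc[symmetric])
  also have "(\<Sum>i\<in>UNIV. pderivative i (F i) x) = ?S * laplacian g (cc d) U ?q"
    unfolding lap using S0 by simp
  finally have div: "(\<Sum>i\<in>UNIV. pderivative i (\<lambda>x. e x * F i x) x) = wt d x * weighted_laplacian g \<phi> (cc d) U ?q"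
    by (simp add: weighted_laplacian_def wt_def e_def algebra_simps)
  have "weighted_laplacian g \<phi> (cc d) U ?q \<le> \<psi> ?q * U ?q"
    using super[OF cc_inner[OF d] chart_inv_cc_in(1)[OF d x]] by simp
  then have "(1 / s) * (wt d x * weighted_laplacian g \<phi> (cc d) U ?q) \<le> (1 / s) * (wt d x * (\<psi> ?q * U ?q))"
    using wt_props(2)[OF d x] s by (intro mult_left_mono) auto
  also have "\<dots> = (\<psi> ?q * (wt d x / s)) * ?u x" by simp
  also have "(1 / s) * (wt d x * weighted_laplacian g \<phi> (cc d) U ?q)
     = (\<Sum>i\<in>UNIV. pderivative i (\<lambda>x. (1 / s) * (e x * F i x)) x)"
    unfolding div[symmetric] sum_distrib_left
    by (rule sum.cong[OF refl]) (rule C1_cmult(2)[OF C1_mult(1)[OF Ce CF] x, symmetric])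
  finally have "(\<Sum>i\<in>UNIV. pderivative i (\<lambda>x. (1 / s) * (e x * F i x)) x) \<le> (\<psi> ?q * (wt d x / s)) * ?u x" .
  moreover have "(\<lambda>x. (1 / s) * (e x * F i x)) = (\<lambda>x. \<Sum>j\<in>UNIV. aa s d x $ i $ j * pderivative j ?u x)" for i
    by (rule ext) (simp add: aa_def wt_def e_def F_def sum_distrib_left mult.assoc)
  ultimately show ?thesis by (simp only:)
qed

end

section \<open>Asymptotics of the coefficients at the boundary\<close>

text \<open>Polarisation: it recovers the entries of a symmetric remainder from its values on
  vectors, and only these are controlled by \<open>metric_expansion\<close>.\<close>

lemma quadratic_form_axis_sum:
  fixes M :: "real ^ 'k::finite ^ 'k"
  shows "(axis i 1 + axis j 1) \<bullet> (M *v (axis i 1 + axis j 1)) = M $ i $ i + M $ i $ j + M $ j $ i + M $ j $ j"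
    and "axis i 1 \<bullet> (M *v axis i 1) = M $ i $ i"
  by (simp_all add: matrix_vector_right_distrib matrix_vector_mult_basis inner_add_left inner_add_right inner_axis' column_def)

lemma C1_lipschitz_at:
  assumes "C1 S f" "y0 \<in> S"
  shows "\<exists>\<delta>>0. \<forall>y. norm (y - y0) < \<delta> \<longrightarrow> \<bar>f y - f y0\<bar> \<le> (norm (grad f y0) + 1) * norm (y - y0)"
proof -
  have "(f has_derivative (\<lambda>h. grad f y0 \<bullet> h)) (at y0)" by (rule C1D(1)[OF assms])
  then obtain \<delta> where \<delta>: "0 < \<delta>" "\<And>y. norm (y - y0) < \<delta> \<Longrightarrow> norm (f y - f y0 - grad f y0 \<bullet> (y - y0)) \<le> 1 * norm (y - y0)"
    unfolding has_derivative_at_alt using zero_less_one by metis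
  have "\<bar>f y - f y0\<bar> \<le> (norm (grad f y0) + 1) * norm (y - y0)" if "norm (y - y0) < \<delta>" for y
    using \<delta>(2)[OF that] Cauchy_Schwarz_ineq2[of "grad f y0" "y - y0"] by (simp add: distrib_right)
  then show ?thesis using \<delta>(1) by blast
qed

context collar_space begin

text \<open>The slower of the two rates r and r^(1-m) in the expansions.\<close>

definition \<alpha> where "\<alpha> = min 1 (1 - m)"

lemma \<alpha>: "0 < \<alpha>" "\<alpha> \<le> 1" "\<alpha> \<le> 1 - m" using m' by (auto simp: \<alpha>_def)

text \<open>Fixed from here on is a boundary point: \<open>F\<close> approaches its coordinates x0
  through the open half space, and \<open>dd\<close>, the distance to x0 to the power \<alpha>, is
  the common rate of all coefficients.\<close>

context
  fixes d q0 x0 and F and dd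
  assumes d: "d \<in> bdry_charts A" and q0: "q0 \<in> fst d"
  defines x0_def: "x0 \<equiv> cons_vec 0 (snd d q0)"
    and F_def: "F \<equiv> at x0 within {x. 0 < x $ None}"
    and dd_def: "dd \<equiv> \<lambda>x. norm (x - x0) powr \<alpha>"
begin

lemma dd: "0 \<le> dd x" "(dd \<longlongrightarrow> 0) F"
proof -
  show "0 \<le> dd x" by (simp add: dd_def)
  have "((\<lambda>x. x - x0) \<longlongrightarrow> x0 - x0) F" unfolding F_def by (rule tendsto_diff[OF tendsto_ident_at tendsto_const])
  then have "((\<lambda>x. norm (x - x0)) \<longlongrightarrow> 0) F" by (simp add: tendsto_norm_zero)
  then show "(dd \<longlongrightarrow> 0) F" unfolding dd_def
    by (rule tendsto_zero_powrI[OF _ tendsto_const]) (use \<alpha> in auto)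
qed

lemma F_open: "open W \<Longrightarrow> x0 \<in> W \<Longrightarrow> \<forall>\<^sub>F x in F. x \<in> W"
  unfolding F_def eventually_at_topological by blast

lemma F_pos: "\<forall>\<^sub>F x in F. 0 < x $ None"
  unfolding F_def eventually_at_filter by (rule always_eventually) simp

lemma F_near: "0 < \<delta> \<Longrightarrow> \<forall>\<^sub>F x in F. norm (x - x0) < \<delta>"
  using F_open[of "ball x0 \<delta>"] by (simp add: dist_norm norm_minus_commute)

lemma F_Om: "\<forall>\<^sub>F x in F. x \<in> Om d"
proof -
  have "open {x. x $ None < \<epsilon> \<and> tang x \<in> snd d ` fst d}"
  proof (rule open_Collect_conj)
    show "open {x :: real ^ 'n option. x $ None < \<epsilon>}"
      by (rule open_Collect_less) (auto intro: continuous_intros)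
    show "open {x. tang x \<in> snd d ` fst d}"
      using open_vimage[OF bdry_chart_open[OF d] continuous_on_tang] by (simp add: vimage_def)
  qed
  then have "\<forall>\<^sub>F x in F. x \<in> {x. x $ None < \<epsilon> \<and> tang x \<in> snd d ` fst d}"
    by (rule F_open) (use \<epsilon> q0 in \<open>auto simp: x0_def\<close>)
  with F_pos show ?thesis by eventually_elim (simp add: Om_def)
qed

lemma F_right: "filterlim (\<lambda>x. x $ None) (at_right 0) F"
proof (rule tendsto_imp_filterlim_at_right[OF _ F_pos])
  have "((\<lambda>x. x $ None) \<longlongrightarrow> x0 $ None) F"
    unfolding F_def by (rule tendsto_vec_nth[OF tendsto_ident_at])
  then show "((\<lambda>x. x $ None) \<longlongrightarrow> 0) F" by (simp add: x0_def)
qed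

lemma r_le: "\<bar>x $ None\<bar> \<le> norm (x - x0)"
  using component_le_norm_cart[of "x - x0" None] by (simp add: x0_def)

lemma rate_r:
  assumes "\<forall>\<^sub>F x in F. \<bar>f x\<bar> \<le> K * x $ None powr \<gamma>" "\<alpha> \<le> \<gamma>" "0 \<le> K"
  shows "rate dd F f 0"
proof -
  have "\<forall>\<^sub>F x in F. \<bar>f x - 0\<bar> \<le> K * dd x"
    using assms(1) F_pos F_near[of 1, OF zero_less_one]
  proof eventually_elim
    case (elim x)
    have r: "0 < x $ None" "x $ None \<le> norm (x - x0)" "x $ None \<le> 1" using elim r_le[of x] by auto
    have "x $ None powr \<gamma> \<le> x $ None powr \<alpha>" by (rule powr_mono') (use r assms in auto)
    also have "\<dots> \<le> dd x" unfolding dd_def by (rule powr_mono2) (use r \<alpha> in auto)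
    finally have "K * x $ None powr \<gamma> \<le> K * dd x" by (rule mult_left_mono) (use assms in simp)
    then show ?case using elim(1) by simp
  qed
  then show ?thesis unfolding rate_def by blast
qed

lemma rate_tang:
  assumes "C1 (snd d ` fst d) f"
  shows "rate dd F (\<lambda>x. f (tang x)) (f (snd d q0))"
proof -
  let ?y = "snd d q0"
  obtain \<delta> where \<delta>: "0 < \<delta>" "\<And>y. norm (y - ?y) < \<delta> \<Longrightarrow> \<bar>f y - f ?y\<bar> \<le> (norm (grad f ?y) + 1) * norm (y - ?y)"
    using C1_lipschitz_at[OF assms] q0 by blast
  have "\<forall>\<^sub>F x in F. \<bar>f (tang x) - f ?y\<bar> \<le> (norm (grad f ?y) + 1) * dd x"
    using F_near[OF \<delta>(1)] F_near[of 1, OF zero_less_one]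
  proof eventually_elim
    case (elim x)
    have t: "norm (tang x - ?y) \<le> norm (x - x0)"
      using norm_tang_le[of "x - x0"] by (simp add: tang_diff x0_def)
    then have "\<bar>f (tang x) - f ?y\<bar> \<le> (norm (grad f ?y) + 1) * norm (tang x - ?y)"
      using \<delta>(2) elim by simp
    also have "norm (tang x - ?y) \<le> dd x"
    proof -
      have "norm (x - x0) powr 1 \<le> norm (x - x0) powr \<alpha>" by (rule powr_mono') (use elim \<alpha> in auto)
      then show ?thesis using t by (simp add: dd_def)
    qed
    finally show ?case by (simp add: mult_left_mono)
  qed
  then show ?thesis unfolding rate_def by blast
qed

lemma smooth_bdry_rate:
  assumes "smooth_function (bdry_charts A) f"
  shows "rate dd F (\<lambda>x. f (chart_inv d (tang x))) (f q0)"
proof -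
  have "smooth_on (snd d ` fst d) (f \<circ> chart_inv d)" using assms d by (simp add: smooth_function_def)
  then have "C1 (snd d ` fst d) (f \<circ> chart_inv d)"
    by (rule smooth_on_imp_C1_pderivative(1)[OF bdry_chart_open[OF d]])
  from rate_tang[OF this] show ?thesis using chart_inv_bdry(1)[OF d q0] by simp
qed

lemma smooth_tensor_rate:
  assumes "smooth_tensor (bdry_charts A) t"
  shows "rate dd F (\<lambda>x. t d (chart_inv d (tang x)) $ i $ j) (t d q0 $ i $ j)"
proof -
  have "smooth_on (snd d ` fst d) (t d \<circ> chart_inv d)" using assms d by (simp add: smooth_tensor_def)
  then have "C1 (snd d ` fst d) (\<lambda>y. (\<lambda>M. M $ i $ j) ((t d \<circ> chart_inv d) y))"
    by (rule smooth_on_imp_C1[OF bdry_chart_open[OF d]])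
       (rule bounded_linear_compose[OF bounded_linear_vec_nth bounded_linear_vec_nth])
  from rate_tang[OF this] show ?thesis using chart_inv_bdry(1)[OF d q0] by simp
qed

lemma rate_bounded:
  assumes "rate dd F f c" "\<bar>c\<bar> < B"
  shows "\<forall>\<^sub>F x in F. \<bar>f x\<bar> < B"
  using order_tendstoD(2)[OF tendsto_rabs[OF rate_tendsto[OF assms(1) dd(2)]] assms(2)] .

lemma tang_in: "\<forall>\<^sub>F x in F. chart_inv d (tang x) \<in> fst d"
  using F_Om by eventually_elim (use chart_inv_bdry(2)[OF d] in \<open>auto simp: Om_def\<close>)

lemma \<rho>_rate: "rate dd F (\<lambda>x. \<rho> (\<kappa> (x $ None, chart_inv d (tang x))) / x $ None) 1"
proof -
  let ?q = "\<lambda>x. chart_inv d (tang x)"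
  let ?R = "\<lambda>r x. \<rho> (\<kappa> (r, x)) / r - (1 + \<Phi> x * r powr (1 - m) + \<rho>1 x * r)"
  have "\<forall>\<^sub>F r in at_right 0. \<forall>x\<in>bdry A. dist (?R r x / r) 0 < 1"
    using uniform_limitD[OF \<rho>_exp[unfolded rho_expansion_def] zero_less_one] .
  from eventually_compose_filterlim[OF this F_right]
  have "\<forall>\<^sub>F x in F. \<forall>y\<in>bdry A. dist (?R (x $ None) y / x $ None) 0 < 1" .
  with tang_in F_pos have "\<forall>\<^sub>F x in F. \<bar>?R (x $ None) (?q x)\<bar> \<le> 1 * x $ None powr 1"
  proof eventually_elim
    case (elim x)
    have "\<bar>?R (x $ None) (?q x) / x $ None\<bar> < 1"
      using elim(1,3) fst_bdry_chart[OF d] by (simp add: dist_real_def subset_iff)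
    then show ?case using elim(2) by (simp add: abs_divide)
  qed
  then have R: "rate dd F (\<lambda>x. ?R (x $ None) (?q x)) 0" by (rule rate_r) (use \<alpha> in auto)
  have "\<forall>\<^sub>F x in F. \<bar>x $ None powr (1 - m)\<bar> \<le> 1 * x $ None powr (1 - m)" by (rule always_eventually) simp
  then have r1: "rate dd F (\<lambda>x. x $ None powr (1 - m)) 0" by (rule rate_r) (use \<alpha> in auto)
  have "\<forall>\<^sub>F x in F. \<bar>x $ None\<bar> \<le> 1 * x $ None powr 1" using F_pos by eventually_elim simp
  then have r2: "rate dd F (\<lambda>x. x $ None) 0" by (rule rate_r) (use \<alpha> in auto)
  have "rate dd F (\<lambda>x. ?R (x $ None) (?q x) + (1 + \<Phi> (?q x) * x $ None powr (1 - m) + \<rho>1 (?q x) * x $ None))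
      (0 + (1 + \<Phi> q0 * 0 + \<rho>1 q0 * 0))"
    by (rule rate_add[OF R rate_add[OF rate_add[OF rate_const[OF dd(1)]
          rate_mult[OF smooth_bdry_rate[OF \<Phi>_smooth] r1 dd(2,1)]] rate_mult[OF smooth_bdry_rate[OF \<rho>1_smooth] r2 dd(2,1)]]])
  then show ?thesis by simp
qed

text \<open>Homogeneity turns the bound on h-unit vectors into one by r times the form of h.
  Polarisation then bounds each entry by 3 B r, with B a bound for the entries of h near q0.\<close>

lemma remainder_rate:
  fixes e :: "real \<Rightarrow> ('x, 'n) tensor2"
  assumes sym: "\<forall>r\<in>{0<..<\<epsilon>}. symmetric_tensor (bdry_charts A) (e r)"
    and lim: "uniform_limit {(d, x, v). d \<in> bdry_charts A \<and> x \<in> fst d \<and> v \<bullet> (h d x *v v) = 1}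
          (\<lambda>r (d, x, v). v \<bullet> (e r d x *v v) / r) (\<lambda>_. 0) (at_right 0)"
  shows "rate dd F (\<lambda>x. e (x $ None) d (chart_inv d (tang x)) $ i $ j) 0"
proof -
  let ?q = "\<lambda>x. chart_inv d (tang x)"
  have hs: "smooth_tensor (bdry_charts A) h" using h by (simp add: riemannian_metric_def)
  have hpos: "0 < v \<bullet> (h d q *v v)" if "q \<in> fst d" "v \<noteq> 0" for q v
    using h d that by (simp add: riemannian_metric_def)
  define B where "B = 1 + (\<Sum>i\<in>UNIV. \<Sum>j\<in>UNIV. \<bar>h d q0 $ i $ j\<bar>)"
  have hB: "\<bar>h d q0 $ i $ j\<bar> < B" for i j
  proof -
    have "\<bar>h d q0 $ i $ j\<bar> \<le> (\<Sum>j\<in>UNIV. \<bar>h d q0 $ i $ j\<bar>)" by (rule member_le_sum) auto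
    also have "\<dots> \<le> (\<Sum>i\<in>UNIV. \<Sum>j\<in>UNIV. \<bar>h d q0 $ i $ j\<bar>)"
      by (rule member_le_sum[of i UNIV "\<lambda>i. \<Sum>j\<in>UNIV. \<bar>h d q0 $ i $ j\<bar>"]) (auto intro: sum_nonneg)
    finally show ?thesis by (simp add: B_def)
  qed
  have hb: "\<forall>\<^sub>F x in F. \<bar>h d (?q x) $ k $ l\<bar> < B" for k l
    by (rule rate_bounded[OF smooth_tensor_rate[OF hs] hB])
  have "\<forall>\<^sub>F r in at_right 0. \<forall>p\<in>{(d, x, v). d \<in> bdry_charts A \<and> x \<in> fst d \<and> v \<bullet> (h d x *v v) = 1}.
      dist (case p of (d, x, v) \<Rightarrow> v \<bullet> (e r d x *v v) / r) 0 < 1"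
    using uniform_limitD[OF lim zero_less_one] .
  from eventually_compose_filterlim[OF this F_right]
  have ev: "\<forall>\<^sub>F x in F. \<forall>p\<in>{(d, x, v). d \<in> bdry_charts A \<and> x \<in> fst d \<and> v \<bullet> (h d x *v v) = 1}.
      dist (case p of (d, y, v) \<Rightarrow> v \<bullet> (e (x $ None) d y *v v) / x $ None) 0 < 1" .
  have "\<forall>\<^sub>F x in F. \<bar>e (x $ None) d (?q x) $ i $ j\<bar> \<le> (3 * B) * x $ None powr 1"
    using ev tang_in F_pos F_Om hb[of i i] hb[of j j] hb[of i j] hb[of j i]
  proof eventually_elim
    case (elim x)
    let ?r = "x $ None" and ?e = "e (x $ None) d (?q x)" and ?h = "h d (?q x)"
    \<comment> \<open>Rescale v to an h-unit vector, for which the uniform limit applies.\<close>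
    have Q: "\<bar>v \<bullet> (?e *v v)\<bar> \<le> ?r * (v \<bullet> (?h *v v))" for v
    proof (cases "v = 0")
      case False
      define c where "c = sqrt (v \<bullet> (?h *v v))"
      have c: "0 < c" "c\<^sup>2 = v \<bullet> (?h *v v)" using hpos[OF elim(2) False] by (auto simp: c_def)
      define w where "w = (1 / c) *\<^sub>R v"
      have wq: "w \<bullet> (M *v w) = (v \<bullet> (M *v v)) / c\<^sup>2" for M :: "real ^ 'n ^ 'n"
        by (simp add: w_def matrix_vector_mult_scaleR power2_eq_square)
      have "w \<bullet> (?h *v w) = 1" using c hpos[OF elim(2) False] by (simp add: wq)
      then have "dist (w \<bullet> (?e *v w) / ?r) 0 < 1"
        using bspec[OF elim(1), of "(d, ?q x, w)"] d elim(2) by simp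
      then have "\<bar>v \<bullet> (?e *v v)\<bar> / c\<^sup>2 / ?r < 1"
        using elim(3) by (simp add: wq dist_real_def abs_divide)
      then have "\<bar>v \<bullet> (?e *v v)\<bar> < ?r * c\<^sup>2" using elim(3) c(1) by (simp add: pos_divide_less_eq mult.commute)
      then show ?thesis using c(2) by simp
    qed simp
    have r0: "0 < ?r" using elim(3) .
    have se: "?e $ j $ i = ?e $ i $ j"
    proof -
      have "?r \<in> {0<..<\<epsilon>}" using elim(4) by (simp add: Om_def)
      with sym have "symmetric_tensor (bdry_charts A) (e ?r)" by blast
      then have "\<forall>c\<in>bdry_charts A. \<forall>q\<in>fst c. transpose (e ?r c q) = e ?r c q"
        unfolding symmetric_tensor_def by (rule conjunct1)
      with d elim(2) have "transpose ?e = ?e" by blast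
      then have "transpose ?e $ i $ j = ?e $ i $ j" by simp
      then show ?thesis by (simp add: transpose_def)
    qed
    have h1: "?r * (?h $ i $ i) \<le> ?r * B" "?r * (?h $ j $ j) \<le> ?r * B"
      "?r * (?h $ i $ i + ?h $ i $ j + ?h $ j $ i + ?h $ j $ j) \<le> ?r * (4 * B)"
      by (rule mult_left_mono; use elim r0 in linarith)+
    have "\<bar>?e $ i $ i + ?e $ i $ j + ?e $ j $ i + ?e $ j $ j\<bar> \<le> ?r * (4 * B)"
      using Q[of "axis i 1 + axis j 1"] h1(3) by (simp only: quadratic_form_axis_sum)
    moreover have "\<bar>?e $ i $ i\<bar> \<le> ?r * B" "\<bar>?e $ j $ j\<bar> \<le> ?r * B"
      using Q[of "axis i 1"] Q[of "axis j 1"] h1(1,2) by (simp_all only: quadratic_form_axis_sum)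
    moreover have "?r * (4 * B) = 4 * (?r * B)" by simp
    ultimately have "\<bar>?e $ i $ j\<bar> \<le> 3 * (?r * B)" unfolding se by linarith
    then show ?case using r0 by (simp add: mult_ac)
  qed
  then show ?thesis by (rule rate_r) (use \<alpha> hB[of i j] in auto)
qed

definition "b0 = dr2_plus (matrix_inv (h d q0))"
text \<open>The limit of wt / r^m at the boundary point. Dividing by it makes the model matrix
  \<open>b0\<close> have the entry 1 in the normal direction.\<close>

definition "s0 = sqrt (det (dr2_plus (h d q0)))"

lemma h0_pos: "v \<noteq> 0 \<Longrightarrow> 0 < v \<bullet> (h d q0 *v v)"
  using h d q0 by (simp add: riemannian_metric_def)

lemma s0_pos: "0 < s0"
  unfolding s0_def using posdef_det_pos[OF dr2_plus_posdef[OF h0_pos]] by simp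

text \<open>Put qh = \<rho> / r, which tends to 1. The metric is qh^2 times a block matrix D, so
  with N = dim X the weight is r^m qh^(m+N) sqrt (det D) and the inverse metric is qh^(-2) times the
  inverse of D. Every factor converges at the rate \<open>dd\<close>.\<close>

lemma coefficient_rate:
  shows "rate dd F (\<lambda>x. aa s0 d x $ i $ j / x $ None powr m) (b0 $ i $ j)"
    and "rate dd F (\<lambda>x. wt d x / s0 / x $ None powr m) 1"
proof -
  let ?q = "\<lambda>x. chart_inv d (tang x)"
  obtain e :: "real \<Rightarrow> ('x, 'n) tensor2" where sym: "\<forall>r\<in>{0<..<\<epsilon>}. symmetric_tensor (bdry_charts A) (e r)"
    and eq: "\<forall>d\<in>bdry_charts A. \<forall>x\<in>fst d. \<forall>r\<in>{0<..<\<epsilon>}.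
           g (cc d) (\<kappa> (r, x)) = (\<rho> (\<kappa> (r, x)) / r)\<^sup>2 *\<^sub>R dr2_plus (h d x + r *\<^sub>R h1 d x + e r d x)"
    and lim: "uniform_limit {(d, x, v). d \<in> bdry_charts A \<and> x \<in> fst d \<and> v \<bullet> (h d x *v v) = 1}
          (\<lambda>r (d, x, v). v \<bullet> (e r d x *v v) / r) (\<lambda>_. 0) (at_right 0)"
    using g_exp unfolding metric_expansion_def by (elim exE conjE)
  define qh where "qh x = \<rho> (\<kappa> (x $ None, ?q x)) / x $ None" for x
  have Rq: "rate dd F qh 1" unfolding qh_def[abs_def] by (rule \<rho>_rate)
  define D where "D x = dr2_plus (h d (?q x) + x $ None *\<^sub>R h1 d (?q x) + e (x $ None) d (?q x))" for x
  define D0 where "D0 = dr2_plus (h d q0)"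
  have hs: "smooth_tensor (bdry_charts A) h" using h by (simp add: riemannian_metric_def)
  have "\<forall>\<^sub>F x in F. \<bar>x $ None\<bar> \<le> 1 * x $ None powr 1" using F_pos by eventually_elim simp
  then have r2: "rate dd F (\<lambda>x. x $ None) 0" by (rule rate_r) (use \<alpha> in auto)
  have "rate dd F (\<lambda>x. h d (?q x) $ i $ j + x $ None * h1 d (?q x) $ i $ j + e (x $ None) d (?q x) $ i $ j)
     (h d q0 $ i $ j + 0 * h1 d q0 $ i $ j + 0)" for i j
    by (rule rate_add[OF rate_add[OF smooth_tensor_rate[OF hs] rate_mult[OF r2 smooth_tensor_rate[OF h1] dd(2,1)]]
          remainder_rate[OF sym lim]])
  then have RD: "rate dd F (\<lambda>x. D x $ i $ j) (D0 $ i $ j)" for i j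
    unfolding D_def D0_def by (cases i; cases j) (simp_all add: rate_const[OF dd(1)])
  have D0: "0 < det D0" unfolding D0_def by (rule posdef_det_pos[OF dr2_plus_posdef[OF h0_pos]])
  have Rdet: "rate dd F (\<lambda>x. det (D x)) (det D0)" by (rule rate_det[OF RD dd(2,1)])
  have Rinv: "rate dd F (\<lambda>x. matrix_inv (D x) $ i $ j) (matrix_inv D0 $ i $ j)"
    by (rule rate_matrix_inv[OF RD dd(2,1)]) (use D0 in simp)
  have Rs: "rate dd F (\<lambda>x. sqrt (det (D x))) (sqrt (det D0))"
    by (rule rate_compose[OF Rdet DERIV_real_sqrt[OF D0] dd(2,1)])
  have Rs': "rate dd F (\<lambda>x. (1 / s0) * sqrt (det (D x))) ((1 / s0) * sqrt (det D0))"
    by (rule rate_mult[OF rate_const[OF dd(1)] Rs dd(2,1)])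
  let ?N = "CARD('n option)"
  have "((\<lambda>t. t powr m) has_real_derivative m * 1 powr (m - 1)) (at 1)" by (rule has_real_derivative_powr) simp
  from rate_compose[OF Rq this dd(2,1)] have R1: "rate dd F (\<lambda>x. qh x powr m) (1 powr m)" .
  have R2: "rate dd F (\<lambda>x. qh x ^ ?N) (1 ^ ?N)" by (rule rate_compose[OF Rq DERIV_pow dd(2,1)])
  have R3: "rate dd F (\<lambda>x. (qh x)\<^sup>2) (1\<^sup>2)" by (rule rate_compose[OF Rq DERIV_pow dd(2,1)])
  have R4: "rate dd F (\<lambda>x. inverse ((qh x)\<^sup>2)) (inverse (1\<^sup>2))"
    by (rule rate_compose[OF R3 DERIV_inverse dd(2,1)]) simp
  have ev: "\<forall>\<^sub>F x in F. wt d x / x $ None powr m = qh x powr m * qh x ^ ?N * sqrt (det (D x)) \<and>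
      matrix_inv (G d x) $ i $ j = inverse ((qh x)\<^sup>2) * matrix_inv (D x) $ i $ j"
    using F_Om tang_in
  proof eventually_elim
    case (elim x)
    have r: "0 < x $ None" "x $ None \<in> {0<..<\<epsilon>}" using elim(1) by (auto simp: Om_def)
    have c: "chart_inv (cc d) x = \<kappa> (x $ None, ?q x)" by (rule chart_inv_cc[OF d elim(1)])
    have \<rho>0: "0 < \<rho> (\<kappa> (x $ None, ?q x))"
      using interior_\<rho>[OF chart_inv_cc_in(2)[OF d elim(1)]] c by simp
    have q: "0 < qh x" using \<rho>0 r by (simp add: qh_def)
    have G: "G d x = (qh x)\<^sup>2 *\<^sub>R D x"
      using eq d elim(2) r(2) by (simp add: c qh_def D_def)
    have detG: "det (G d x) = ((qh x)\<^sup>2) ^ ?N * det (D x)" unfolding G by (rule det_scaleR)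
    have "((qh x)\<^sup>2) ^ ?N = (qh x ^ ?N)\<^sup>2" by (simp only: power_mult[symmetric] mult.commute)
    then have "sqrt (((qh x)\<^sup>2) ^ ?N) = qh x ^ ?N"
      using zero_less_power[OF q, of ?N] by (simp only: real_sqrt_abs abs_of_pos)
    then have sG: "sqrt (det (G d x)) = qh x ^ ?N * sqrt (det (D x))"
      unfolding detG real_sqrt_mult by simp
    have "(\<rho> \<circ> chart_inv (cc d)) x = qh x * x $ None" using r by (simp add: c qh_def)
    then have "(\<rho> \<circ> chart_inv (cc d)) x powr m = qh x powr m * x $ None powr m"
      using q r by (simp add: powr_mult)
    then have 1: "wt d x / x $ None powr m = qh x powr m * qh x ^ ?N * sqrt (det (D x))"
      using r unfolding wt_def sG by simp
    have "det (D x) \<noteq> 0" using G_props(3)[OF d elim(1)] unfolding detG by auto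
    then have "matrix_inv (G d x) = inverse ((qh x)\<^sup>2) *\<^sub>R matrix_inv (D x)"
      unfolding G by (rule matrix_inv_scaleR[rotated]) (use q in simp)
    then show ?case using 1 by simp
  qed
  have Rw: "rate dd F (\<lambda>x. qh x powr m * qh x ^ ?N * ((1 / s0) * sqrt (det (D x)))) (1 powr m * 1 ^ ?N * ((1 / s0) * sqrt (det D0)))"
    by (rule rate_mult[OF rate_mult[OF R1 R2 dd(2,1)] Rs' dd(2,1)])
  have s1: "(1 / s0) * sqrt (det D0) = 1" using s0_pos by (simp add: s0_def D0_def)
  have "\<forall>\<^sub>F x in F. qh x powr m * qh x ^ ?N * ((1 / s0) * sqrt (det (D x))) = wt d x / s0 / x $ None powr m"
    using ev
  proof eventually_elim
    case (elim x)
    have "wt d x / s0 / x $ None powr m = (1 / s0) * (wt d x / x $ None powr m)" by simp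
    then show ?case unfolding conjunct1[OF elim] by simp
  qed
  from rate_cong[OF Rw this] show wt1: "rate dd F (\<lambda>x. wt d x / s0 / x $ None powr m) 1"
    unfolding s1 by simp
  have "matrix_inv D0 = b0"
    unfolding D0_def b0_def by (rule matrix_inv_dr2_plus[OF posdef_det_nonzero[OF h0_pos]])
  then have Ra: "rate dd F (\<lambda>x. (wt d x / s0 / x $ None powr m) * (inverse ((qh x)\<^sup>2) * matrix_inv (D x) $ i $ j))
      (1 * (inverse (1\<^sup>2) * b0 $ i $ j))"
    using rate_mult[OF wt1 rate_mult[OF R4 Rinv dd(2,1)] dd(2,1)] by simp
  have "\<forall>\<^sub>F x in F. (wt d x / s0 / x $ None powr m) * (inverse ((qh x)\<^sup>2) * matrix_inv (D x) $ i $ j)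
      = aa s0 d x $ i $ j / x $ None powr m"
    using ev by eventually_elim (simp add: aa_def)
  from rate_cong[OF Ra this] show "rate dd F (\<lambda>x. aa s0 d x $ i $ j / x $ None powr m) (b0 $ i $ j)" by simp
qed

text \<open>Passes from the filter to one explicit ball and one constant for all entries, the form
  in which \<open>degenerate_supersolution\<close> asks for its bounds.\<close>

lemma coefficient_asymptotics:
  obtains \<delta> K where "0 < \<delta>" "0 \<le> K"
    "\<And>x. 0 < x $ None \<Longrightarrow> norm (x - x0) < \<delta> \<Longrightarrow> x \<in> Om d"
    "\<And>x i j. 0 < x $ None \<Longrightarrow> norm (x - x0) < \<delta> \<Longrightarrow>
      \<bar>aa s0 d x $ i $ j - x $ None powr m * b0 $ i $ j\<bar> \<le> K * x $ None powr m * norm (x - x0) powr \<alpha>"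
    "\<And>x. 0 < x $ None \<Longrightarrow> norm (x - x0) < \<delta> \<Longrightarrow> wt d x / s0 \<le> 2 * x $ None powr m"
proof -
  let ?P = "\<lambda>i j K. 0 \<le> K \<and> (\<forall>\<^sub>F x in F. \<bar>aa s0 d x $ i $ j / x $ None powr m - b0 $ i $ j\<bar> \<le> K * dd x)"
  have ex: "\<exists>K. ?P i j K" for i j
    by (rule rateE[OF coefficient_rate(1)[of i j] dd(1)]) blast
  define KK where "KK i j = (SOME K. ?P i j K)" for i j
  have "?P i j (KK i j)" for i j unfolding KK_def by (rule someI_ex[OF ex])
  then have KK: "\<And>i j. 0 \<le> KK i j"
      "\<And>i j. \<forall>\<^sub>F x in F. \<bar>aa s0 d x $ i $ j / x $ None powr m - b0 $ i $ j\<bar> \<le> KK i j * dd x"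
    by blast+
  define K where "K = (\<Sum>i\<in>UNIV. \<Sum>j\<in>UNIV. KK i j)"
  have K0: "0 \<le> K" unfolding K_def using KK(1) by (auto intro!: sum_nonneg)
  have KKK: "KK i j \<le> K" for i j
  proof -
    have "KK i j \<le> (\<Sum>j\<in>UNIV. KK i j)" by (rule member_le_sum) (use KK(1) in auto)
    also have "\<dots> \<le> K" unfolding K_def
      by (rule member_le_sum[of i UNIV "\<lambda>i. \<Sum>j\<in>UNIV. KK i j"]) (use KK(1) in \<open>auto intro: sum_nonneg\<close>)
    finally show ?thesis .
  qed
  have "\<forall>\<^sub>F x in F. \<forall>i\<in>UNIV. \<forall>j\<in>UNIV. \<bar>aa s0 d x $ i $ j / x $ None powr m - b0 $ i $ j\<bar> \<le> KK i j * dd x"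
    by (rule eventually_ball_finite[OF finite], rule ballI, rule eventually_ball_finite[OF finite], rule ballI, rule KK(2))
  moreover have "\<forall>\<^sub>F x in F. \<bar>wt d x / s0 / x $ None powr m\<bar> < 2"
    by (rule rate_bounded[OF coefficient_rate(2)]) simp
  ultimately have "\<forall>\<^sub>F x in F. x \<in> Om d \<and> (\<forall>i j. \<bar>aa s0 d x $ i $ j - x $ None powr m * b0 $ i $ j\<bar> \<le> K * x $ None powr m * dd x)
      \<and> wt d x / s0 \<le> 2 * x $ None powr m"
    using F_Om F_pos
  proof eventually_elim
    case (elim x)
    let ?r = "x $ None powr m"
    have r: "0 < ?r" using elim(4) by simp
    have "\<bar>aa s0 d x $ i $ j - ?r * b0 $ i $ j\<bar> \<le> K * ?r * dd x" for i j
    proof -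
      have "\<bar>aa s0 d x $ i $ j / ?r - b0 $ i $ j\<bar> \<le> K * dd x"
        using elim(1) mult_right_mono[OF KKK[of i j] dd(1)[of x]] by (meson UNIV_I order_trans)
      then have "?r * \<bar>aa s0 d x $ i $ j / ?r - b0 $ i $ j\<bar> \<le> ?r * (K * dd x)"
        using r by (intro mult_left_mono) auto
      moreover have "?r * \<bar>aa s0 d x $ i $ j / ?r - b0 $ i $ j\<bar> = \<bar>?r * (aa s0 d x $ i $ j / ?r - b0 $ i $ j)\<bar>"
        using r by (simp add: abs_mult)
      moreover have "?r * (aa s0 d x $ i $ j / ?r - b0 $ i $ j) = aa s0 d x $ i $ j - ?r * b0 $ i $ j"
        using r by (simp add: right_diff_distrib)
      ultimately show ?thesis by (simp add: mult_ac)
    qed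
    moreover have "wt d x / s0 \<le> 2 * ?r"
    proof -
      have "wt d x / s0 / ?r \<le> 2" using elim(2) by linarith
      then show ?thesis using r by (simp only: pos_divide_le_eq)
    qed
    ultimately show ?case using elim(3) by blast
  qed
  then obtain \<delta> where "0 < \<delta>" and \<delta>: "\<And>x. x \<in> {x. 0 < x $ None} \<Longrightarrow> x \<noteq> x0 \<Longrightarrow> dist x x0 < \<delta> \<Longrightarrow>
      x \<in> Om d \<and> (\<forall>i j. \<bar>aa s0 d x $ i $ j - x $ None powr m * b0 $ i $ j\<bar> \<le> K * x $ None powr m * dd x)
      \<and> wt d x / s0 \<le> 2 * x $ None powr m"
    unfolding F_def eventually_at by auto
  have ne: "x \<noteq> x0" if "0 < x $ None" for x using that by (auto simp: x0_def)
  show thesis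
    by (rule that[OF \<open>0 < \<delta>\<close> K0]) (use \<delta> ne in \<open>auto simp: dist_norm dd_def\<close>)
qed

end

end

section \<open>The lower bound along the collar\<close>

context collar_space begin

context
  fixes U :: "'x \<Rightarrow> real"
  assumes U: "smooth_function (inner_charts A) U" "continuous_on UNIV U" "\<And>q. 0 \<le> U q"
    and super: "\<And>c q. c \<in> inner_charts A \<Longrightarrow> q \<in> fst c \<Longrightarrow> 0 \<le> - weighted_laplacian g \<phi> c U q + \<psi> q * U q"
begin

lemma boundary_lower_bound:
  assumes d: "d \<in> bdry_charts A" and q0: "q0 \<in> fst d"
    and pos: "0 < \<delta>0" "\<And>x. x \<in> Om d \<Longrightarrow> norm (x - cons_vec 0 (snd d q0)) < \<delta>0 \<Longrightarrow> 0 < (U \<circ> chart_inv (cc d)) x"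
  obtains c q R1 where "0 < c" "0 < q" "q < 1" "0 < R1" "R1 < \<epsilon>"
    "\<And>k. c * (R1 * q ^ k) powr (1 - m) \<le> U (\<kappa> (R1 * q ^ k, q0))"
proof -
  let ?x0 = "cons_vec 0 (snd d q0)"
  obtain \<delta> K where \<delta>: "0 < \<delta>" and K: "0 \<le> K"
    and inOm: "\<And>x. 0 < x $ None \<Longrightarrow> norm (x - ?x0) < \<delta> \<Longrightarrow> x \<in> Om d"
    and coeff: "\<And>x i j. 0 < x $ None \<Longrightarrow> norm (x - ?x0) < \<delta> \<Longrightarrow>
      \<bar>aa (s0 d q0) d x $ i $ j - x $ None powr m * b0 d q0 $ i $ j\<bar> \<le> K * x $ None powr m * norm (x - ?x0) powr \<alpha>"
    and weight: "\<And>x. 0 < x $ None \<Longrightarrow> norm (x - ?x0) < \<delta> \<Longrightarrow> wt d x / s0 d q0 \<le> 2 * x $ None powr m"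
    using coefficient_asymptotics[OF d q0] by blast
  have s0: "0 < s0 d q0" by (rule s0_pos[OF d q0])
  obtain \<delta>1 where \<delta>1: "0 < \<delta>1" "ball (snd d q0) \<delta>1 \<subseteq> snd d ` fst d"
    using openE[OF bdry_chart_open[OF d] imageI[OF q0]] by blast
  have "bounded (\<psi> ` UNIV)" using compact_continuous_image[OF \<psi>_cont cpt] compact_imp_bounded by blast
  then obtain B where B: "\<And>q. \<bar>\<psi> q\<bar> \<le> B" by (auto simp: bounded_iff)
  have B0: "0 \<le> B" using B[of q0] by linarith
  \<comment> \<open>One constant for two purposes: K bounds the perturbation of the coefficients,
    and 2 B the zero order term, since |\<psi>| \<le> B and the normalised weight is at most 2
    r^m.\<close>
  define C where "C = max K (2 * B)"
  have C: "0 \<le> C" "K \<le> C" "2 * B \<le> C" using K by (auto simp: C_def)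
  have h0: "0 < v \<bullet> (h d q0 *v v)" if "v \<noteq> 0" for v by (rule h0_pos[OF d q0 that])
  have bpos: "0 < v \<bullet> (b0 d q0 *v v)" if "v \<noteq> 0" for v
    unfolding b0_def[OF d q0] using dr2_plus_posdef[OF posdef_inverse[OF h0] that] .
  obtain \<mu> where \<mu>: "0 < \<mu>" "\<And>v. \<mu> * (norm v)\<^sup>2 \<le> v \<bullet> (b0 d q0 *v v)"
    by (rule uniformly_elliptic_on_compact[of "{0 :: real ^ 'n}" "\<lambda>_. b0 d q0"]) (use bpos in auto)
  \<comment> \<open>The cylinder of size R0 lies within distance 2 R0 of the boundary point, so the
    thirds keep it inside each of the three balls.\<close>
  define R0 where "R0 = Min {1, \<epsilon> / 2, \<delta> / 3, \<delta>0 / 3, \<delta>1 / 3}"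
  have R0: "0 < R0" "R0 \<le> 1" "R0 < \<epsilon>" "2 * R0 < \<delta>" "2 * R0 < \<delta>0" "2 * R0 < \<delta>1"
    using \<epsilon> \<delta> pos(1) \<delta>1(1) by (auto simp: R0_def min_def)
  define p2 where "p2 x = (\<Sum>i\<in>UNIV. (x $ Some i - ?x0 $ Some i) * (x $ Some i - ?x0 $ Some i))" for x :: "real ^ 'n option"
  define Cyl where "Cyl R = {x. 0 \<le> x $ None \<and> x $ None \<le> R \<and> p2 x \<le> R\<^sup>2}" for R
  have near: "norm (x - ?x0) \<le> 2 * R0" if "x \<in> Cyl R0" for x
  proof (rule power2_le_imp_le)
    have "(norm (x - ?x0))\<^sup>2 = (x $ None)\<^sup>2 + p2 x"
      unfolding norm_vec_squared sum_UNIV_option p2_def by (simp add: power2_eq_square)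
    moreover have "(x $ None)\<^sup>2 \<le> R0\<^sup>2" using that by (intro power_mono) (auto simp: Cyl_def)
    moreover have "p2 x \<le> R0\<^sup>2" "0 \<le> R0\<^sup>2" using that by (auto simp: Cyl_def)
    moreover have "(2 * R0)\<^sup>2 = 4 * R0\<^sup>2" by (simp add: power_mult_distrib)
    ultimately show "(norm (x - ?x0))\<^sup>2 \<le> (2 * R0)\<^sup>2" by linarith
  qed (use R0 in simp)
  have tin: "tang x \<in> snd d ` fst d" if "x \<in> Cyl R0" for x
  proof -
    have "norm (tang x - snd d q0) \<le> norm (x - ?x0)" using norm_tang_le[of "x - ?x0"] by (simp add: tang_diff)
    then have "tang x \<in> ball (snd d q0) \<delta>1" using near[OF that] R0 by (simp add: dist_norm norm_minus_commute)
    then show ?thesis using \<delta>1(2) by blast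
  qed
  have CylOm: "x \<in> Om d" if "x \<in> Cyl R0" "0 < x $ None" for x
    using inOm[OF that(2)] near[OF that(1)] R0 by simp
  have eqOm: "(U \<circ> chart_inv (cc d)) x = rep U d x" if "x \<in> Om d" for x by (rule rep_eq[OF d that])
  have Cu: "C1 (Om d) (rep U d)"
    by (rule C1_cong[OF smooth_C1(1)[OF d U(1)] cc_chart(1)[OF d] eqOm])
  have pd: "pderivative j (U \<circ> chart_inv (cc d)) x = pderivative j (rep U d) x" if "x \<in> Om d" for j x
    by (rule pderivative_cong[OF cc_chart(1)[OF d] that eqOm smooth_C1(1)[OF d U(1)]])
  have Cpu: "C1 (Om d) (pderivative j (rep U d))" for j
    by (rule C1_cong[OF smooth_C1(2)[OF d U(1)] cc_chart(1)[OF d] pd])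
  have "degenerate_supersolution ?x0 (Om d) (aa (s0 d q0) d) (b0 d q0) (rep U d) m \<alpha> \<mu> C R0"
  proof (unfold_locales, fold p2_def, fold Cyl_def)
    show "open (Om d)" by (rule cc_chart(1)[OF d])
    show "C1 (Om d) (\<lambda>x. aa (s0 d q0) d x $ i $ j)" for i j by (rule aa_props(1)[OF d s0])
    show "C1 (Om d) (rep U d)" "C1 (Om d) (pderivative j (rep U d))" for j by (rule Cu, rule Cpu)
    show "continuous_on (Cyl R0) (rep U d)"
      by (rule continuous_on_subset[OF rep_cont[OF d U(2)]]) (use tin R0 in \<open>auto simp: Cyl_def\<close>)
    show "0 \<le> rep U d x" for x unfolding rep_def by (rule U(3))
    show "0 < rep U d x" if "x \<in> Cyl R0" "0 < x $ None" for x
      using pos(2)[OF CylOm[OF that]] near[OF that(1)] R0 eqOm[OF CylOm[OF that]] by simp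
    show "b0 d q0 $ None $ None = 1" "b0 d q0 $ None $ Some i = 0" "b0 d q0 $ Some i $ None = 0" for i
      by (simp_all add: b0_def[OF d q0])
    show "\<mu> * (norm v)\<^sup>2 \<le> v \<bullet> (b0 d q0 *v v)" for v by (rule \<mu>(2))
    show "\<bar>aa (s0 d q0) d x $ i $ j - x $ None powr m * b0 d q0 $ i $ j\<bar> \<le> C * x $ None powr m * norm (x - ?x0) powr \<alpha>"
      if "x \<in> Cyl R0" "0 < x $ None" for x i j
    proof -
      have "K * (x $ None powr m * norm (x - ?x0) powr \<alpha>) \<le> C * (x $ None powr m * norm (x - ?x0) powr \<alpha>)"
        using C(2) by (intro mult_right_mono) auto
      then show ?thesis using coeff[OF that(2), of i j] near[OF that(1)] R0 by (simp add: mult.assoc)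
    qed
    show "(\<Sum>i\<in>UNIV. pderivative i (\<lambda>x. \<Sum>j\<in>UNIV. aa (s0 d q0) d x $ i $ j * pderivative j (rep U d) x) x)
        \<le> C * x $ None powr m * rep U d x" if x: "x \<in> Cyl R0" "0 < x $ None" for x
    proof -
      have xO: "x \<in> Om d" by (rule CylOm[OF x])
      let ?u = "U \<circ> chart_inv (cc d)"
      have "pderivative i (\<lambda>x. \<Sum>j\<in>UNIV. aa (s0 d q0) d x $ i $ j * pderivative j ?u x) x
         = pderivative i (\<lambda>x. \<Sum>j\<in>UNIV. aa (s0 d q0) d x $ i $ j * pderivative j (rep U d) x) x" for i
        by (rule pderivative_cong[OF cc_chart(1)[OF d] xO])
           (auto simp: pd intro!: C1_sum_UNIV(1) C1_mult(1) aa_props(1)[OF d s0] smooth_C1(2)[OF d U(1)])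
      then have "(\<Sum>i\<in>UNIV. pderivative i (\<lambda>x. \<Sum>j\<in>UNIV. aa (s0 d q0) d x $ i $ j * pderivative j (rep U d) x) x)
        \<le> (\<psi> (chart_inv (cc d) x) * (wt d x / s0 d q0)) * ?u x"
        using divergence_form[OF d s0 U(1) super xO] by simp
      also have "\<dots> \<le> (B * (2 * x $ None powr m)) * ?u x"
      proof (intro mult_right_mono mult_mono)
        show "\<psi> (chart_inv (cc d) x) \<le> B" using B abs_le_D1 by blast
        show "wt d x / s0 d q0 \<le> 2 * x $ None powr m" using weight[OF x(2)] near[OF x(1)] R0 by simp
        show "0 \<le> wt d x / s0 d q0" using wt_props(2)[OF d xO] s0 by simp
      qed (use B0 U(3) in auto)
      also have "\<dots> \<le> (C * x $ None powr m) * ?u x"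
      proof (rule mult_right_mono)
        show "B * (2 * x $ None powr m) \<le> C * x $ None powr m"
          using mult_right_mono[OF C(3), of "x $ None powr m"] by (simp add: mult_ac)
      qed (simp add: U(3))
      finally show ?thesis using eqOm[OF xO] by simp
    qed
  qed (use m' \<alpha> R0 \<mu> C CylOm in auto)
  then obtain c q R1 where *: "0 < c" "0 < q" "q < 1" "0 < R1" "R1 \<le> R0"
    "\<And>k. c * (R1 * q ^ k) powr (1 - m) \<le> rep U d (?x0 + (R1 * q ^ k) *\<^sub>R axis None 1)"
    by (rule degenerate_supersolution.axis_lower_bound) (rule that; assumption)
  have "rep U d (?x0 + r *\<^sub>R axis None 1) = U (\<kappa> (r, q0))" for r
  proof -
    have "tang (?x0 + r *\<^sub>R axis None 1) = snd d q0" by (simp add: vec_eq_iff axis_def)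
    then show ?thesis unfolding rep_def using chart_inv_bdry(1)[OF d q0] by simp
  qed
  then show thesis using that[OF *(1-4)] *(5,6) R0(3) by simp
qed

section \<open>From a positive boundary value to a neighbourhood of q0\<close>

lemma positivity_spreads:
  assumes d: "d \<in> bdry_charts A" and R: "0 < R" "cball x1 R \<subseteq> Om d"
    and ux: "0 < (U \<circ> chart_inv (cc d)) x1" and y: "y \<in> ball x1 R"
  shows "0 < (U \<circ> chart_inv (cc d)) y"
proof (rule positivity_propagates[OF cc_chart(1)[OF d] _ _ smooth_C1[OF d U(1)] _ _ _ R ux y,
      where a = "aa 1 d" and K = "\<lambda>x. \<psi> (chart_inv (cc d) x) * (wt d x / 1)"])
  show "C1 (Om d) (\<lambda>x. aa 1 d x $ i $ j)" for i j by (rule aa_props(1)[OF d]) simp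
  show "0 < v \<bullet> (aa 1 d x *v v)" if "x \<in> Om d" "v \<noteq> 0" for x v by (rule aa_props(2)[OF d _ that]) simp
  show "0 \<le> (U \<circ> chart_inv (cc d)) x" for x using U(3) by simp
  have "continuous_on (Om d) (chart_inv (cc d))" using cc_chart(2)[OF d] by (simp add: homeomorphism_def)
  then show "continuous_on (Om d) (\<lambda>x. \<psi> (chart_inv (cc d) x) * (wt d x / 1))"
    by (intro continuous_intros continuous_on_compose2[OF \<psi>_cont] C1D(4)[OF wt_props(1)[OF d]]) auto
  show "(\<Sum>i\<in>UNIV. pderivative i (\<lambda>x. \<Sum>j\<in>UNIV. aa 1 d x $ i $ j * pderivative j (U \<circ> chart_inv (cc d)) x) x)
    \<le> (\<psi> (chart_inv (cc d) x) * (wt d x / 1)) * (U \<circ> chart_inv (cc d)) x" if "x \<in> Om d" for x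
    by (rule divergence_form[OF d zero_less_one U(1) super that])
qed

text \<open>The maximum principle read backwards: if U were positive at some y within R / 2 of a
  zero, it would be positive on the ball of radius R / 2 about y, which contains the zero.\<close>

lemma zero_set_open:
  assumes z: "z \<in> {0<..<\<epsilon>} \<times> bdry A" "U (\<kappa> z) = 0"
  shows "\<exists>T. openin (top_of_set ({0<..<\<epsilon>} \<times> bdry A)) T \<and> z \<in> T \<and> (\<forall>p\<in>T. U (\<kappa> p) = 0)"
proof -
  obtain r q where rq: "z = (r, q)" "r \<in> {0<..<\<epsilon>}" "q \<in> bdry A" using z by auto
  obtain d where d: "d \<in> bdry_charts A" "q \<in> fst d" using bdry_chart_cover[OF rq(3)] by blast
  let ?\<Psi> = "\<lambda>p. cons_vec (fst p) (snd d (snd p))"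
  have \<Psi>Om: "?\<Psi> p \<in> Om d" "(U \<circ> chart_inv (cc d)) (?\<Psi> p) = U (\<kappa> p)" if "p \<in> {0<..<\<epsilon>} \<times> fst d" for p
  proof -
    show *: "?\<Psi> p \<in> Om d" using that by (auto simp: Om_def)
    show "(U \<circ> chart_inv (cc d)) (?\<Psi> p) = U (\<kappa> p)"
      unfolding rep_eq[OF d(1) *] rep_def using that chart_inv_bdry(1)[OF d(1), of "snd p"] by (cases p) auto
  qed
  let ?x = "?\<Psi> z"
  have zd: "z \<in> {0<..<\<epsilon>} \<times> fst d" using rq d by simp
  obtain R where R: "0 < R" "cball ?x R \<subseteq> Om d"
    using open_contains_cball cc_chart(1)[OF d(1)] \<Psi>Om(1)[OF zd] by metis
  have zero: "(U \<circ> chart_inv (cc d)) y = 0" if y: "y \<in> ball ?x (R / 2)" for y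
  proof (rule ccontr)
    assume "(U \<circ> chart_inv (cc d)) y \<noteq> 0"
    then have uy: "0 < (U \<circ> chart_inv (cc d)) y" using U(3)[of "chart_inv (cc d) y"] by simp
    have sub: "cball y (R / 2) \<subseteq> Om d"
    proof
      fix w assume "w \<in> cball y (R / 2)"
      then have "dist ?x w \<le> R" using y dist_triangle[of ?x w y] by simp
      then show "w \<in> Om d" using R(2) by (meson mem_cball subsetD)
    qed
    have xy: "?x \<in> ball y (R / 2)" using y by (simp add: dist_commute)
    have "0 < R / 2" using R(1) by simp
    from positivity_spreads[OF d(1) this sub uy xy] show False using \<Psi>Om(2)[OF zd] z(2) by simp
  qed
  let ?W = "{0<..<\<epsilon>} \<times> fst d"
  let ?T = "?W \<inter> ?\<Psi> -` ball ?x (R / 2)"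
  have Wo: "openin (top_of_set ({0<..<\<epsilon>} \<times> bdry A)) ?W"
    by (rule openin_Times[OF _ bdry_chart_cont(2)[OF d(1)]]) simp
  have c\<Psi>: "continuous_on ?W ?\<Psi>"
    by (intro continuous_on_cons_vec continuous_on_fst continuous_on_id
        continuous_on_compose2[OF bdry_chart_cont(1)[OF d(1)] continuous_on_snd[OF continuous_on_id]]) auto
  have "openin (top_of_set ?W) ?T" by (rule continuous_openin_preimage_gen[OF c\<Psi>]) simp
  then have "openin (top_of_set ({0<..<\<epsilon>} \<times> bdry A)) ?T" using Wo by (rule openin_trans)
  moreover have "z \<in> ?T" using zd R(1) by simp
  moreover have "U (\<kappa> p) = 0" if "p \<in> ?T" for p
    using zero[of "?\<Psi> p"] that \<Psi>Om(2)[of p] by auto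
  ultimately show ?thesis by blast
qed

text \<open>The zeros of U on the product of (0, \<epsilon>) with C form a set that is open and
  closed in it, hence empty or everything. If everything, U would vanish along the collar line over
  z, against continuity at r = 0 and U z > 0.\<close>

lemma positive_on_collar_over_connected:
  assumes C: "connected C" "C \<subseteq> bdry A" and z: "z \<in> C" "0 < U z"
    and p: "r \<in> {0<..<\<epsilon>}" "q \<in> C"
  shows "0 < U (\<kappa> (r, q))"
proof (rule ccontr)
  assume "\<not> 0 < U (\<kappa> (r, q))"
  then have U0: "U (\<kappa> (r, q)) = 0" using U(3)[of "\<kappa> (r, q)"] by simp
  let ?P = "{0<..<\<epsilon>} \<times> C" and ?B = "{0<..<\<epsilon>} \<times> bdry A"
  have PB: "?P \<subseteq> ?B" using C(2) by auto
  have conP: "connected ?P" by (intro connected_Times C(1)) simp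
  have cU: "continuous_on ({0..<\<epsilon>} \<times> bdry A) (\<lambda>p. U (\<kappa> p))"
    by (rule continuous_on_compose2[OF U(2) \<kappa>_cont]) auto
  have cUP: "continuous_on ?P (\<lambda>p. U (\<kappa> p))" by (rule continuous_on_subset[OF cU]) (use C(2) in auto)
  define Z where "Z = {p \<in> ?P. U (\<kappa> p) = 0}"
  have "closedin (top_of_set ?P) Z"
    unfolding Z_def using continuous_closedin_preimage_constant[OF cUP, of 0] by simp
  moreover have "openin (top_of_set ?P) Z"
  proof (subst openin_subopen, rule ballI)
    fix p assume p: "p \<in> Z"
    then have "p \<in> ?B" "U (\<kappa> p) = 0" using PB by (auto simp: Z_def)
    from zero_set_open[OF this] obtain T where T: "openin (top_of_set ?B) T" "p \<in> T" "\<forall>p\<in>T. U (\<kappa> p) = 0" by blast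
    obtain S where S: "open S" "T = ?B \<inter> S" using T(1) by (auto simp: openin_open)
    have "?P \<inter> T = ?P \<inter> S" using S(2) PB by blast
    then have "openin (top_of_set ?P) (?P \<inter> T)" using openin_open_Int[OF S(1)] by simp
    moreover have "p \<in> ?P \<inter> T" using p T(2) by (simp add: Z_def)
    moreover have "?P \<inter> T \<subseteq> Z" using T(3) by (auto simp: Z_def)
    ultimately show "\<exists>T. openin (top_of_set ?P) T \<and> p \<in> T \<and> T \<subseteq> Z" by blast
  qed
  ultimately have "Z = {} \<or> Z = ?P" using conP unfolding connected_clopen by blast
  moreover have "(r, q) \<in> Z" using p U0 by (simp add: Z_def)
  ultimately have ZP: "Z = ?P" by blast
  have zB: "z \<in> bdry A" using z(1) C(2) by blast
  have at_Ico: "at 0 within {0..<\<epsilon>} = at_right 0"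
    by (rule at_within_nhd[of _ "{..<\<epsilon>}"]) (use \<epsilon> in auto)
  have "continuous_on {0..<\<epsilon>} (\<lambda>t. U (\<kappa> (t, z)))"
    by (rule continuous_on_compose2[OF cU]) (use zB in \<open>auto intro!: continuous_intros\<close>)
  then have "((\<lambda>t. U (\<kappa> (t, z))) \<longlongrightarrow> U (\<kappa> (0, z))) (at 0 within {0..<\<epsilon>})"
    using \<epsilon> by (simp add: continuous_on_def)
  then have "((\<lambda>t. U (\<kappa> (t, z))) \<longlongrightarrow> U z) (at_right 0)"
    using at_Ico \<kappa>_0[OF zB] by simp
  then have "\<forall>\<^sub>F t in at_right 0. 0 < U (\<kappa> (t, z))" by (rule order_tendstoD(1)[OF _ z(2)])
  moreover have "\<forall>\<^sub>F t in at_right 0. t \<in> {0<..<\<epsilon>}" using \<epsilon> by (intro eventually_at_rightI[of 0 \<epsilon>]) auto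
  ultimately have "\<forall>\<^sub>F t in at_right (0::real). False"
  proof eventually_elim
    case (elim t)
    then have "(t, z) \<in> Z" using ZP z(1) by simp
    then show ?case using elim(1) by (simp add: Z_def)
  qed
  then show False by simp
qed

text \<open>C will be a curve, over which positivity says nothing about a full neighbourhood of q0.
  Adding a coordinate ball around q0 keeps the set connected and covers one.\<close>

lemma lower_bound_along_sequence:
  assumes C: "connected C" "C \<subseteq> bdry A" and z: "z \<in> C" "0 < U z" and q0: "q0 \<in> C"
  obtains c q R1 where "0 < c" "0 < q" "q < 1" "0 < R1" "R1 < \<epsilon>"
    "\<And>k. c * (R1 * q ^ k) powr (1 - m) \<le> U (\<kappa> (R1 * q ^ k, q0))"
proof -
  have q0B: "q0 \<in> bdry A" using q0 C by blast
  obtain d where d: "d \<in> bdry_charts A" "q0 \<in> fst d" using bdry_chart_cover[OF q0B] by blast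
  obtain \<delta> where \<delta>: "0 < \<delta>" "ball (snd d q0) \<delta> \<subseteq> snd d ` fst d"
    using openE[OF bdry_chart_open[OF d(1)] imageI[OF d(2)]] by blast
  define D where "D = chart_inv d ` ball (snd d q0) \<delta>"
  have cD: "connected D" unfolding D_def
    by (rule connected_continuous_image[OF continuous_on_subset[OF chart_inv_bdry_cont[OF d(1)] \<delta>(2)]]) simp
  have DB: "D \<subseteq> bdry A"
    unfolding D_def using chart_inv_bdry(2)[OF d(1)] \<delta>(2) fst_bdry_chart[OF d(1)] by blast
  have q0D: "q0 \<in> D"
    unfolding D_def using chart_inv_bdry(1)[OF d] \<delta>(1) by (metis centre_in_ball imageI)
  have con: "connected (C \<union> D)" by (rule connected_Un[OF C(1) cD]) (use q0 q0D in blast)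
  have sub: "C \<union> D \<subseteq> bdry A" using C(2) DB by blast
  have "0 < (U \<circ> chart_inv (cc d)) x" if x: "x \<in> Om d" "norm (x - cons_vec 0 (snd d q0)) < \<delta>" for x
  proof -
    have "norm (tang x - snd d q0) < \<delta>"
      using norm_tang_le[of "x - cons_vec 0 (snd d q0)"] x(2) by (simp add: tang_diff)
    then have "chart_inv d (tang x) \<in> C \<union> D"
      unfolding D_def by (simp add: dist_norm norm_minus_commute)
    moreover have "x $ None \<in> {0<..<\<epsilon>}" using x(1) by (simp add: Om_def)
    ultimately have "0 < U (\<kappa> (x $ None, chart_inv d (tang x)))"
      using positive_on_collar_over_connected[OF con sub _ z(2)] z(1) by blast
    then show ?thesis unfolding rep_eq[OF d(1) x(1)] rep_def .
  qed
  from boundary_lower_bound[OF d \<delta>(1) this] show thesis using that by metis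
qed


section \<open>The derivative with respect to \<rho> along a collar line\<close>

lemma collar_path_derivative:
  assumes W: "smooth_function (inner_charts A) W" and q0: "q0 \<in> bdry A" and r: "r \<in> {0<..<\<epsilon>}"
  shows "\<exists>D. ((\<lambda>r. W (\<kappa> (r, q0))) has_real_derivative D) (at r)"
proof -
  obtain d where d: "d \<in> bdry_charts A" "q0 \<in> fst d" using bdry_chart_cover[OF q0] by blast
  let ?p = "\<lambda>r. cons_vec r (snd d q0)" and ?W = "W \<circ> chart_inv (cc d)"
  have Om: "?p r \<in> Om d" if "r \<in> {0<..<\<epsilon>}" for r using that d(2) by (simp add: Om_def)
  have eq: "?W (?p r) = W (\<kappa> (r, q0))" if "r \<in> {0<..<\<epsilon>}" for r
    unfolding rep_eq[OF d(1) Om[OF that]] rep_def using chart_inv_bdry(1)[OF d] by simp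
  have "?p = (\<lambda>r. cons_vec 0 (snd d q0) + r *\<^sub>R axis None 1)"
  proof
    fix r
    have "?p r $ k = (cons_vec 0 (snd d q0) + r *\<^sub>R axis None 1) $ k" for k
      by (cases k) (simp_all add: axis_def)
    then show "?p r = cons_vec 0 (snd d q0) + r *\<^sub>R axis None 1" by (simp add: vec_eq_iff)
  qed
  then have dp: "(?p has_derivative (\<lambda>h. h *\<^sub>R axis None 1)) (at r)"
    by (auto intro!: derivative_eq_intros)
  have "((\<lambda>r. ?W (?p r)) has_derivative (\<lambda>h. grad ?W (?p r) \<bullet> (h *\<^sub>R axis None 1))) (at r)"
    by (rule has_derivative_compose[OF dp C1D(1)[OF smooth_C1(1)[OF d(1) W] Om[OF r]]])
  then have "((\<lambda>r. ?W (?p r)) has_real_derivative (grad ?W (?p r) \<bullet> axis None 1)) (at r)"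
    by (simp add: has_field_derivative_def mult_commute_abs)
  then have "((\<lambda>r. W (\<kappa> (r, q0))) has_real_derivative (grad ?W (?p r) \<bullet> axis None 1)) (at r)"
    by (rule has_field_derivative_transform_within_open[of _ _ _ "{0<..<\<epsilon>}"]) (use r eq in auto)
  then show ?thesis by blast
qed

text \<open>The lower bound for U is in powers of r, the derivative in the claim is with respect to
  \<rho>; this comparison lets them meet.\<close>

lemma \<rho>_le_twice:
  assumes q0: "q0 \<in> bdry A"
  shows "\<forall>\<^sub>F r in at_right 0. \<rho> (\<kappa> (r, q0)) < 2 * r"
proof -
  obtain d where d: "d \<in> bdry_charts A" "q0 \<in> fst d" using bdry_chart_cover[OF q0] by blast
  let ?x0 = "cons_vec 0 (snd d q0)"
  have lim: "((\<lambda>x. \<rho> (\<kappa> (x $ None, chart_inv d (tang x))) / x $ None) \<longlongrightarrow> 1) (at ?x0 within {x. 0 < x $ None})"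
    by (rule rate_tendsto[OF \<rho>_rate[OF d] dd(2)[OF d]])
  have "isCont (\<lambda>r. cons_vec r (snd d q0)) 0"
    using continuous_on_cons_vec[OF continuous_on_id continuous_on_const, of UNIV "snd d q0"]
    by (simp add: continuous_on_eq_continuous_at)
  then have "((\<lambda>r. cons_vec r (snd d q0)) \<longlongrightarrow> ?x0) (at_right 0)"
    unfolding isCont_def by (rule tendsto_within_subset) simp
  moreover have "\<forall>\<^sub>F r in at_right 0. cons_vec r (snd d q0) \<in> {x. 0 < x $ None} \<and> cons_vec r (snd d q0) \<noteq> ?x0"
    using eventually_at_right_less[of "0::real"]
  proof eventually_elim
    case (elim r)
    have "cons_vec r (snd d q0) \<noteq> ?x0"
    proof
      assume "cons_vec r (snd d q0) = ?x0"
      then have "cons_vec r (snd d q0) $ None = ?x0 $ None" by (rule arg_cong)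
      then show False using elim by simp
    qed
    then show ?case using elim by simp
  qed
  ultimately have "filterlim (\<lambda>r. cons_vec r (snd d q0)) (at ?x0 within {x. 0 < x $ None}) (at_right 0)"
    by (simp add: filterlim_at)
  from filterlim_compose[OF lim this] have "((\<lambda>r. \<rho> (\<kappa> (r, q0)) / r) \<longlongrightarrow> 1) (at_right 0)"
    using chart_inv_bdry(1)[OF d] by simp
  then have "\<forall>\<^sub>F r in at_right 0. \<rho> (\<kappa> (r, q0)) / r < 2" by (rule order_tendstoD(2)) simp
  then show ?thesis using eventually_at_right_less[of "0::real"]
    by eventually_elim (simp add: pos_divide_less_eq)
qed

text \<open>If \<open>\<sigma>\<^sup>m \<partial>U/\<partial>\<sigma> < \<delta>\<close> near the boundary, then \<open>U \<le> \<delta> \<sigma>\<^sup>1\<^sup>-\<^sup>m / (1 - m)\<close>, which contradicts the lower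
  bound for small \<open>\<delta>\<close>.\<close>

lemma Limsup_rho_derivative_pos:
  assumes q0: "q0 \<in> bdry A" "U q0 = 0"
    and c: "0 < c" and q: "0 < q" "q < 1" and R1: "0 < R1" "R1 < \<epsilon>"
    and low: "\<And>k. c * (R1 * q ^ k) powr (1 - m) \<le> U (\<kappa> (R1 * q ^ k, q0))"
  shows "0 < Limsup (at_right 0) (\<lambda>\<sigma>. ereal (\<sigma> powr m * rho_derivative \<epsilon> \<kappa> \<rho> U q0 \<sigma>))"
proof (rule ccontr)
  assume "\<not> ?thesis"
  then have L: "Limsup (at_right 0) (\<lambda>\<sigma>. ereal (\<sigma> powr m * rho_derivative \<epsilon> \<kappa> \<rho> U q0 \<sigma>)) \<le> 0" by simp
  define f where "f r = \<rho> (\<kappa> (r, q0))" for r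
  define v where "v r = U (\<kappa> (r, q0))" for r
  \<comment> \<open>Chosen so that the upper bound \<delta> / (1 - m) * (2 r)^(1-m) is exactly half
    of the lower bound c r^(1-m).\<close>
  define \<delta> where "\<delta> = c * (1 - m) / (2 * 2 powr (1 - m))"
  have \<delta>: "0 < \<delta>" using c m' by (simp add: \<delta>_def)
  have cont: "continuous_on {0..<\<epsilon>} (\<lambda>r. W (\<kappa> (r, q0)))" if "continuous_on UNIV W" for W :: "'x \<Rightarrow> real"
    by (rule continuous_on_compose2[OF that continuous_on_compose2[OF \<kappa>_cont]])
       (use q0 in \<open>auto intro!: continuous_intros\<close>)
  have cf: "continuous_on {0..<\<epsilon>} f" unfolding f_def by (rule cont[OF \<rho>_cont])
  have cv: "continuous_on {0..<\<epsilon>} v" unfolding v_def by (rule cont[OF U(2)])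
  have f0: "f 0 = 0" using q0(1) \<rho>_zero \<kappa>_0 by (auto simp: f_def)
  have v0: "v 0 = 0" using q0 \<kappa>_0 by (simp add: v_def)
  have df: "(f has_real_derivative deriv f r) (at r)" "0 < deriv f r" if r: "r \<in> {0<..<\<epsilon>}" for r
  proof -
    obtain D where D: "(f has_real_derivative D) (at r)"
      using collar_path_derivative[OF \<rho>_smooth q0(1) r] unfolding f_def by blast
    then show "(f has_real_derivative deriv f r) (at r)" using DERIV_imp_deriv by blast
    show "0 < deriv f r" using \<rho>_coord q0(1) r unfolding rho_is_coordinate_def f_def by blast
  qed
  have dv: "(v has_real_derivative deriv v r) (at r)" if r: "r \<in> {0<..<\<epsilon>}" for r
  proof -
    obtain D where D: "(v has_real_derivative D) (at r)"
      using collar_path_derivative[OF U(1) q0(1) r] unfolding v_def by blast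
    then show ?thesis using DERIV_imp_deriv by blast
  qed
  have mono: "f r < f r'" if "0 \<le> r" "r < r'" "r' < \<epsilon>" for r r'
  proof (rule DERIV_pos_imp_increasing_open[OF that(2)])
    show "\<exists>y. (f has_real_derivative y) (at x) \<and> 0 < y" if "r < x" "x < r'" for x
      using df[of x] that \<open>0 \<le> r\<close> \<open>r' < \<epsilon>\<close> by (intro exI[of _ "deriv f x"]) auto
    show "continuous_on {r..r'} f" by (rule continuous_on_subset[OF cf]) (use that in auto)
  qed
  have f_pos: "0 < f r" if "r \<in> {0<..<\<epsilon>}" for r using mono[of 0 r] f0 that by simp
  \<comment> \<open>The inverse of \<rho> along the collar line, in the form used by
    \<open>in_rho_coordinate\<close>; strict monotonicity of f makes the description
    definite.\<close>
  define Gi where "Gi \<sigma> = (THE r. r \<in> {0<..<\<epsilon>} \<and> f r = \<sigma>)" for \<sigma>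
  have Gi: "Gi (f r) = r" if "r \<in> {0<..<\<epsilon>}" for r
    unfolding Gi_def
  proof (rule the_equality)
    show "r' = r" if "r' \<in> {0<..<\<epsilon>} \<and> f r' = f r" for r'
    proof (rule ccontr)
      assume "r' \<noteq> r"
      then consider "r' < r" | "r < r'" by linarith
      then show False
        by cases (use mono[of r r'] mono[of r' r] that \<open>r \<in> {0<..<\<epsilon>}\<close> in simp_all)
    qed
  qed (use that in simp)
  have fc: "isCont f r" if "r \<in> {0<..<\<epsilon>}" for r using df(1)[OF that] DERIV_isCont by blast
  \<comment> \<open>The chain rule through the inverse function. It replaces the derivative in
    \<rho> by derivatives in r, so that the monotonicity argument below runs in the variable
    r.\<close>
  have du: "rho_derivative \<epsilon> \<kappa> \<rho> U q0 (f r) * deriv f r = deriv v r" if r: "r \<in> {0<..<\<epsilon>}" for r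
  proof -
    define a b where "a = r / 2" and "b = (r + \<epsilon>) / 2"
    have ab: "0 < a" "a < r" "r < b" "b < \<epsilon>" using r by (auto simp: a_def b_def)
    have "isCont Gi (f r)"
      by (rule isCont_inverse_function2[OF ab(2,3)]) (use Gi fc ab in auto)
    have G: "(Gi has_real_derivative inverse (deriv f r)) (at (f r))"
    proof (rule DERIV_inverse_function[of f, OF _ _ _ _ _ \<open>isCont Gi (f r)\<close>])
      show "(f has_real_derivative deriv f r) (at (Gi (f r)))" using df(1)[OF r] Gi[OF r] by simp
      show "deriv f r \<noteq> 0" using df(2)[OF r] by simp
      show "f a < f r" "f r < f b" using mono ab by auto
      show "f (Gi y) = y" if y: "f a < y" "y < f b" for y
      proof -
        have "continuous_on {a..b} f" by (rule continuous_on_subset[OF cf]) (use ab in auto)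
        then obtain t where "a \<le> t" "t \<le> b" "f t = y"
          using IVT'[of f a y b] y ab by auto
        then show ?thesis using Gi[of t] ab by auto
      qed
    qed
    have "(v has_real_derivative deriv v r) (at (Gi (f r)))" using dv[OF r] Gi[OF r] by simp
    from DERIV_chain2[OF this G]
    have "((\<lambda>\<sigma>. v (Gi \<sigma>)) has_real_derivative deriv v r * inverse (deriv f r)) (at (f r))" .
    moreover have "in_rho_coordinate \<epsilon> \<kappa> \<rho> U q0 = (\<lambda>\<sigma>. v (Gi \<sigma>))"
      by (simp add: in_rho_coordinate_def v_def Gi_def f_def fun_eq_iff)
    ultimately have "rho_derivative \<epsilon> \<kappa> \<rho> U q0 (f r) = deriv v r * inverse (deriv f r)"
      unfolding rho_derivative_def by (simp add: DERIV_imp_deriv)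
    then show ?thesis using df(2)[OF r] by simp
  qed
  have "Limsup (at_right 0) (\<lambda>\<sigma>. ereal (\<sigma> powr m * rho_derivative \<epsilon> \<kappa> \<rho> U q0 \<sigma>)) < ereal \<delta>"
    using L \<delta> by (simp add: le_less_trans)
  then have evs: "\<forall>\<^sub>F \<sigma> in at_right 0. \<sigma> powr m * rho_derivative \<epsilon> \<kappa> \<rho> U q0 \<sigma> < \<delta>"
    using Limsup_lessD by fastforce
  have at_Ico: "at 0 within {0..<\<epsilon>} = at_right 0"
    by (rule at_within_nhd[of _ "{..<\<epsilon>}"]) (use \<epsilon> in auto)
  have in_Ioo: "\<forall>\<^sub>F r in at_right 0. r \<in> {0<..<\<epsilon>}" using eventually_at_right_real[OF \<epsilon>] .
  have "(f \<longlongrightarrow> 0) (at_right 0)" using cf \<epsilon> at_Ico f0 by (force simp: continuous_on_def)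
  moreover have "\<forall>\<^sub>F r in at_right 0. 0 < f r" using in_Ioo by eventually_elim (rule f_pos)
  ultimately have "filterlim f (at_right 0) (at_right 0)" by (rule tendsto_imp_filterlim_at_right)
  from eventually_compose_filterlim[OF evs this]
  have "\<forall>\<^sub>F r in at_right 0. f r powr m * rho_derivative \<epsilon> \<kappa> \<rho> U q0 (f r) < \<delta>" .
  with in_Ioo \<rho>_le_twice[OF q0(1)]
  have "\<forall>\<^sub>F r in at_right 0. r \<in> {0<..<\<epsilon>} \<and> f r < 2 * r \<and> f r powr m * rho_derivative \<epsilon> \<kappa> \<rho> U q0 (f r) < \<delta>"
    unfolding f_def by eventually_elim blast
  then obtain b where b: "0 < b" "\<And>r. 0 < r \<Longrightarrow> r < b \<Longrightarrow> r \<in> {0<..<\<epsilon>} \<and> f r < 2 * r \<and> f r powr m * rho_derivative \<epsilon> \<kappa> \<rho> U q0 (f r) < \<delta>"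
    unfolding eventually_at_right_field by blast
  have upper: "v r \<le> \<delta> / (1 - m) * f r powr (1 - m)" if r: "0 < r" "r < b" for r
  proof -
    define w where "w t = \<delta> / (1 - m) * f t powr (1 - m) - v t" for t
    have rb: "t \<in> {0<..<\<epsilon>}" if "0 < t" "t \<le> r" for t using b(2)[of t] that r by simp
    have "w 0 \<le> w r"
    proof (rule DERIV_nonneg_imp_increasing_open[OF less_imp_le[OF r(1)]])
      have sub: "{0..r} \<subseteq> {0..<\<epsilon>}" using rb[OF r(1)] by auto
      show "continuous_on {0..r} w" unfolding w_def
      proof (intro continuous_on_diff continuous_on_mult continuous_on_const continuous_on_powr')
        show "continuous_on {0..r} f" "continuous_on {0..r} v" using cf cv sub continuous_on_subset by blast+
        show "\<forall>t\<in>{0..r}. 0 \<le> f t \<and> (f t = 0 \<longrightarrow> 0 < 1 - m)"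
          using \<rho>_nonneg m' by (auto simp: f_def)
      qed
      fix t assume t: "0 < t" "t < r"
      have te: "t \<in> {0<..<\<epsilon>}" using rb t by simp
      have "((\<lambda>t. f t powr (1 - m)) has_real_derivative (1 - m) * f t powr (1 - m - 1) * deriv f t) (at t)"
        using DERIV_chain2[OF has_real_derivative_powr[OF f_pos[OF te]] df(1)[OF te]] .
      from DERIV_diff[OF DERIV_cmult[OF this, of "\<delta> / (1 - m)"] dv[OF te]]
      have "(w has_real_derivative (\<delta> / (1 - m) * ((1 - m) * f t powr (1 - m - 1) * deriv f t) - deriv v t)) (at t)"
        unfolding w_def .
      moreover have "\<delta> / (1 - m) * ((1 - m) * f t powr (1 - m - 1) * deriv f t) = \<delta> * f t powr (- m) * deriv f t"
        using m' by simp
      moreover have "deriv v t \<le> \<delta> * f t powr (- m) * deriv f t"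
      proof -
        have "f t powr m * rho_derivative \<epsilon> \<kappa> \<rho> U q0 (f t) \<le> \<delta>" using b(2)[of t] t r by simp
        then have "f t powr (- m) * (f t powr m * rho_derivative \<epsilon> \<kappa> \<rho> U q0 (f t)) \<le> f t powr (- m) * \<delta>"
          by (rule mult_left_mono) simp
        moreover have "f t powr (- m) * (f t powr m * rho_derivative \<epsilon> \<kappa> \<rho> U q0 (f t)) = rho_derivative \<epsilon> \<kappa> \<rho> U q0 (f t)"
          using f_pos[OF te] by (simp add: mult.assoc[symmetric] powr_add[symmetric])
        ultimately have "rho_derivative \<epsilon> \<kappa> \<rho> U q0 (f t) * deriv f t \<le> (f t powr (- m) * \<delta>) * deriv f t"
          using df(2)[OF te] by (intro mult_right_mono) auto
        then show ?thesis using du[OF te] by (simp add: mult_ac)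
      qed
      ultimately show "\<exists>y. (w has_real_derivative y) (at t) \<and> 0 \<le> y" by auto
    qed
    then show ?thesis using f0 v0 m' by (simp add: w_def)
  qed
  have "(\<lambda>k. R1 * q ^ k) \<longlonglongrightarrow> R1 * 0"
    by (rule tendsto_mult_left, rule LIMSEQ_power_zero) (use q in simp)
  then have "\<forall>\<^sub>F k in sequentially. R1 * q ^ k < b"
    using order_tendstoD(2)[of _ "R1 * 0" sequentially b] b(1) by simp
  then obtain k where k: "R1 * q ^ k < b" using eventually_happens'[OF sequentially_bot] by blast
  let ?r = "R1 * q ^ k"
  have r: "0 < ?r" using R1 q by simp
  have "c * ?r powr (1 - m) \<le> \<delta> / (1 - m) * f ?r powr (1 - m)"
    using low[of k] upper[OF r k] by (simp add: v_def)
  also have "\<dots> \<le> \<delta> / (1 - m) * (2 * ?r) powr (1 - m)"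
  proof (rule mult_left_mono)
    show "f ?r powr (1 - m) \<le> (2 * ?r) powr (1 - m)"
      by (rule powr_mono2) (use b(2)[OF r k] f_pos[of ?r] m' in auto)
  qed (use \<delta> m' in simp)
  also have "\<dots> = c / 2 * ?r powr (1 - m)"
  proof -
    have "(2 * ?r) powr (1 - m) = 2 powr (1 - m) * ?r powr (1 - m)" using r by (simp only: powr_mult)
    then show ?thesis using m' by (simp add: \<delta>_def)
  qed
  finally have "c * ?r powr (1 - m) \<le> c / 2 * ?r powr (1 - m)" .
  moreover have "0 < ?r powr (1 - m)" using r unfolding powr_gt_zero by (rule less_imp_neq[symmetric])
  ultimately show False using c by (simp only: mult_le_cancel_right_pos)
qed

end

end

section \<open>Boundary curves and the conclusion\<close>

lemma riemannian_dist_self: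
  assumes "p \<in> (\<Union>c\<in>B. fst c)"
  shows "riemannian_dist B h p p = 0"
proof -
  let ?\<gamma> = "\<lambda>_::real. p"
  have "piecewise_C1_curve B ?\<gamma>"
    unfolding piecewise_C1_curve_def
    using assms by (auto intro!: exI[of _ "{}"] simp: o_def C1_differentiable_on_def intro: exI[of _ "\<lambda>_. 0"])
  moreover have "speed B h ?\<gamma> t = 0" for t
    unfolding speed_def Let_def by (simp add: o_def)
  ultimately have "riemannian_dist B h p p \<le> (\<integral>\<^sup>+t\<in>{0..1}. ennreal 0 \<partial>lborel)"
    unfolding riemannian_dist_def by (intro INF_lower2[of ?\<gamma>]) auto
  then show ?thesis by simp
qed

text \<open>An infimum over no curves is infinite, so a finite distance provides a curve; only its
  continuity matters for connectedness.\<close>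

lemma riemannian_dist_finite_path:
  assumes "riemannian_dist B h x y < ennreal s"
  obtains \<gamma> where "continuous_on {0..1} \<gamma>" "\<gamma> ` {0..1} \<subseteq> (\<Union>c\<in>B. fst c)" "\<gamma> 0 = x" "\<gamma> (1::real) = y"
proof -
  have "{\<gamma>. piecewise_C1_curve B \<gamma> \<and> \<gamma> 0 = x \<and> \<gamma> 1 = y} \<noteq> {}"
  proof
    assume e: "{\<gamma>. piecewise_C1_curve B \<gamma> \<and> \<gamma> 0 = x \<and> \<gamma> 1 = y} = {}"
    have "riemannian_dist B h x y = top" unfolding riemannian_dist_def e by simp
    then show False using assms by simp
  qed
  then show thesis using that unfolding piecewise_C1_curve_def by blast
qed

text \<open>U is only continuous up to the boundary, so the conclusion covers every possible limit
  in the extended reals and, to have content when there is none, the upper limit as well. The former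
  follows from the latter.\<close>

theorem proposition7p1:
  fixes A :: "('x::{t2_space, second_countable_topology}, real ^ ('n::finite option)) chart set"
    and g :: "('x, 'n option) tensor2"
    and h h1 :: "('x, 'n) tensor2"
    and \<rho> \<phi> \<Phi> \<rho>1 \<psi> :: "'x \<Rightarrow> real"
    and \<kappa> :: "real \<times> 'x \<Rightarrow> 'x"
    and m \<epsilon> :: real
  assumes "manifold_with_boundary A"
    and "compact (UNIV :: 'x set)"
    and "bdry A \<noteq> {}"
    and "riemannian_metric (inner_charts A) g"
    and "m \<in> {-1<..<1}"
    and "smooth_function (inner_charts A) \<rho>" "continuous_on UNIV \<rho>"
    and "\<And>q. 0 \<le> \<rho> q" "{q. \<rho> q = 0} = bdry A"
    and "\<And>q. q \<in> manifold_interior A \<Longrightarrow> \<rho> q powr m = exp (- \<phi> q)"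
    and "is_collar A \<epsilon> \<kappa>"
    and "smooth_function (bdry_charts A) \<Phi>" "smooth_function (bdry_charts A) \<rho>1"
    and "riemannian_metric (bdry_charts A) h"
    and "symmetric_tensor (bdry_charts A) h1" "smooth_tensor (bdry_charts A) h1"
    and "rho_expansion A \<kappa> m \<rho> \<Phi> \<rho>1"
    and "metric_expansion A \<epsilon> \<kappa> \<rho> g h h1"
    and "rho_is_coordinate A \<epsilon> \<kappa> \<rho>"
    and "smooth_function (inner_charts A) \<psi>" "continuous_on UNIV \<psi>"
  shows "\<exists>s>0. \<forall>s0 (U :: 'x \<Rightarrow> real) q0 p.
    0 < s0 \<and> s0 < s \<and>
    smooth_function (inner_charts A) U \<and> continuous_on UNIV U \<and> (\<forall>q. 0 \<le> U q) \<and>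
    (\<forall>c\<in>inner_charts A. \<forall>q\<in>fst c. 0 \<le> - weighted_laplacian g \<phi> c U q + \<psi> q * U q) \<and>
    q0 \<in> bdry A \<and> U q0 = 0 \<and>
    p \<in> bdry A \<and>
    q0 \<in> boundary_ball A h p s0 - top_of_set (bdry A) closure_of boundary_ball A h p (s0 / 2) \<and>
    (\<forall>q \<in> top_of_set (bdry A) frontier_of boundary_ball A h p (s0 / 2). 0 < U q)
    \<longrightarrow>
    (\<forall>L :: ereal. ((\<lambda>\<sigma>. ereal (\<sigma> powr m * rho_derivative \<epsilon> \<kappa> \<rho> U q0 \<sigma>)) \<longlongrightarrow> L) (at_right 0)
       \<longrightarrow> 0 < L) \<and>
    0 < Limsup (at_right 0) (\<lambda>\<sigma>. ereal (\<sigma> powr m * rho_derivative \<epsilon> \<kappa> \<rho> U q0 \<sigma>))"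
proof (rule exI[of _ 1], rule conjI[OF zero_less_one], intro allI impI, elim conjE)
  fix s0 :: real and U :: "'x \<Rightarrow> real" and q0 p :: 'x
  assume s0: "0 < s0"
    and U: "smooth_function (inner_charts A) U" "continuous_on UNIV U" "\<forall>q. 0 \<le> U q"
    and super: "\<forall>c\<in>inner_charts A. \<forall>q\<in>fst c. 0 \<le> - weighted_laplacian g \<phi> c U q + \<psi> q * U q"
    and q0: "q0 \<in> bdry A" "U q0 = 0" and p: "p \<in> bdry A"
    and q0': "q0 \<in> boundary_ball A h p s0 - top_of_set (bdry A) closure_of boundary_ball A h p (s0 / 2)"
    and fr: "\<forall>q \<in> top_of_set (bdry A) frontier_of boundary_ball A h p (s0 / 2). 0 < U q"
  interpret collar_space A g h h1 \<rho> \<phi> \<Phi> \<rho>1 \<psi> \<kappa> m \<epsilon>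
    by unfold_locales (use assms in auto)
  let ?X = "top_of_set (bdry A)" and ?B = "boundary_ball A h p (s0 / 2)"
  have cover: "(\<Union>d\<in>bdry_charts A. fst d) = bdry A"
    using fst_bdry_chart bdry_chart_cover by blast
  have "riemannian_dist (bdry_charts A) h q0 p < ennreal s0" using q0' by (simp add: boundary_ball_def)
  then obtain \<gamma> where \<gamma>: "continuous_on {0..1} \<gamma>" "\<gamma> ` {0..1} \<subseteq> bdry A" "\<gamma> 0 = q0" "\<gamma> (1::real) = p"
    by (rule riemannian_dist_finite_path) (use cover in auto)
  let ?C = "\<gamma> ` {0..1}"
  have conC: "connected ?C" by (rule connected_continuous_image[OF \<gamma>(1)]) simp
  have qC: "q0 \<in> ?C" "p \<in> ?C" using \<gamma>(3,4) by force+
  have pB: "p \<in> ?B"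
    using p s0 riemannian_dist_self[of p "bdry_charts A" h] cover by (simp add: boundary_ball_def)
  have "?B \<subseteq> ?X closure_of ?B" by (rule closure_of_subset) (auto simp: boundary_ball_def)
  then have q0B: "q0 \<notin> ?B" using q0' by blast
  have "?C \<inter> ?X frontier_of ?B \<noteq> {}"
  proof (rule connectedin_Int_frontier_of)
    show "connectedin ?X ?C" using conC \<gamma>(2) by (simp add: connectedin_subtopology)
    show "?C \<inter> ?B \<noteq> {}" "?C - ?B \<noteq> {}" using qC pB q0B by blast+
  qed
  then obtain z where z: "z \<in> ?C" "0 < U z" using fr by blast
  obtain c q R1 where *: "0 < c" "0 < q" "q < 1" "0 < R1" "R1 < \<epsilon>"
    "\<And>k. c * (R1 * q ^ k) powr (1 - m) \<le> U (\<kappa> (R1 * q ^ k, q0))"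
    by (rule lower_bound_along_sequence[OF U(1,2) _ _ conC \<gamma>(2) z qC(1)]) (use U(3) super in auto)
  have Limsup: "0 < Limsup (at_right 0) (\<lambda>\<sigma>. ereal (\<sigma> powr m * rho_derivative \<epsilon> \<kappa> \<rho> U q0 \<sigma>))"
    by (rule Limsup_rho_derivative_pos[OF U(1,2) _ _ q0 *]) (use U(3) super in auto)
  moreover have "0 < L" if "((\<lambda>\<sigma>. ereal (\<sigma> powr m * rho_derivative \<epsilon> \<kappa> \<rho> U q0 \<sigma>)) \<longlongrightarrow> L) (at_right 0)" for L
    using lim_imp_Limsup[OF trivial_limit_at_right_real that] Limsup by simp
  ultimately show "(\<forall>L :: ereal. ((\<lambda>\<sigma>. ereal (\<sigma> powr m * rho_derivative \<epsilon> \<kappa> \<rho> U q0 \<sigma>)) \<longlongrightarrow> L) (at_right 0)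
       \<longrightarrow> 0 < L) \<and>
    0 < Limsup (at_right 0) (\<lambda>\<sigma>. ereal (\<sigma> powr m * rho_derivative \<epsilon> \<kappa> \<rho> U q0 \<sigma>))" by blast
qed

end
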